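(* Let $n\ge2$. In the semidirect product $\mathcal{B}_n\ltimes C_2^{*n}$, the subgroup $\mathcal{B}_n\ltimes\Phi_{n-1}$ is isomorphic to $\mathrm{Art}\langle D_n\rangle$ via an isomorphism with $d_i\mapsto\sigma_i$ for $i\in\{1,\dots,n-1\}$ and $d_n\mapsto\sigma_{n-1}\tau_n\tau_{n-1}$.
   Context: $C_2^{*n}$ is the group with generators $\tau_1,\dots,\tau_n$ and relations $\tau_k^2=1$. $\Sigma_{0,1,n}$ is the free group on $t_1,\dots,t_n$, with $z_1=(t_1\cdots t_n)^{-1}$. Automorphisms act on the right as exponents and compose left to right, and $a^b:=b^{-1}ab$. $\mathcal{B}_n$ is the group of automorphisms of $\Sigma_{0,1,n}$ fixing $z_1$ and permuting the conjugacy classes $\{[t_1],\dots,[t_n]\}$. It is generated by $\sigma_1,\dots,\sigma_{n-1}$, where $t_k^{\sigma_i}=t_k$ for $k\notin\{i,i+1\}$, $t_i^{\sigma_i}=t_{i+1}$ and $t_{i+1}^{\sigma_i}=t_{i+1}^{-1}t_it_{i+1}$. Each element of $\mathcal{B}_n$ induces an automorphism of $C_2^{*n}$ via $t_k\mapsto\tau_k$. In particular $\sigma_i$ acts by $\tau_k\mapsto\tau_k$ for $k\notin\{i,i+1\}$, $\tau_i\mapsto\tau_{i+1}$ and $\tau_{i+1}\mapsto\tau_{i+1}\tau_i\tau_{i+1}$. This gives a faithful right action of $\mathcal{B}_n$ on $C_2^{*n}$. The semidirect product $\mathcal{B}_n\ltimes C_2^{*n}$ satisfies $\phi^{-1}g\phi=g^\phi$.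 $\Phi_{n-1}$ is the subgroup of $C_2^{*n}$ consisting of the elements that are products of an even number of generators $\tau_k$. It is free of rank $n-1$ and $\mathcal{B}_n$-invariant. $\mathrm{Art}\langle D_n\rangle$ is the group with generators $d_1,\dots,d_n$ and the following relations. For each pair $\{i,j\}$ in $\{\{1,2\},\{2,3\},\dots,\{n-2,n-1\},\{n-2,n\}\}$ (pairs with an index $\le0$ omitted), $d_id_jd_i=d_jd_id_j$. For every other pair $i\ne j$, $d_id_j=d_jd_i$. *)

theory Defs
  imports "HOL-Algebra.Coset" "HOL-Algebra.Generated_Groups" "HOL-Algebra.Bij"
begin

section \<open>Free groups (reduced words) and group presentations\<close>

text \<open>A letter (a, False) stands for the generator a, (a, True) for its inverse.
  free_red computes the freely reduced form of a word (stack-based cancellation).\<close>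

fun free_red :: "('a \<times> bool) list \<Rightarrow> ('a \<times> bool) list" where
  "free_red [] = []"
| "free_red (x # xs) =
     (case free_red xs of
        [] \<Rightarrow> [x]
      | y # ys \<Rightarrow> (if fst x = fst y \<and> snd x \<noteq> snd y then ys else x # y # ys))"

definition free_grp :: "'a set \<Rightarrow> ('a \<times> bool) list monoid" where
  "free_grp A = \<lparr>carrier = {w. fst ` set w \<subseteq> A \<and> free_red w = w},
                 mult = (\<lambda>x y. free_red (x @ y)),
                 one = []\<rparr>"

definition normal_closure :: "('a, 'b) monoid_scheme \<Rightarrow> 'a set \<Rightarrow> 'a set" where
  "normal_closure G S =
     generate G {inv\<^bsub>G\<^esub> g \<otimes>\<^bsub>G\<^esub> r \<otimes>\<^bsub>G\<^esub> g | g r. g \<in> carrier G \<and> r \<in> S}"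

text \<open>The group with generators A and relators R (R a set of words over A).\<close>
definition presented_grp :: "'a set \<Rightarrow> ('a \<times> bool) list set \<Rightarrow> ('a \<times> bool) list set monoid" where
  "presented_grp A R = free_grp A Mod normal_closure (free_grp A) (free_red ` R)"

text \<open>Image of the generator a in the presented group.\<close>
definition pres_gen :: "'a set \<Rightarrow> ('a \<times> bool) list set \<Rightarrow> 'a \<Rightarrow> ('a \<times> bool) list set" where
  "pres_gen A R a = normal_closure (free_grp A) (free_red ` R) #>\<^bsub>free_grp A\<^esub> [(a, False)]"

section \<open>The Artin group of type D_n\<close>

text \<open>Braid pairs: {i,i+1} for 1 \<le> i and i+1 \<le> n-1, and {n-2,n} provided n-2 \<ge> 1.\<close>
definition braid_pair_D :: "nat \<Rightarrow> nat \<Rightarrow> nat \<Rightarrow> bool" where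
  "braid_pair_D n i j \<longleftrightarrow>
     (1 \<le> i \<and> j = i + 1 \<and> j \<le> n - 1) \<or> (1 \<le> j \<and> i = j + 1 \<and> i \<le> n - 1)
   \<or> (n \<ge> 3 \<and> ((i = n - 2 \<and> j = n) \<or> (i = n \<and> j = n - 2)))"

definition artD_rels :: "nat \<Rightarrow> (nat \<times> bool) list set" where
  "artD_rels n =
     {[(i,False),(j,False),(i,False),(j,True),(i,True),(j,True)] | i j.
         i \<in> {1..n} \<and> j \<in> {1..n} \<and> i \<noteq> j \<and> braid_pair_D n i j}
   \<union> {[(i,False),(j,False),(i,True),(j,True)] | i j.
         i \<in> {1..n} \<and> j \<in> {1..n} \<and> i \<noteq> j \<and> \<not> braid_pair_D n i j}"

definition ArtD :: "nat \<Rightarrow> (nat \<times> bool) list set monoid" where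
  "ArtD n = presented_grp {1..n} (artD_rels n)"

definition artD_gen :: "nat \<Rightarrow> nat \<Rightarrow> (nat \<times> bool) list set" where
  "artD_gen n i = pres_gen {1..n} (artD_rels n) i"

section \<open>The free product C_2^{*n} (reduced words: no two adjacent letters equal)\<close>

fun c2_red :: "nat list \<Rightarrow> nat list" where
  "c2_red [] = []"
| "c2_red (x # xs) =
     (case c2_red xs of [] \<Rightarrow> [x] | y # ys \<Rightarrow> (if x = y then ys else x # y # ys))"

definition C2_carrier :: "nat \<Rightarrow> nat list set" where
  "C2_carrier n = {w. set w \<subseteq> {1..n} \<and> c2_red w = w}"

definition c2_mult :: "nat list \<Rightarrow> nat list \<Rightarrow> nat list" where
  "c2_mult x y = c2_red (x @ y)"

text \<open>Phi_{n-1}: products of an even number of generators tau_k.\<close>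
definition Phi :: "nat \<Rightarrow> nat list set" where
  "Phi n = {g \<in> C2_carrier n. \<exists>ks. even (length ks) \<and> set ks \<subseteq> {1..n} \<and> g = c2_red ks}"

section \<open>The action of sigma_i and the braid group B_n\<close>

text \<open>Image of tau_k under sigma_i, as a word.\<close>
definition sigma_img :: "nat \<Rightarrow> nat \<Rightarrow> nat list" where
  "sigma_img i k = (if k = i then [i + 1] else if k = i + 1 then [i + 1, i, i + 1] else [k])"

text \<open>The automorphism g \<mapsto> g^{sigma_i} of C_2^{*n} (restricted to the carrier).\<close>
definition sigma_act :: "nat \<Rightarrow> nat \<Rightarrow> nat list \<Rightarrow> nat list" where
  "sigma_act n i = (\<lambda>w \<in> C2_carrier n. c2_red (concat (map (sigma_img i) w)))"

text \<open>B_n, realised (faithfully) as the group of automorphisms of C_2^{*n}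
  generated by sigma_1, ..., sigma_{n-1}.\<close>
definition Bn :: "nat \<Rightarrow> (nat list \<Rightarrow> nat list) set" where
  "Bn n = generate (BijGroup (C2_carrier n)) {sigma_act n i | i. 1 \<le> i \<and> i < n}"

text \<open>The semidirect product B_n \<ltimes> C_2^{*n}: the pair (phi, g) stands for phi g.
  Automorphisms act on the right and compose left to right, so
  (phi g)(psi h) = (phi psi)(g^psi h), and phi psi is "first phi, then psi".\<close>
definition semidirect_BC :: "nat \<Rightarrow> ((nat list \<Rightarrow> nat list) \<times> nat list) monoid" where
  "semidirect_BC n =
     \<lparr>carrier = Bn n \<times> C2_carrier n,
      mult = (\<lambda>(phi, g) (psi, h). (compose (C2_carrier n) psi phi, c2_mult (psi g) h)),
      one = (\<lambda>x \<in> C2_carrier n. x, [])\<rparr>"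

text \<open>The subgroup B_n \<ltimes> Phi_{n-1}.\<close>
definition semidirect_BPhi :: "nat \<Rightarrow> ((nat list \<Rightarrow> nat list) \<times> nat list) monoid" where
  "semidirect_BPhi n = semidirect_BC n \<lparr>carrier := Bn n \<times> Phi n\<rparr>"

text \<open>Elements sigma_i and tau_k of the semidirect product.\<close>
definition sd_sigma :: "nat \<Rightarrow> nat \<Rightarrow> (nat list \<Rightarrow> nat list) \<times> nat list" where
  "sd_sigma n i = (sigma_act n i, [])"

definition sd_tau :: "nat \<Rightarrow> nat \<Rightarrow> (nat list \<Rightarrow> nat list) \<times> nat list" where
  "sd_tau n k = (\<lambda>x \<in> C2_carrier n. x, [k])"

end

theory Submission
  imports Defs
begin

text \<open>
  The relations of \<open>Art\<langle>D\<^sub>n\<rangle>\<close> hold for the proposed images, which clearly generate, so the point is injectivity.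

  Write \<open>s\<^sub>i = d\<^sub>i\<close> for \<open>i < n\<close>. The elements \<open>\<xi>\<^sub>j\<close> obtained from \<open>d\<^sub>n\<^sub>-\<^sub>1\<^sup>-\<^sup>1 d\<^sub>n\<close> by conjugation map to
  \<open>\<tau>\<^sub>n \<tau>\<^sub>j\<close> and generate a subgroup normalised by the \<open>s\<^sub>i\<close>; hence every element is a braid word times a
  word in the \<open>\<xi>\<^sub>j\<close>, and since the \<open>\<tau>\<^sub>n \<tau>\<^sub>j\<close> freely generate \<open>\<Phi>\<close> it remains to see that a braid word acting
  trivially on \<open>C\<^sub>2\<^sup>*\<^sup>n\<close> is trivial as a consequence of the braid relations.

  This goes by induction on the number of strands. By combing, such a braid is a product of a braid on one
  strand less and an element \<open>u\<close> pushing the last point around the others. Killing the last letter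
  removes the first factor. The pushing subgroup \<open>U\<^sub>m\<close> is conjugate to the one generated by \<open>A = s\<^sub>m\<^sup>2\<close> and
  \<open>U\<^sub>m\<^sub>-\<^sub>1\<close>, where \<open>A\<close> only involves the letters \<open>m, m + 1\<close> and \<open>U\<^sub>m\<^sub>-\<^sub>1\<close> only the letters \<open>1, \<dots>, m\<close>.
  A ping-pong on reduced words shows \<open>u = 1\<close>: nontrivial powers of \<open>A\<close> turn a subword \<open>a m c\<close> with
  \<open>a, c < m\<close> into one containing \<open>(m+1) m (m+1)\<close>, and nontrivial elements of \<open>U\<^sub>m\<^sub>-\<^sub>1\<close>
  turn the latter into one containing some \<open>a m a\<close> with \<open>a < m\<close>.
\<close>

section \<open>Reduced words with respect to an involution of the letters\<close>

text \<open>The subgroup generated by the \<open>s\<^sub>i\<close> is known beforehand only as some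
  quotient of the braid group. Faithfulness is therefore proved for an arbitrary group containing
  elements that satisfy the braid relations and act like the \<open>\<sigma>\<^sub>i\<close>.
  Topology is replaced by algebra on words: point pushing is a recursion on generators, and
  forgetting a point is the deletion of a letter.

  The ping-pong works because the two factors share the single letter \<open>m\<close>. Each factor
  fixes the letters with which the other one has surrounded an \<open>m\<close>, so its effect on
  that \<open>m\<close> can be read off in place. This relies on blocks between fixed letters never
  disappearing, which is where injectivity of the action enters.

  At the end the two components of the semidirect product separate: a braid word has trivial second
  component and a word in the \<open>\<xi>\<^sub>j\<close> has trivial first component. An element
  of the kernel thus splits into two factors that are shown to be trivial independently, one by
  faithfulness and the other by an explicit left inverse of
  \<open>\<xi>\<^sub>j \<mapsto> \<tau>\<^sub>n \<tau>\<^sub>j\<close>.\<close>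

fun wred :: "('a \<Rightarrow> 'a) \<Rightarrow> 'a list \<Rightarrow> 'a list" where
  "wred \<iota> [] = []"
| "wred \<iota> (x # xs) =
     (case wred \<iota> xs of [] \<Rightarrow> [x] | y # ys \<Rightarrow> (if y = \<iota> x then ys else x # y # ys))"

definition red_grp :: "('a \<Rightarrow> 'a) \<Rightarrow> 'a set \<Rightarrow> 'a list monoid" where
  "red_grp \<iota> S = \<lparr>carrier = {w. set w \<subseteq> S \<and> wred \<iota> w = w},
                  mult = (\<lambda>x y. wred \<iota> (x @ y)), one = []\<rparr>"

lemma set_wred_subset: "set (wred \<iota> w) \<subseteq> set w"
proof (induction w)
  case (Cons x w)
  then show ?case
    by (cases "wred \<iota> w") auto
qed simp

lemma wred_Cons_wred: "wred \<iota> xs = wred \<iota> ys \<Longrightarrow> wred \<iota> (x # xs) = wred \<iota> (x # ys)"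
  by simp

lemma wred_append_cong: "wred \<iota> ys = wred \<iota> zs \<Longrightarrow> wred \<iota> (xs @ ys) = wred \<iota> (xs @ zs)"
  by (induction xs) simp_all

text \<open>Reduction never lengthens a word, so a cancellation inside \<open>xs\<close> would leave
  too few letters to return \<open>x # xs\<close>.\<close>

lemma wred_tl: "wred \<iota> (x # xs) = x # xs \<Longrightarrow> wred \<iota> xs = xs"
proof -
  have "length (wred \<iota> xs) \<le> length xs" for xs
  proof (induction xs)
    case (Cons a xs)
    then show ?case by (cases "wred \<iota> xs") auto
  qed simp
  note len = this[of xs]
  assume "wred \<iota> (x # xs) = x # xs"
  then show ?thesis
    using len by (cases "wred \<iota> xs") (auto split: if_splits)
qed

lemma wred_reduced_Cons_iff:
  "wred \<iota> (x # y # xs) = x # y # xs \<longleftrightarrow> y \<noteq> \<iota> x \<and> wred \<iota> (y # xs) = y # xs"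
proof
  assume red: "wred \<iota> (x # y # xs) = x # y # xs"
  note tl = wred_tl[OF red]
  show "y \<noteq> \<iota> x \<and> wred \<iota> (y # xs) = y # xs"
  proof (intro conjI tl notI)
    assume "y = \<iota> x"
    moreover have "wred \<iota> (x # y # xs) = (if y = \<iota> x then xs else x # y # xs)"
      using tl by (simp del: wred.simps(2) add: wred.simps(2)[of \<iota> x])
    ultimately show False
      using red by auto
  qed
next
  assume "y \<noteq> \<iota> x \<and> wred \<iota> (y # xs) = y # xs"
  then show "wred \<iota> (x # y # xs) = x # y # xs"
    by (simp del: wred.simps(2) add: wred.simps(2)[of \<iota> x])
qed

text \<open>One theory serves both kinds of words: with \<open>flip_sign\<close> the reduction is
  \<open>free_red\<close> on signed generators; with the identity it is \<open>c2_red\<close>, where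
  every letter is its own inverse.\<close>

locale letter_involution =
  fixes \<iota> :: "'a \<Rightarrow> 'a"
  assumes invol [simp]: "\<iota> (\<iota> x) = x"
begin

lemma wred_reduced: "wred \<iota> (wred \<iota> w) = wred \<iota> w"
proof (induction w)
  case (Cons x w)
  show ?case
  proof (cases "wred \<iota> w")
    case (Cons y ys)
    with Cons.IH have "wred \<iota> (y # ys) = y # ys" by simp
    then show ?thesis
      using Cons wred_tl[of \<iota> y ys] wred_reduced_Cons_iff[of \<iota> x y ys]
      by (simp del: wred.simps(2) add: wred.simps(2)[of \<iota> x w])
  qed simp
qed simp

lemma wred_append_right [simp]: "wred \<iota> (xs @ wred \<iota> ys) = wred \<iota> (xs @ ys)"
  by (rule wred_append_cong) (rule wred_reduced)

text \<open>If the reduction of \<open>w\<close> begins with \<open>x\<close>, then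
  \<open>\<iota> x\<close> removes this letter and \<open>x\<close> puts it back; what follows is
  already reduced, so \<open>x\<close> meets no further partner. Otherwise the two new letters
  cancel each other.\<close>

lemma wred_cancel_Cons: "wred \<iota> (x # \<iota> x # w) = wred \<iota> w"
proof (cases "wred \<iota> w")
  case (Cons y ys)
  show ?thesis
  proof (cases "y = x")
    case True
    have "wred \<iota> (x # ys) = x # ys"
      using wred_reduced[of w] Cons True by simp
    then have "wred \<iota> ys = ys" "ys = [] \<or> hd ys \<noteq> \<iota> x"
      using wred_tl wred_reduced_Cons_iff[of \<iota> x] by (auto simp: neq_Nil_conv)
    then show ?thesis
      using Cons True by (cases ys) auto
  qed (use Cons in auto)
qed simp

lemma wred_cancel: "wred \<iota> (xs @ x # \<iota> x # ys) = wred \<iota> (xs @ ys)"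
  by (rule wred_append_cong) (rule wred_cancel_Cons)

lemma wred_append_left [simp]: "wred \<iota> (wred \<iota> xs @ ys) = wred \<iota> (xs @ ys)"
proof (induction xs)
  case (Cons x xs)
  show ?case
  proof (cases "wred \<iota> xs")
    case Nil
    then show ?thesis
      using Cons.IH wred_Cons_wred[of \<iota> ys "xs @ ys" x] by simp
  next
    case (Cons y r)
    have *: "wred \<iota> (x # y # r @ ys) = wred \<iota> (x # xs @ ys)"
      using Cons.IH Cons by (intro wred_Cons_wred) simp
    show ?thesis
    proof (cases "y = \<iota> x")
      case True
      then have "wred \<iota> (x # xs) = r" using Cons by simp
      then show ?thesis
        using * True wred_cancel_Cons[of x "r @ ys"] by simp
    next
      case False
      then have "wred \<iota> (x # xs) = x # y # r" using Cons by simp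
      then show ?thesis
        using * by simp
    qed
  qed
qed simp

lemma wred_inverse: "wred \<iota> (w @ rev (map \<iota> w)) = []" "wred \<iota> (rev (map \<iota> w) @ w) = []"
proof -
  have inv: "wred \<iota> (w @ rev (map \<iota> w)) = []" for w
  proof (induction w)
    case (Cons x w)
    have "wred \<iota> ((w @ rev (map \<iota> w)) @ [\<iota> x]) = wred \<iota> [\<iota> x]"
      by (subst wred_append_left[symmetric]) (simp add: Cons.IH)
    then have "wred \<iota> (x # w @ rev (map \<iota> w) @ [\<iota> x]) = wred \<iota> (x # [\<iota> x])"
      by (intro wred_Cons_wred) simp
    then show ?case by simp
  qed simp
  then show "wred \<iota> (w @ rev (map \<iota> w)) = []" .
  show "wred \<iota> (rev (map \<iota> w) @ w) = []"
    using inv[of "rev (map \<iota> w)"] by (simp add: rev_map comp_def)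
qed

text \<open>The universal property in word form: a substitution is compatible with reduction as soon
  as the images of a letter and of its inverse cancel. Source and target may carry different
  involutions.\<close>

lemma wred_concat_map:
  assumes "\<And>x. x \<in> set w \<Longrightarrow> wred \<iota> (f x @ f (\<kappa> x)) = []"
  shows "wred \<iota> (concat (map f (wred \<kappa> w))) = wred \<iota> (concat (map f w))"
  using assms
proof (induction w)
  case (Cons x w)
  then have IH: "wred \<iota> (concat (map f (wred \<kappa> w))) = wred \<iota> (concat (map f w))" by simp
  have eq: "wred \<iota> (f x @ concat (map f (wred \<kappa> w))) = wred \<iota> (f x @ concat (map f w))"
    using IH by (rule wred_append_cong)
  show ?case
  proof (cases "wred \<kappa> w")
    case (Cons y ys)
    show ?thesis
    proof (cases "y = \<kappa> x")
      case True
      have "wred \<iota> (f x @ concat (map f w)) = wred \<iota> ((f x @ f (\<kappa> x)) @ concat (map f ys))"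
        using eq Cons True by simp
      also have "\<dots> = wred \<iota> (concat (map f ys))"
        by (subst wred_append_left[symmetric]) (simp add: Cons.prems)
      finally show ?thesis
        using Cons True by simp
    qed (use Cons eq in auto)
  qed (use eq in auto)
qed simp

lemma group_red_grp:
  assumes "\<iota> ` S \<subseteq> S"
  shows "group (red_grp \<iota> S)"
proof (rule groupI)
  fix x y z
  assume "x \<in> carrier (red_grp \<iota> S)" "y \<in> carrier (red_grp \<iota> S)" "z \<in> carrier (red_grp \<iota> S)"
  then show "x \<otimes>\<^bsub>red_grp \<iota> S\<^esub> y \<otimes>\<^bsub>red_grp \<iota> S\<^esub> z = x \<otimes>\<^bsub>red_grp \<iota> S\<^esub> (y \<otimes>\<^bsub>red_grp \<iota> S\<^esub> z)"
    by (simp add: red_grp_def)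
next
  fix x
  assume x: "x \<in> carrier (red_grp \<iota> S)"
  show "\<exists>y\<in>carrier (red_grp \<iota> S). y \<otimes>\<^bsub>red_grp \<iota> S\<^esub> x = \<one>\<^bsub>red_grp \<iota> S\<^esub>"
  proof (rule bexI)
    show "wred \<iota> (rev (map \<iota> x)) \<otimes>\<^bsub>red_grp \<iota> S\<^esub> x = \<one>\<^bsub>red_grp \<iota> S\<^esub>"
      by (simp add: red_grp_def wred_inverse)
    have "set (rev (map \<iota> x)) \<subseteq> S"
      using x assms by (auto simp: red_grp_def)
    then show "wred \<iota> (rev (map \<iota> x)) \<in> carrier (red_grp \<iota> S)"
      by (simp add: red_grp_def wred_reduced subset_trans[OF set_wred_subset])
  qed
qed (use set_wred_subset in \<open>fastforce simp: red_grp_def wred_reduced\<close>)+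

end

section \<open>Groups given by generators and relators\<close>

definition flip_sign :: "'a \<times> bool \<Rightarrow> 'a \<times> bool" where
  "flip_sign x = (fst x, \<not> snd x)"

lemma flip_sign_Pair [simp]: "flip_sign (a, b) = (a, \<not> b)"
  by (simp add: flip_sign_def)

interpretation flip: letter_involution flip_sign
  by unfold_locales (simp add: flip_sign_def)

fun word_eval :: "('a, 'b) monoid_scheme \<Rightarrow> ('c \<Rightarrow> 'a) \<Rightarrow> ('c \<times> bool) list \<Rightarrow> 'a" where
  "word_eval G e [] = \<one>\<^bsub>G\<^esub>"
| "word_eval G e ((a, b) # w) = (if b then inv\<^bsub>G\<^esub> (e a) else e a) \<otimes>\<^bsub>G\<^esub> word_eval G e w"

lemma word_induct [case_names Nil Cons]:
  "P [] \<Longrightarrow> (\<And>a b w. P w \<Longrightarrow> P ((a, b) # w)) \<Longrightarrow> P w"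
  by (induction w) auto

lemma free_red_eq_wred: "free_red w = wred flip_sign w"
proof (induction w)
  case (Cons x w)
  have "(fst x = fst y \<and> snd x \<noteq> snd y) = (y = flip_sign x)" for y
    by (cases x; cases y) (auto simp: flip_sign_def)
  then show ?case
    using Cons by (simp split: list.split)
qed simp

lemma free_grp_eq_red_grp: "free_grp A = red_grp flip_sign (A \<times> UNIV)"
proof -
  have "{w. fst ` set w \<subseteq> A \<and> free_red w = w} = {w. set w \<subseteq> A \<times> UNIV \<and> wred flip_sign w = w}"
    by (force simp: free_red_eq_wred)
  then show ?thesis
    by (simp add: free_grp_def red_grp_def free_red_eq_wred)
qed

lemma group_free_grp: "group (free_grp A)"
  unfolding free_grp_eq_red_grp by (rule flip.group_red_grp) (auto simp: flip_sign_def)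

lemma free_red_in_carrier:
  "fst ` set w \<subseteq> A \<Longrightarrow> free_red w \<in> carrier (free_grp A)"
  using set_wred_subset[of flip_sign w]
  by (auto simp: free_grp_def free_red_eq_wred flip.wred_reduced)

context group
begin

lemma normal_closure_normal:
  assumes S: "S \<subseteq> carrier G"
  shows "normal_closure G S \<lhd> G"
  unfolding normal_closure_def
proof (rule normal_generateI)
  show "{inv g \<otimes> r \<otimes> g |g r. g \<in> carrier G \<and> r \<in> S} \<subseteq> carrier G"
    using S by auto
next
  fix x g
  assume "x \<in> {inv g \<otimes> r \<otimes> g |g r. g \<in> carrier G \<and> r \<in> S}" and g: "g \<in> carrier G"
  then obtain k r where kr: "k \<in> carrier G" "r \<in> S" "x = inv k \<otimes> r \<otimes> k" by auto
  moreover have "r \<in> carrier G" using kr S by auto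
  ultimately have "g \<otimes> x \<otimes> inv g = inv (k \<otimes> inv g) \<otimes> r \<otimes> (k \<otimes> inv g)"
    using g by (simp add: inv_mult_group m_assoc)
  then show "g \<otimes> x \<otimes> inv g \<in> {inv g \<otimes> r \<otimes> g |g r. g \<in> carrier G \<and> r \<in> S}"
    using kr g by blast
qed

lemma subset_normal_closure:
  assumes S: "S \<subseteq> carrier G"
  shows "S \<subseteq> normal_closure G S"
proof
  fix r assume r: "r \<in> S"
  then have "r = inv \<one> \<otimes> r \<otimes> \<one>" using S by auto
  then show "r \<in> normal_closure G S"
    unfolding normal_closure_def using r by (intro generate.incl) blast
qed

lemma normal_closure_subset_kernel:
  assumes h: "h \<in> hom G K" and K: "group K" and S: "S \<subseteq> carrier G"
    and one: "\<And>r. r \<in> S \<Longrightarrow> h r = \<one>\<^bsub>K\<^esub>"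
  shows "normal_closure G S \<subseteq> kernel G K h"
proof -
  interpret h: group_hom G K h
    using h K is_group by (simp add: group_hom_def group_hom_axioms_def)
  show ?thesis
    unfolding normal_closure_def
  proof (rule generate_subgroup_incl)
    show "{inv g \<otimes> r \<otimes> g |g r. g \<in> carrier G \<and> r \<in> S} \<subseteq> kernel G K h"
      using S one by (auto simp: kernel_def subset_iff)
  qed (rule h.subgroup_kernel)
qed

lemma word_eval_closed [simp]:
  "e \<in> fst ` set w \<rightarrow> carrier G \<Longrightarrow> word_eval G e w \<in> carrier G"
  by (induction w rule: word_induct) auto

lemma word_eval_append:
  "e \<in> fst ` set (v @ w) \<rightarrow> carrier G \<Longrightarrow> word_eval G e (v @ w) = word_eval G e v \<otimes> word_eval G e w"
proof (induction v rule: word_induct)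
  case (Cons a b v)
  have "word_eval G e v \<in> carrier G" "word_eval G e w \<in> carrier G" "e a \<in> carrier G"
    using Cons.prems by (auto intro!: word_eval_closed)
  then show ?case
    using Cons by (auto simp: m_assoc)
qed auto

lemma word_eval_wred:
  "e \<in> fst ` set w \<rightarrow> carrier G \<Longrightarrow> word_eval G e (wred flip_sign w) = word_eval G e w"
proof (induction w rule: word_induct)
  case (Cons a b w)
  have IH: "word_eval G e (wred flip_sign w) = word_eval G e w"
    using Cons by auto
  show ?case
  proof (cases "wred flip_sign w")
    case red: (Cons y ys)
    obtain c d where y: "y = (c, d)" by fastforce
    have "set (y # ys) \<subseteq> set w"
      using set_wred_subset[of flip_sign w] red by simp
    then have "word_eval G e ys \<in> carrier G" "e a \<in> carrier G" "e c \<in> carrier G"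
      using Cons.prems y by (force intro!: word_eval_closed simp: Pi_iff)+
    then show ?thesis
      using IH[symmetric] red y by (auto simp: m_assoc[symmetric])
  qed (use IH in auto)
qed auto

end

section \<open>Presented groups: evaluation of words and the universal property\<close>

context
  fixes A :: "'a set" and R :: "('a \<times> bool) list set"
  assumes R: "\<And>r. r \<in> R \<Longrightarrow> fst ` set r \<subseteq> A"
begin

interpretation F: group "free_grp A"
  by (rule group_free_grp)

lemma relators_subset: "free_red ` R \<subseteq> carrier (free_grp A)"
  by (intro image_subsetI free_red_in_carrier R)

lemma presented_normal: "normal_closure (free_grp A) (free_red ` R) \<lhd> free_grp A"
  by (rule F.normal_closure_normal[OF relators_subset])

lemma group_presented_grp: "group (presented_grp A R)"
  unfolding presented_grp_def by (rule normal.factorgroup_is_group[OF presented_normal])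

lemma singleton_in_free_grp: "a \<in> A \<Longrightarrow> [(a, b)] \<in> carrier (free_grp A)"
  by (auto simp: free_grp_def)

lemma inv_singleton_free_grp:
  assumes a: "a \<in> A"
  shows "inv\<^bsub>free_grp A\<^esub> [(a, False)] = [(a, True)]"
  by (rule F.inv_equality) (use singleton_in_free_grp a in \<open>auto simp: free_grp_def\<close>)

lemma pres_gen_closed [simp]: "a \<in> A \<Longrightarrow> pres_gen A R a \<in> carrier (presented_grp A R)"
  unfolding pres_gen_def presented_grp_def
  by (auto simp: carrier_FactGroup singleton_in_free_grp)

text \<open>Translates cosets of words into products of generators, the form in which generation and
  the relators are expressed below.\<close>

lemma coset_eq_word_eval:
  assumes "w \<in> carrier (free_grp A)"
  shows "normal_closure (free_grp A) (free_red ` R) #>\<^bsub>free_grp A\<^esub> w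
       = word_eval (presented_grp A R) (pres_gen A R) w"
  using assms
proof (induction w)
  interpret N: normal "normal_closure (free_grp A) (free_red ` R)" "free_grp A"
    by (rule presented_normal)
  interpret P: group "presented_grp A R" by (rule group_presented_grp)
  let ?N = "normal_closure (free_grp A) (free_red ` R)"
  case Nil
  have "?N #>\<^bsub>free_grp A\<^esub> \<one>\<^bsub>free_grp A\<^esub> = ?N"
    by (rule F.coset_mult_one) (rule N.subset)
  moreover have "\<one>\<^bsub>free_grp A\<^esub> = []" "\<one>\<^bsub>presented_grp A R\<^esub> = ?N"
    by (simp_all add: free_grp_def presented_grp_def FactGroup_def)
  ultimately show ?case by simp
next
  interpret N: normal "normal_closure (free_grp A) (free_red ` R)" "free_grp A"
    by (rule presented_normal)
  interpret P: group "presented_grp A R" by (rule group_presented_grp)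
  let ?N = "normal_closure (free_grp A) (free_red ` R)"
  case (Cons x w)
  obtain a b where x: "x = (a, b)" by fastforce
  have w: "w \<in> carrier (free_grp A)" "a \<in> A"
    using Cons.prems x wred_tl[of flip_sign x w]
    by (auto simp: free_grp_def free_red_eq_wred simp del: wred.simps)
  have "[x] \<otimes>\<^bsub>free_grp A\<^esub> w = x # w"
    using Cons.prems by (simp add: free_grp_def)
  then have "?N #>\<^bsub>free_grp A\<^esub> (x # w) = (?N #>\<^bsub>free_grp A\<^esub> [x]) \<otimes>\<^bsub>presented_grp A R\<^esub> (?N #>\<^bsub>free_grp A\<^esub> w)"
    using N.rcos_sum[of "[x]" w] w x singleton_in_free_grp[of a b]
    by (simp add: presented_grp_def FactGroup_def)
  moreover have "?N #>\<^bsub>free_grp A\<^esub> [x] = (if b then inv\<^bsub>presented_grp A R\<^esub> pres_gen A R a else pres_gen A R a)"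
  proof -
    have "inv\<^bsub>presented_grp A R\<^esub> pres_gen A R a = ?N #>\<^bsub>free_grp A\<^esub> (inv\<^bsub>free_grp A\<^esub> [(a, False)])"
      using N.inv_FactGroup[of "pres_gen A R a"] N.rcos_inv[of "[(a, False)]"]
        singleton_in_free_grp[OF w(2)] pres_gen_closed[OF w(2)]
      by (simp add: pres_gen_def presented_grp_def)
    then show ?thesis
      using inv_singleton_free_grp[OF w(2)] x by (cases b) (auto simp: pres_gen_def)
  qed
  ultimately show ?case
    using Cons.IH w x by simp
qed

lemma presented_grp_generated:
  "carrier (presented_grp A R) = generate (presented_grp A R) (pres_gen A R ` A)"
proof
  interpret P: group "presented_grp A R" by (rule group_presented_grp)
  let ?E = "generate (presented_grp A R) (pres_gen A R ` A)"
  show "carrier (presented_grp A R) \<subseteq> ?E"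
  proof
    fix X assume "X \<in> carrier (presented_grp A R)"
    then obtain w where w: "w \<in> carrier (free_grp A)"
      "X = normal_closure (free_grp A) (free_red ` R) #>\<^bsub>free_grp A\<^esub> w"
      by (auto simp: presented_grp_def carrier_FactGroup)
    have "word_eval (presented_grp A R) (pres_gen A R) w \<in> ?E" if "fst ` set w \<subseteq> A" for w
      using that
    proof (induction w)
      case (Cons x w)
      then show ?case
        by (cases x) (auto intro!: generate.eng intro: generate.incl generate.inv)
    qed (auto intro: generate.intros)
    with w show "X \<in> ?E"
      using coset_eq_word_eval[OF w(1)] by (auto simp: free_grp_def)
  qed
  show "?E \<subseteq> carrier (presented_grp A R)"
    by (rule P.generate_incl) auto
qed

lemma presented_grp_relator:
  assumes r: "r \<in> R"
  shows "word_eval (presented_grp A R) (pres_gen A R) r = \<one>\<^bsub>presented_grp A R\<^esub>"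
proof -
  interpret N: normal "normal_closure (free_grp A) (free_red ` R)" "free_grp A"
    by (rule presented_normal)
  interpret P: group "presented_grp A R" by (rule group_presented_grp)
  note sub = relators_subset
  have "pres_gen A R \<in> fst ` set r \<rightarrow> carrier (presented_grp A R)"
    using R[OF r] by auto
  then have "word_eval (presented_grp A R) (pres_gen A R) r = word_eval (presented_grp A R) (pres_gen A R) (free_red r)"
    unfolding free_red_eq_wred by (rule P.word_eval_wred[symmetric])
  also have "\<dots> = normal_closure (free_grp A) (free_red ` R) #>\<^bsub>free_grp A\<^esub> free_red r"
    using coset_eq_word_eval[of "free_red r"] sub r by auto
  also have "\<dots> = normal_closure (free_grp A) (free_red ` R)"
    using F.subset_normal_closure[OF sub] r
    by (intro N.rcos_const) (auto intro: group_free_grp)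
  finally show ?thesis
    by (simp add: presented_grp_def FactGroup_def)
qed

text \<open>Von Dyck's theorem: evaluation of words kills the relators, hence their normal closure,
  and so factors through the quotient.\<close>

lemma presented_grp_hom:
  assumes K: "group K" and e: "e \<in> A \<rightarrow> carrier K"
    and rel: "\<And>r. r \<in> R \<Longrightarrow> word_eval K e r = \<one>\<^bsub>K\<^esub>"
  obtains h where "h \<in> hom (presented_grp A R) K" "\<And>a. a \<in> A \<Longrightarrow> h (pres_gen A R a) = e a"
proof -
  interpret K: group K by (rule K)
  note sub = relators_subset
  have e': "e \<in> fst ` set w \<rightarrow> carrier K" if "fst ` set w \<subseteq> A" for w :: "('a \<times> bool) list"
    using that e by auto
  have hom: "word_eval K e \<in> hom (free_grp A) K"
  proof (rule homI)
    fix v w assume "v \<in> carrier (free_grp A)" "w \<in> carrier (free_grp A)"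
    then have "fst ` set (v @ w) \<subseteq> A" by (auto simp: free_grp_def)
    from K.word_eval_append[OF e'[OF this]] K.word_eval_wred[OF e'[OF this]]
    show "word_eval K e (v \<otimes>\<^bsub>free_grp A\<^esub> w) = word_eval K e v \<otimes>\<^bsub>K\<^esub> word_eval K e w"
      by (simp add: free_grp_def free_red_eq_wred)
  qed (use e' in \<open>auto simp: free_grp_def\<close>)
  have one: "word_eval K e r = \<one>\<^bsub>K\<^esub>" if "r \<in> free_red ` R" for r
    using that by (auto simp: free_red_eq_wred rel K.word_eval_wred[OF e'[OF R]])
  interpret H: group_hom "free_grp A" K "word_eval K e"
    using hom by unfold_locales
  obtain h where h: "h \<in> hom (free_grp A Mod normal_closure (free_grp A) (free_red ` R)) K"
    "\<And>x. x \<in> carrier (free_grp A) \<Longrightarrow>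
       h (normal_closure (free_grp A) (free_red ` R) #>\<^bsub>free_grp A\<^esub> x) = word_eval K e x"
    using H.FactGroup_universal_kernel[OF presented_normal
        F.normal_closure_subset_kernel[OF hom K sub one]] by blast
  show thesis
  proof
    show "h \<in> hom (presented_grp A R) K" using h by (simp add: presented_grp_def)
    show "h (pres_gen A R a) = e a" if "a \<in> A" for a
      using h(2)[of "[(a, False)]"] that funcset_mem[OF e that] singleton_in_free_grp[OF that]
      by (simp add: pres_gen_def)
  qed
qed

end

section \<open>The free product of groups of order two\<close>

interpretation c2: letter_involution "\<lambda>x :: nat. x"
  by unfold_locales simp

lemma c2_red_eq_wred: "c2_red w = wred (\<lambda>x. x) w"
  by (induction w) (auto split: list.split)

lemma c2_red_append [simp]:
  "c2_red (xs @ c2_red ys) = c2_red (xs @ ys)" "c2_red (c2_red xs @ ys) = c2_red (xs @ ys)"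
  by (simp_all add: c2_red_eq_wred)

lemma c2_red_Cons [simp]: "c2_red (x # c2_red w) = c2_red (x # w)"
  using c2_red_append(1)[of "[x]" w] by (simp del: c2_red.simps)

lemma c2_red_c2_red [simp]: "c2_red (c2_red w) = c2_red w"
  by (simp add: c2_red_eq_wred c2.wred_reduced)

lemma set_c2_red: "set (c2_red w) \<subseteq> set w"
  by (simp add: c2_red_eq_wred set_wred_subset)

lemma c2_red_rev [simp]: "c2_red (w @ rev w) = []" "c2_red (rev w @ w) = []"
  using c2.wred_inverse[of w] by (simp_all add: c2_red_eq_wred)

lemma c2_red_fixed_iff: "c2_red w = w \<longleftrightarrow> distinct_adj w"
proof (induction w rule: induct_list012)
  case (3 x y zs)
  then show ?case
    using wred_reduced_Cons_iff[of "\<lambda>x. x" x y zs]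
    by (auto simp: c2_red_eq_wred simp del: wred.simps)
qed auto

declare c2_red.simps(2) [simp del]

lemma c2_red_single [simp]: "c2_red [x] = [x]"
  by (simp add: c2_red_fixed_iff)

lemma c2_red_cancel [simp]:
  "c2_red (x # x # w) = c2_red w" "c2_red (v @ x # x # w) = c2_red (v @ w)"
  using c2.wred_cancel[of v x w] c2.wred_cancel_Cons[of x w] by (simp_all add: c2_red_eq_wred)

lemma C2_carrier_iff: "w \<in> C2_carrier n \<longleftrightarrow> set w \<subseteq> {1..n} \<and> distinct_adj w"
  by (simp add: C2_carrier_def c2_red_fixed_iff)

lemma c2_red_in_carrier: "set w \<subseteq> {1..n} \<Longrightarrow> c2_red w \<in> C2_carrier n"
  using set_c2_red[of w] by (auto simp: C2_carrier_def)

lemma c2_red_concat_map: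
  assumes "\<And>x. x \<in> set w \<Longrightarrow> c2_red (f x @ f x) = []"
  shows "c2_red (concat (map f (c2_red w))) = c2_red (concat (map f w))"
  using c2.wred_concat_map[of w f "\<lambda>x. x"] assms by (simp add: c2_red_eq_wred)

definition C2_grp :: "nat \<Rightarrow> nat list monoid" where
  "C2_grp n = \<lparr>carrier = C2_carrier n, mult = c2_mult, one = []\<rparr>"

lemma C2_grp_simps [simp]:
  "carrier (C2_grp n) = C2_carrier n" "mult (C2_grp n) = c2_mult" "one (C2_grp n) = []"
  by (simp_all add: C2_grp_def)

lemma group_C2_grp: "group (C2_grp n)"
proof -
  have "C2_grp n = red_grp (\<lambda>x. x) {1..n}"
    by (simp add: C2_grp_def red_grp_def C2_carrier_def c2_mult_def fun_eq_iff c2_red_eq_wred)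
  then show ?thesis
    using c2.group_red_grp[of "{1..n}"] by simp
qed

lemma Nil_in_C2 [simp]: "[] \<in> C2_carrier n"
  by (simp add: C2_carrier_iff)

lemma rev_in_C2 [simp]: "rev w \<in> C2_carrier n \<longleftrightarrow> w \<in> C2_carrier n"
  by (simp add: C2_carrier_iff)

lemma inv_C2_grp: "w \<in> C2_carrier n \<Longrightarrow> inv\<^bsub>C2_grp n\<^esub> w = rev w"
  by (rule group.inv_equality[OF group_C2_grp]) (simp_all add: c2_mult_def)

lemma c2_mult_closed: "v \<in> C2_carrier n \<Longrightarrow> w \<in> C2_carrier n \<Longrightarrow> c2_mult v w \<in> C2_carrier n"
  unfolding c2_mult_def by (rule c2_red_in_carrier) (auto simp: C2_carrier_def)

lemma c2_mult_reduced: "distinct_adj (v @ w) \<Longrightarrow> c2_mult v w = v @ w"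
  by (simp add: c2_mult_def c2_red_fixed_iff)

lemma c2_mult_assoc: "c2_mult (c2_mult u v) w = c2_mult u (c2_mult v w)"
  by (simp add: c2_mult_def)

text \<open>The step supplies \<open>k # w = c2_mult [k] w\<close>, the form to which a homomorphism
  can be applied.\<close>

lemma c2_induct [consumes 1, case_names Nil Cons]:
  assumes "w \<in> C2_carrier n" and "P []"
    and "\<And>k w. \<lbrakk>k \<in> {1..n}; w \<in> C2_carrier n; k # w \<in> C2_carrier n; k # w = c2_mult [k] w; P w\<rbrakk> \<Longrightarrow> P (k # w)"
  shows "P w"
  using assms(1)
proof (induction w)
  case (Cons k w)
  then have "w \<in> C2_carrier n" "k \<in> {1..n}" "k # w = c2_mult [k] w"
    using c2_mult_reduced[of "[k]" w] by (auto simp: C2_carrier_iff distinct_adj_Cons)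
  then show ?case
    using Cons assms(3) by auto
qed (rule assms(2))

section \<open>Endomorphisms of the free product that respect a set of letters\<close>

definition c2_end :: "nat \<Rightarrow> (nat list \<Rightarrow> nat list) \<Rightarrow> bool" where
  "c2_end n \<theta> \<longleftrightarrow> \<theta> \<in> hom (C2_grp n) (C2_grp n)"

lemma c2_endD:
  assumes "c2_end n \<theta>"
  shows "w \<in> C2_carrier n \<Longrightarrow> \<theta> w \<in> C2_carrier n"
    "v \<in> C2_carrier n \<Longrightarrow> w \<in> C2_carrier n \<Longrightarrow> \<theta> (c2_mult v w) = c2_mult (\<theta> v) (\<theta> w)"
    "\<theta> [] = []"
    "w \<in> C2_carrier n \<Longrightarrow> \<theta> (rev w) = rev (\<theta> w)"
proof -
  interpret group_hom "C2_grp n" "C2_grp n" \<theta>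
    using assms group_C2_grp by (simp add: c2_end_def group_hom_def group_hom_axioms_def)
  show "w \<in> C2_carrier n \<Longrightarrow> \<theta> w \<in> C2_carrier n"
    "v \<in> C2_carrier n \<Longrightarrow> w \<in> C2_carrier n \<Longrightarrow> \<theta> (c2_mult v w) = c2_mult (\<theta> v) (\<theta> w)"
    "\<theta> [] = []"
    "w \<in> C2_carrier n \<Longrightarrow> \<theta> (rev w) = rev (\<theta> w)"
    using hom_closed[of w] hom_mult[of v w] hom_one hom_inv[of w] by (auto simp: inv_C2_grp)
qed

lemma c2_end_eqI:
  assumes "c2_end n \<theta>" "c2_end n \<eta>" "\<And>k. k \<in> {1..n} \<Longrightarrow> \<theta> [k] = \<eta> [k]" and "w \<in> C2_carrier n"
  shows "\<theta> w = \<eta> w"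
  using assms(4)
proof (induction w rule: c2_induct)
  case (Cons k w)
  have "[k] \<in> C2_carrier n"
    using Cons by (simp add: C2_carrier_iff)
  then show ?case
    using Cons assms(3) c2_endD(2)[OF assms(1)] c2_endD(2)[OF assms(2)] by metis
qed (use assms c2_endD(3) in metis)

context
  fixes n :: nat and S :: "nat set" and \<theta> :: "nat list \<Rightarrow> nat list"
  assumes \<theta>: "c2_end n \<theta>" "inj_on \<theta> (C2_carrier n)"
    and pres: "\<And>w. w \<in> C2_carrier n \<Longrightarrow> set w \<subseteq> S \<Longrightarrow> set (\<theta> w) \<subseteq> S"
    and fix_letter: "\<And>a. a \<in> {1..n} \<Longrightarrow> a \<notin> S \<Longrightarrow> \<theta> [a] = [a]"
begin

text \<open>Let \<open>c\<close> be the last letter of \<open>p\<close> outside \<open>S\<close>, so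
  that only a block \<open>d\<close> over \<open>S\<close> separates it from \<open>a\<close>. If
  \<open>d\<close> is empty, then \<open>c\<close> and \<open>a\<close> differ because the word is
  reduced. Otherwise injectivity keeps the image of \<open>d\<close> nonempty and, being a word over
  \<open>S\<close>, it cancels neither with \<open>c\<close> nor with \<open>a\<close>.\<close>

lemma free_factor_end_left:
  assumes "p @ [a] \<in> C2_carrier n" and a: "a \<notin> S"
  shows "distinct_adj (\<theta> p @ [a]) \<and> \<theta> (p @ [a]) = \<theta> p @ [a]"
  using assms
proof (induction p arbitrary: a rule: length_induct)
  case (1 p)
  have p: "p \<in> C2_carrier n" and an: "a \<in> {1..n}" "[a] \<in> C2_carrier n"
    using 1 by (auto simp: C2_carrier_iff distinct_adj_append_iff)
  have "distinct_adj (\<theta> p @ [a])"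
  proof (cases "set p \<subseteq> S")
    case True
    then have "a \<notin> set (\<theta> p)" using pres[OF p] 1 by auto
    then show ?thesis
      using c2_endD(1)[OF \<theta>(1) p] by (auto simp: C2_carrier_iff distinct_adj_append_iff)
  next
    case False
    then obtain q c d where pq: "p = q @ c # d" "c \<notin> S" "\<forall>x\<in>set d. x \<in> S"
      using split_list_last_prop[of p "\<lambda>x. x \<notin> S"] by auto
    have qc: "q @ [c] \<in> C2_carrier n" and d: "d \<in> C2_carrier n"
      using p pq by (auto simp: C2_carrier_iff distinct_adj_append_iff distinct_adj_Cons)
    have \<theta>qc: "\<theta> (q @ [c]) = \<theta> q @ [c]" "distinct_adj (\<theta> q @ [c])"
      using "1.IH" qc pq by auto
    show ?thesis
    proof (cases "d = []")
      case True
      then show ?thesis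
        using \<theta>qc 1 pq by (auto simp: C2_carrier_iff distinct_adj_append_iff)
    next
      case False
      have ne: "\<theta> d \<noteq> []"
        using inj_onD[OF \<theta>(2), of d "[]"] d False c2_endD(3)[OF \<theta>(1)] by auto
      have S: "set (\<theta> d) \<subseteq> S" using pres[OF d] pq by auto
      then have S': "hd (\<theta> d) \<in> S" "last (\<theta> d) \<in> S"
        using hd_in_set[OF ne] last_in_set[OF ne] by blast+
      have "p = c2_mult (q @ [c]) d"
        using p pq by (subst c2_mult_reduced) (auto simp: C2_carrier_iff)
      then have "\<theta> p = c2_mult (\<theta> q @ [c]) (\<theta> d)"
        using c2_endD(2)[OF \<theta>(1) qc d] \<theta>qc by simp
      also have "\<dots> = (\<theta> q @ [c]) @ \<theta> d"
        using \<theta>qc S' pq c2_endD(1)[OF \<theta>(1) d] ne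
        by (intro c2_mult_reduced, subst distinct_adj_append_iff) (auto simp: C2_carrier_iff)
      finally show ?thesis
        using S' 1 ne c2_endD(1)[OF \<theta>(1) p]
        by (subst distinct_adj_append_iff) (auto simp: C2_carrier_iff)
    qed
  qed
  moreover have "\<theta> (p @ [a]) = c2_mult (\<theta> p) [a]"
    using 1 c2_mult_reduced[of p "[a]"] c2_endD(2)[OF \<theta>(1) p an(2)] fix_letter an
    by (auto simp: C2_carrier_iff)
  ultimately show ?case
    by (simp add: c2_mult_reduced)
qed

lemma free_factor_end:
  assumes w: "p @ a # r \<in> C2_carrier n" and a: "a \<notin> S"
  shows "\<theta> (p @ a # r) = \<theta> p @ a # \<theta> r"
proof -
  have mem: "p @ [a] \<in> C2_carrier n" "rev r @ [a] \<in> C2_carrier n" "r \<in> C2_carrier n"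
    using w rev_in_C2[of "a # r" n]
    by (auto simp: C2_carrier_iff distinct_adj_append_iff distinct_adj_Cons)
  \<comment> \<open>Reversal is inversion and commutes with \<open>\<theta>\<close>, so the
    left-hand statement also governs the letters to the right of \<open>a\<close>.\<close>
  have "distinct_adj (rev (\<theta> r) @ [a])"
    using free_factor_end_left[OF mem(2) a] c2_endD(4)[OF \<theta>(1) mem(3)] by simp
  then have "distinct_adj (a # \<theta> r)"
    using distinct_adj_rev[of "a # \<theta> r"] by simp
  moreover have "distinct_adj (\<theta> p @ [a])" "\<theta> (p @ [a]) = \<theta> p @ [a]"
    using free_factor_end_left[OF mem(1) a] by auto
  ultimately have "distinct_adj ((\<theta> p @ [a]) @ \<theta> r)" "\<theta> (p @ [a]) = \<theta> p @ [a]"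
    by (auto simp: distinct_adj_append_iff distinct_adj_Cons)
  moreover have "p @ a # r = c2_mult (p @ [a]) r"
    using w by (subst c2_mult_reduced) (auto simp: C2_carrier_iff)
  ultimately show ?thesis
    using c2_endD(2)[OF \<theta>(1) mem(1,3)] c2_mult_reduced[of "\<theta> p @ [a]" "\<theta> r"] by simp
qed

end

section \<open>Conjugates of a letter\<close>

definition c2_conj :: "nat \<Rightarrow> nat \<Rightarrow> nat list \<Rightarrow> bool" where
  "c2_conj n j w \<longleftrightarrow> (\<exists>v. set v \<subseteq> {1..n} \<and> w = c2_red (rev v @ [j] @ v))"

text \<open>The conjugator is shortened as long as it begins with \<open>j\<close> or has two equal
  neighbours. Afterwards the whole word is reduced, and the first letter of the conjugator, if there
  is one, is the \<open>a\<close> on both sides of \<open>j\<close>. This centre is what the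
  ping-pong looks for.\<close>

lemma c2_conj_normal_form:
  assumes "c2_conj n j w"
  shows "w = [j] \<or> (\<exists>v a. w = rev v @ [a, j, a] @ v \<and> a \<noteq> j)"
proof -
  obtain v0 where "set v0 \<subseteq> {1..n}" "w = c2_red (rev v0 @ [j] @ v0)"
    using assms by (auto simp: c2_conj_def)
  then show ?thesis
  proof (induction v0 rule: length_induct)
    case (1 v)
    have *: "\<exists>v'. length v' < length v \<and> set v' \<subseteq> {1..n} \<and> w = c2_red (rev v' @ [j] @ v')"
      if "v = x # v'" "x = j" for x v'
      using that 1 c2.wred_cancel[of "rev v'" j "j # v'"] by (auto simp: c2_red_eq_wred simp del: wred.simps)
    have **: "\<exists>v'. length v' < length v \<and> set v' \<subseteq> {1..n} \<and> w = c2_red (rev v' @ [j] @ v')"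
      if nd: "\<not> distinct_adj v"
    proof -
      obtain p x q where v: "v = p @ x # x # q"
      proof -
        have "\<exists>p x q. v = p @ x # x # q" using nd
        proof (induction v rule: induct_list012)
          case (3 x y zs)
          show ?case
          proof (cases "x = y")
            case True
            then show ?thesis by (metis append_Nil)
          next
            case False
            then show ?thesis using 3 by (metis append_Cons distinct_adj_Cons_Cons)
          qed
        qed auto
        then show thesis using that by auto
      qed
      have "w = c2_red (rev (p @ q) @ [j] @ (p @ q))"
        using "1.prems" v c2.wred_cancel[of "rev q" x "rev p @ [j] @ p @ x # x # q"]
          c2.wred_cancel[of "rev q @ rev p @ [j] @ p" x q]
        by (simp add: c2_red_eq_wred del: wred.simps)
      then show ?thesis
        using 1 v by (intro exI[of _ "p @ q"]) auto
    qed
    show ?case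
    proof (cases "v = [] \<or> (distinct_adj v \<and> hd v \<noteq> j)")
      case True
      show ?thesis
      proof (cases v)
        case (Cons a r)
        then have "distinct_adj (rev v @ [j] @ v)"
          using True by (auto simp: distinct_adj_append_iff distinct_adj_Cons last_rev)
        then show ?thesis
          using 1 Cons True by (metis append.assoc append_Cons append_Nil c2_red_fixed_iff list.sel(1) list.distinct(1) rev.simps(2))
      qed (use 1 in auto)
    next
      case False
      then show ?thesis
        using 1 * ** by (metis list.exhaust_sel)
    qed
  qed
qed

lemma c2_conj_hom:
  assumes \<theta>: "c2_end n \<theta>" and j: "j \<in> {1..n}" "c2_conj n k (\<theta> [j])" and w: "c2_conj n j w"
  shows "c2_conj n k (\<theta> w)"
proof -
  obtain v where v: "set v \<subseteq> {1..n}" "w = c2_red (rev v @ [j] @ v)"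
    using w by (auto simp: c2_conj_def)
  obtain u where u: "set u \<subseteq> {1..n}" "\<theta> [j] = c2_red (rev u @ [k] @ u)"
    using j by (auto simp: c2_conj_def)
  let ?v = "c2_red v"
  have v': "?v \<in> C2_carrier n" "[j] \<in> C2_carrier n"
    using v j by (simp_all add: c2_red_in_carrier) (simp add: C2_carrier_iff)
  \<comment> \<open>Both words are inverse to \<open>?v\<close>, so uniqueness of inverses makes
    reduction commute with reversal.\<close>
  have rv: "c2_red (rev v) = rev ?v"
    using inv_C2_grp[OF v'(1)] group.inv_equality[OF group_C2_grp[of n], of "c2_red (rev v)" ?v] v v'
    by (simp add: c2_mult_def c2_red_in_carrier)
  have "w = c2_mult (rev ?v) (c2_mult [j] ?v)"
    unfolding v(2) rv[symmetric] by (simp add: c2_mult_def)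
  then have "\<theta> w = c2_mult (rev (\<theta> ?v)) (c2_mult (\<theta> [j]) (\<theta> ?v))"
    using v' c2_endD[OF \<theta>] by (simp add: c2_mult_closed)
  also have "\<dots> = c2_red (rev (u @ \<theta> ?v) @ [k] @ (u @ \<theta> ?v))"
    unfolding u(2) by (simp add: c2_mult_def)
  finally show ?thesis
    unfolding c2_conj_def using u c2_endD(1)[OF \<theta> v'(1)]
    by (intro exI[of _ "u @ \<theta> ?v"]) (auto simp: C2_carrier_iff)
qed

section \<open>Conjugation and normalisers\<close>

context group
begin

definition conj_by :: "'a \<Rightarrow> 'a \<Rightarrow> 'a" where
  "conj_by g x = inv g \<otimes> x \<otimes> g"

text \<open>Both directions are demanded because conjugation may map an infinite \<open>T\<close>
  into itself without mapping it onto itself; this makes closure under inverses immediate.\<close>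

definition normalizing :: "'a set \<Rightarrow> 'a set" where
  "normalizing T = {g \<in> carrier G. \<forall>x\<in>T. conj_by g x \<in> T \<and> conj_by (inv g) x \<in> T}"

lemma inv_mult_cancel [simp]:
  assumes "x \<in> carrier G" "y \<in> carrier G"
  shows "inv x \<otimes> (x \<otimes> y) = y" "x \<otimes> (inv x \<otimes> y) = y"
  using assms by (simp_all add: m_assoc[symmetric])

lemma conj_by_closed [simp]: "g \<in> carrier G \<Longrightarrow> x \<in> carrier G \<Longrightarrow> conj_by g x \<in> carrier G"
  by (simp add: conj_by_def)

lemma conj_by_mult:
  "\<lbrakk>g \<in> carrier G; x \<in> carrier G; y \<in> carrier G\<rbrakk> \<Longrightarrow> conj_by g (x \<otimes> y) = conj_by g x \<otimes> conj_by g y"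
  by (simp add: conj_by_def m_assoc)

lemma conj_by_inv: "\<lbrakk>g \<in> carrier G; x \<in> carrier G\<rbrakk> \<Longrightarrow> conj_by g (inv x) = inv (conj_by g x)"
  by (simp add: conj_by_def m_assoc inv_mult_group)

lemma conj_by_one [simp]: "g \<in> carrier G \<Longrightarrow> conj_by g \<one> = \<one>"
  by (simp add: conj_by_def)

lemma conj_one_by [simp]: "x \<in> carrier G \<Longrightarrow> conj_by \<one> x = x"
  by (simp add: conj_by_def)

lemma conj_by_comp:
  "\<lbrakk>g \<in> carrier G; h \<in> carrier G; x \<in> carrier G\<rbrakk> \<Longrightarrow> conj_by (g \<otimes> h) x = conj_by h (conj_by g x)"
  by (simp add: conj_by_def m_assoc inv_mult_group)

lemma conj_by_cancel [simp]:
  assumes "g \<in> carrier G" "x \<in> carrier G"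
  shows "conj_by g (conj_by (inv g) x) = x" "conj_by (inv g) (conj_by g x) = x"
  using assms by (simp_all add: conj_by_def m_assoc)

lemma conj_by_move:
  assumes "g \<in> carrier G" "x \<in> carrier G"
  shows "x \<otimes> g = g \<otimes> conj_by g x" "g \<otimes> x = conj_by (inv g) x \<otimes> g"
  using assms by (simp_all add: conj_by_def m_assoc)

lemma conj_by_commute:
  assumes "g \<in> carrier G" "x \<in> carrier G" "g \<otimes> x = x \<otimes> g"
  shows "conj_by g x = x" "conj_by (inv g) x = x"
proof -
  show 1: "conj_by g x = x"
    using assms by (metis conj_by_def inv_mult_cancel(1) inv_closed m_assoc)
  show "conj_by (inv g) x = x"
    using conj_by_cancel(2)[of g x] assms 1 by simp
qed

lemma conj_by_fixed_inv: "\<lbrakk>g \<in> carrier G; x \<in> carrier G; conj_by g x = x\<rbrakk> \<Longrightarrow> conj_by (inv g) x = x"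
  by (metis conj_by_cancel(2))

lemma subgroup_normalizing:
  assumes T: "T \<subseteq> carrier G"
  shows "subgroup (normalizing T) G"
proof (rule subgroupI)
  show "normalizing T \<noteq> {}"
    using T by (auto simp: normalizing_def intro!: exI[of _ \<one>])
next
  fix a b assume "a \<in> normalizing T" "b \<in> normalizing T"
  then show "a \<otimes> b \<in> normalizing T"
    using T by (auto simp: normalizing_def conj_by_comp inv_mult_group subset_iff)
qed (auto simp: normalizing_def)

lemma conj_by_generate:
  assumes g: "g \<in> carrier G" and X: "X \<subseteq> carrier G" and H: "subgroup H G"
    and inH: "\<And>x. x \<in> X \<Longrightarrow> conj_by g x \<in> H" and y: "y \<in> generate G X"
  shows "conj_by g y \<in> H"
  using y
proof (induction y rule: generate.induct)
  case one
  then show ?case using g subgroup.one_closed[OF H] by simp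
next
  case (incl h)
  then show ?case using inH by simp
next
  case (inv h)
  then show ?case
    using inH g X subgroup.m_inv_closed[OF H] by (simp add: conj_by_inv subset_iff)
next
  case (eng h1 h2)
  then show ?case
    using subgroup.m_closed[OF H] g generate_in_carrier[OF X] by (simp add: conj_by_mult)
qed

lemma normalizing_generate:
  assumes g: "g \<in> carrier G" and X: "X \<subseteq> carrier G"
    and "\<And>x. x \<in> X \<Longrightarrow> conj_by g x \<in> generate G X"
    and "\<And>x. x \<in> X \<Longrightarrow> conj_by (inv g) x \<in> generate G X"
  shows "g \<in> normalizing (generate G X)"
  using conj_by_generate[OF g X generate_is_subgroup[OF X]]
    conj_by_generate[OF inv_closed[OF g] X generate_is_subgroup[OF X]] assms
  by (auto simp: normalizing_def)

lemma subgroup_set_mult: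
  assumes H: "subgroup H G" and T: "subgroup T G" and HT: "H \<subseteq> normalizing T"
  shows "subgroup (H <#> T) G"
proof -
  note cH = subgroup.mem_carrier[OF H] and cT = subgroup.mem_carrier[OF T]
  have n: "conj_by h t \<in> T" if "h \<in> H" "t \<in> T" for h t
    using that HT by (auto simp: normalizing_def)
  have I: "h \<otimes> t \<in> H <#> T" if "h \<in> H" "t \<in> T" for h t
    using that by (auto simp: set_mult_def)
  show ?thesis
  proof (rule subgroupI)
    show "H <#> T \<subseteq> carrier G"
      using cH cT by (auto simp: set_mult_def)
    show "H <#> T \<noteq> {}"
      using subgroup.one_closed[OF H] subgroup.one_closed[OF T] by (auto simp: set_mult_def)
  next
    fix a assume "a \<in> H <#> T"
    then obtain h t where a: "h \<in> H" "t \<in> T" "a = h \<otimes> t" by (auto simp: set_mult_def)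
    then have "inv a = inv h \<otimes> conj_by (inv h) (inv t)"
      using cH cT by (simp add: inv_mult_group conj_by_def m_assoc)
    then show "inv a \<in> H <#> T"
      using a n subgroup.m_inv_closed[OF H] subgroup.m_inv_closed[OF T] by (auto intro!: I)
  next
    fix a b assume "a \<in> H <#> T" "b \<in> H <#> T"
    then obtain h t h' t' where a: "h \<in> H" "t \<in> T" "a = h \<otimes> t" and b: "h' \<in> H" "t' \<in> T" "b = h' \<otimes> t'"
      by (auto simp: set_mult_def)
    then have "a \<otimes> b = (h \<otimes> h') \<otimes> (conj_by h' t \<otimes> t')"
      using cH cT by (simp add: conj_by_def m_assoc)
    then show "a \<otimes> b \<in> H <#> T"
      using a b n subgroup.m_closed[OF H] subgroup.m_closed[OF T] by (auto intro!: I)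
  qed
qed

text \<open>Appending generators on the right suits a right action, where the last factor acts last,
  and decompositions shown to be stable under right multiplication.\<close>

lemma generate_right_induct [consumes 2, case_names one mult mult_inv]:
  assumes X: "X \<subseteq> carrier G" and y: "y \<in> generate G X" and one: "P \<one>"
    and mult: "\<And>x h. x \<in> carrier G \<Longrightarrow> P x \<Longrightarrow> h \<in> X \<Longrightarrow> P (x \<otimes> h)"
    and mult_inv: "\<And>x h. x \<in> carrier G \<Longrightarrow> P x \<Longrightarrow> h \<in> X \<Longrightarrow> P (x \<otimes> inv h)"
  shows "P y"
proof -
  have "P (x \<otimes> y)" if "P x" "x \<in> carrier G" for x
    using y that
  proof (induction y arbitrary: x rule: generate.induct)
    case (eng h1 h2)
    have c: "h1 \<in> carrier G" "h2 \<in> carrier G" using eng generate_in_carrier[OF X] by auto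
    have "P ((x \<otimes> h1) \<otimes> h2)" using eng c by simp
    then show ?case using c eng by (simp add: m_assoc)
  qed (use mult mult_inv in auto)
  from this[of \<one>] show ?thesis
    using one generate_in_carrier[OF X y] by simp
qed

end

section \<open>Combing a group with braid generators\<close>

text \<open>The relations are assumed to hold, not to be the only ones. Here \<open>n\<close> counts
  strands, so the generators are \<open>s 1\<close> up to \<open>s (n - 1)\<close>; the ambient
  group may contain further elements.\<close>

locale braid_gens = group G for G (structure) +
  fixes n :: nat and s :: "nat \<Rightarrow> 'a"
  assumes s_closed [simp]: "\<lbrakk>1 \<le> i; i < n\<rbrakk> \<Longrightarrow> s i \<in> carrier G"
    and braid: "\<lbrakk>1 \<le> i; Suc i < n\<rbrakk> \<Longrightarrow> s i \<otimes> s (Suc i) \<otimes> s i = s (Suc i) \<otimes> s i \<otimes> s (Suc i)"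
    and far: "\<lbrakk>1 \<le> i; Suc i < j; j < n\<rbrakk> \<Longrightarrow> s i \<otimes> s j = s j \<otimes> s i"
begin

text \<open>The index counts generators: these are the braids on the first \<open>m + 1\<close>
  strands.\<close>

definition braids :: "nat \<Rightarrow> 'a set" where
  "braids m = generate G (s ` {1..m})"

text \<open>The braids in which only the strand in position \<open>m + 1\<close> moves (point pushing).\<close>
fun push :: "nat \<Rightarrow> 'a set" where
  "push 0 = {\<one>}"
| "push (Suc m) = generate G (insert (s (Suc m) \<otimes> s (Suc m)) (conj_by (s (Suc m)) ` push m))"

lemma gens_subset: "m < n \<Longrightarrow> s ` {1..m} \<subseteq> carrier G"
  by auto

lemma subgroup_braids: "m < n \<Longrightarrow> subgroup (braids m) G"
  unfolding braids_def by (rule generate_is_subgroup[OF gens_subset])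

lemma braids_carrier: "\<lbrakk>g \<in> braids m; m < n\<rbrakk> \<Longrightarrow> g \<in> carrier G"
  using subgroup.mem_carrier[OF subgroup_braids] .

lemma braids_0: "braids 0 = {\<one>}"
  by (simp add: braids_def generate_empty)

lemma s_in_braids: "\<lbrakk>1 \<le> i; i \<le> m\<rbrakk> \<Longrightarrow> s i \<in> braids m"
  unfolding braids_def by (rule generate.incl) simp

lemma braids_mono: "m \<le> k \<Longrightarrow> braids m \<subseteq> braids k"
  unfolding braids_def by (rule mono_generate) auto

lemma subgroup_push: "m < n \<Longrightarrow> subgroup (push m) G"
proof (induction m)
  case (Suc m)
  then have "push m \<subseteq> carrier G" using subgroup.subset by simp
  then show ?case using Suc by (auto intro!: generate_is_subgroup)
qed (auto simp: triv_subgroup)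

lemma push_carrier: "\<lbrakk>u \<in> push m; m < n\<rbrakk> \<Longrightarrow> u \<in> carrier G"
  using subgroup.mem_carrier[OF subgroup_push] .

lemma push_gens_subset:
  "Suc m < n \<Longrightarrow> insert (s (Suc m) \<otimes> s (Suc m)) (conj_by (s (Suc m)) ` push m) \<subseteq> carrier G"
  using push_carrier[of _ m] by auto

lemma push_subset_braids: "m < n \<Longrightarrow> push m \<subseteq> braids m"
proof (induction m)
  case (Suc m)
  have sub: "subgroup (braids (Suc m)) G" and s: "s (Suc m) \<in> braids (Suc m)"
    using Suc by (auto intro: subgroup_braids s_in_braids)
  have "push m \<subseteq> braids (Suc m)"
    using Suc braids_mono[of m "Suc m"] by auto
  then show ?case
    using s subgroup.m_closed[OF sub] subgroup.m_inv_closed[OF sub]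
    by (auto simp: conj_by_def intro!: generate_subgroup_incl[OF _ sub])
qed (simp add: braids_0)

lemma square_in_push: "s (Suc m) \<otimes> s (Suc m) \<in> push (Suc m)"
  by (auto intro: generate.incl)

lemma conj_push: "u \<in> push m \<Longrightarrow> conj_by (s (Suc m)) u \<in> push (Suc m)"
  by (auto intro: generate.incl)

text \<open>With \<open>b = s (m + 1)\<close>, the generators provide only \<open>b^-1 u b\<close>.
  The opposite conjugate is \<open>b u b^-1 = b^2 (b^-1 u b) b^-2\<close>, and \<open>b^2\<close> is
  itself a generator.\<close>

lemma conj_inv_push:
  assumes u: "u \<in> push m" and m: "Suc m < n"
  shows "conj_by (inv (s (Suc m))) u \<in> push (Suc m)"
proof -
  let ?b = "s (Suc m)"
  have c: "?b \<in> carrier G" "u \<in> carrier G" using u m push_carrier[of u m] by auto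
  have "conj_by (inv ?b) u = (?b \<otimes> ?b) \<otimes> conj_by ?b u \<otimes> inv (?b \<otimes> ?b)"
    using c by (simp add: conj_by_def m_assoc inv_mult_group)
  then show ?thesis
    using conj_push[OF u] square_in_push[of m] subgroup_push[OF m] 
    by (simp del: push.simps add: subgroup.m_closed subgroup.m_inv_closed)
qed

lemma braids_commute:
  assumes x: "x \<in> braids m" and j: "Suc m < j" "j < n"
  shows "s j \<otimes> x = x \<otimes> s j"
proof -
  have sub: "s ` {1..m} \<subseteq> carrier G" using j by auto
  have "generate G (s ` {1..m}) \<subseteq> {x \<in> carrier G. conj_by (s j) x = x}"
  proof (rule generate_subgroup_incl)
    show "subgroup {x \<in> carrier G. conj_by (s j) x = x} G"
    proof (rule subgroupI)
      show "{x \<in> carrier G. conj_by (s j) x = x} \<noteq> {}"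
        using j by (auto intro!: exI[of _ \<one>])
    qed (use j in \<open>auto simp: conj_by_inv conj_by_mult\<close>)
    show "s ` {1..m} \<subseteq> {x \<in> carrier G. conj_by (s j) x = x}"
    proof
      fix x assume "x \<in> s ` {1..m}"
      then obtain i where i: "1 \<le> i" "i \<le> m" "x = s i" by auto
      then have "conj_by (s j) x = x"
        using far[of i j] j by (intro conj_by_commute) auto
      then show "x \<in> {x \<in> carrier G. conj_by (s j) x = x}"
        using i j by simp
    qed
  qed
  then have c: "x \<in> carrier G" "s j \<in> carrier G" and "conj_by (s j) x = x"
    using x j by (auto simp: braids_def)
  then show ?thesis
    using conj_by_move(1)[OF c(2,1)] by simp
qed

lemma braid_conj:
  assumes "1 \<le> i" "Suc i < n"
  defines "a \<equiv> s i" and "b \<equiv> s (Suc i)"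
  shows "b \<otimes> a \<otimes> inv b = inv a \<otimes> b \<otimes> a" "a \<otimes> b \<otimes> inv a = inv b \<otimes> a \<otimes> b"
proof -
  have c: "a \<in> carrier G" "b \<in> carrier G" and ab: "a \<otimes> (b \<otimes> a) = b \<otimes> (a \<otimes> b)"
    using assms braid[of i] by (simp_all add: m_assoc)
  have "inv a \<otimes> b \<otimes> a \<otimes> b = inv a \<otimes> (b \<otimes> (a \<otimes> b))" using c by (simp add: m_assoc)
  also have "\<dots> = b \<otimes> a" using c ab[symmetric] by simp
  finally show "b \<otimes> a \<otimes> inv b = inv a \<otimes> b \<otimes> a"
    using c by (simp add: inv_solve_right')
  have "inv b \<otimes> a \<otimes> b \<otimes> a = inv b \<otimes> (a \<otimes> (b \<otimes> a))" using c by (simp add: m_assoc)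
  also have "\<dots> = a \<otimes> b" using c ab by simp
  finally show "a \<otimes> b \<otimes> inv a = inv b \<otimes> a \<otimes> b"
    using c by (simp add: inv_solve_right')
qed

text \<open>For \<open>j < m - 1\<close> the element \<open>s j\<close> commutes with
  \<open>s m\<close>, and the claim is inherited from \<open>push (m - 1)\<close>. For
  \<open>j = m - 1\<close> two levels of the recursion are unfolded: with
  \<open>a = s (m - 1)\<close> and \<open>b = s m\<close>, the group is generated by
  \<open>b^2\<close>, \<open>b^-1 a^2 b\<close> and all \<open>b^-1 a^-1 v a b\<close> with
  \<open>v\<close> in \<open>push (m - 2)\<close>. Conjugation by \<open>a\<close> sends
  \<open>b^-1 a^2 b\<close> to \<open>b^2\<close>, sends \<open>b^2\<close> to
  \<open>b a^2 b^-1\<close>, and fixes the elements of the third kind.\<close>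

lemma normalizing_push:
  assumes "1 \<le> j" "j < m" "m < n"
  shows "s j \<in> normalizing (push m)"
  using assms
proof (induction m arbitrary: j)
  case (Suc k)
  let ?b = "s (Suc k)"
  note sub = push_gens_subset[OF Suc.prems(3)]
  note sgU = subgroup_push[OF Suc.prems(3)]
  have sj: "s j \<in> carrier G" and b: "?b \<in> carrier G" using Suc.prems by auto
  show ?case
  proof (cases "j < k")
    case True
    have comm: "s j \<otimes> ?b = ?b \<otimes> s j"
      using far[of j "Suc k"] True Suc.prems by simp
    have comm': "inv (s j) \<otimes> ?b = ?b \<otimes> inv (s j)"
      using comm sj b by (metis inv_closed inv_solve_left inv_solve_right m_assoc m_closed)
    have bb: "conj_by (s j) (?b \<otimes> ?b) = ?b \<otimes> ?b" "conj_by (inv (s j)) (?b \<otimes> ?b) = ?b \<otimes> ?b"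
      using conj_by_commute[OF sj b comm] sj b by (simp_all add: conj_by_mult)
    have IH: "s j \<in> normalizing (push k)"
      using Suc.IH True Suc.prems by simp
    have swap: "conj_by g (conj_by ?b u) = conj_by ?b (conj_by g u)"
      if "g \<in> carrier G" "g \<otimes> ?b = ?b \<otimes> g" "u \<in> push k" for g u
      using that b push_carrier[of u k] Suc.prems by (simp flip: conj_by_comp)
    show ?thesis
      unfolding push.simps
    proof (rule normalizing_generate[OF sj sub])
      fix x assume x: "x \<in> insert (?b \<otimes> ?b) (conj_by ?b ` push k)"
      then show "conj_by (s j) x \<in> generate G (insert (?b \<otimes> ?b) (conj_by ?b ` push k))"
        using bb swap[OF sj comm] IH by (auto simp: normalizing_def intro: generate.incl)
      show "conj_by (inv (s j)) x \<in> generate G (insert (?b \<otimes> ?b) (conj_by ?b ` push k))"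
        using x bb swap[OF inv_closed[OF sj] comm'] IH by (auto simp: normalizing_def intro: generate.incl)
    qed
  next
    case False
    then obtain k' where k: "j = k" "k = Suc k'" using Suc.prems by (cases k) auto
    let ?a = "s k"
    have a: "?a \<in> carrier G" using sj k by simp
    have kn: "1 \<le> k" "Suc k < n" "k' < n" "k < n" using k Suc.prems by auto
    note bc = braid_conj[OF kn(1,2)]
    have aa: "?a \<otimes> ?a \<in> push k" using square_in_push k by simp
    note X = conj_push[OF aa] and bb = square_in_push[of k]
    have sq: "conj_by ?a (x \<otimes> x) = conj_by ?a x \<otimes> conj_by ?a x" "conj_by ?b (x \<otimes> x) = conj_by ?b x \<otimes> conj_by ?b x"
      "conj_by (inv ?a) (x \<otimes> x) = conj_by (inv ?a) x \<otimes> conj_by (inv ?a) x"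
      "conj_by (inv ?b) (x \<otimes> x) = conj_by (inv ?b) x \<otimes> conj_by (inv ?b) x" if "x \<in> carrier G" for x
      using that a b by (simp_all add: conj_by_mult)
    have e1: "conj_by ?a ?b = conj_by (inv ?b) ?a" and e2: "conj_by (inv ?a) ?b = conj_by ?b ?a"
      using bc a b by (simp_all add: conj_by_def)
    have c1: "conj_by ?a (?b \<otimes> ?b) = conj_by (inv ?b) (?a \<otimes> ?a)"
      and c2: "conj_by (inv ?a) (?b \<otimes> ?b) = conj_by ?b (?a \<otimes> ?a)"
      using e1 e2 a b by (simp_all add: sq)
    have bbU: "conj_by ?a (?b \<otimes> ?b) \<in> push (Suc k)" "conj_by (inv ?a) (?b \<otimes> ?b) \<in> push (Suc k)"
      unfolding c1 c2 using conj_inv_push[OF aa kn(2)] X by auto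
    have c3: "conj_by ?a (conj_by ?b (?a \<otimes> ?a)) = ?b \<otimes> ?b"
      using c2[symmetric] a b by simp
    \<comment> \<open>Put \<open>x = b^-1 a^2 b\<close>. The product \<open>b^2 x = b a^2 b\<close>
      commutes with \<open>a\<close>, while conjugation by \<open>a^-1\<close> turns
      \<open>b^2\<close> into \<open>x\<close>; hence \<open>x\<close> times the unknown conjugate
      of \<open>x\<close> equals \<open>b^2 x\<close>.\<close>
    have c4: "conj_by (inv ?a) (conj_by ?b (?a \<otimes> ?a)) = inv (conj_by ?b (?a \<otimes> ?a)) \<otimes> (?b \<otimes> ?b) \<otimes> conj_by ?b (?a \<otimes> ?a)"
    proof -
      have ab: "?a \<otimes> (?b \<otimes> ?a) = ?b \<otimes> (?a \<otimes> ?b)"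
        using braid[OF kn(1,2)] a b by (simp add: m_assoc)
      have "?a \<otimes> (?b \<otimes> (?a \<otimes> (?a \<otimes> ?b))) = (?a \<otimes> (?b \<otimes> ?a)) \<otimes> (?a \<otimes> ?b)"
        using a b by (simp add: m_assoc)
      also have "\<dots> = ?b \<otimes> (?a \<otimes> (?b \<otimes> (?a \<otimes> ?b)))"
        using a b ab by (simp add: m_assoc)
      also have "\<dots> = ?b \<otimes> (?a \<otimes> (?a \<otimes> (?b \<otimes> ?a)))"
        using ab by simp
      finally have "conj_by (inv ?a) (?b \<otimes> ?b \<otimes> conj_by ?b (?a \<otimes> ?a)) = ?b \<otimes> ?b \<otimes> conj_by ?b (?a \<otimes> ?a)"
        using a b by (intro conj_by_commute) (simp_all add: conj_by_def m_assoc)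
      then have "conj_by ?b (?a \<otimes> ?a) \<otimes> conj_by (inv ?a) (conj_by ?b (?a \<otimes> ?a)) = ?b \<otimes> ?b \<otimes> conj_by ?b (?a \<otimes> ?a)"
        using a b c2 by (simp add: conj_by_mult[of "inv ?a" "?b \<otimes> ?b"])
      then show ?thesis
        using a b by (simp add: inv_solve_left m_assoc)
    qed
    \<comment> \<open>As \<open>v\<close> commutes with \<open>b\<close>, conjugating it by
      \<open>bab\<close> gives the right-hand side and conjugating it by \<open>aba\<close> gives
      the left-hand side.\<close>
    have fixed: "conj_by ?a (conj_by ?b (conj_by ?a v)) = conj_by ?b (conj_by ?a v)"
      if v: "v \<in> push k'" for v
    proof -
      have vc: "v \<in> carrier G" using v kn push_carrier by auto
      have "v \<in> braids k'" using v push_subset_braids kn by auto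
      then have "conj_by ?b v = v"
        using braids_commute[of v k' "Suc k"] vc b k kn by (intro conj_by_commute) auto
      then have "conj_by (?b \<otimes> ?a \<otimes> ?b) v = conj_by ?b (conj_by ?a v)"
        using vc a b by (simp add: conj_by_comp)
      moreover have "conj_by (?a \<otimes> ?b \<otimes> ?a) v = conj_by ?a (conj_by ?b (conj_by ?a v))"
        using vc a b by (simp add: conj_by_comp)
      ultimately show ?thesis using braid[OF kn(1,2)] by simp
    qed
    have pk: "push k = generate G (insert (?a \<otimes> ?a) (conj_by ?a ` push k'))"
      using k by simp
    have subk: "insert (?a \<otimes> ?a) (conj_by ?a ` push k') \<subseteq> carrier G"
      using push_gens_subset[of k'] k kn by simp
    have main: "conj_by g (conj_by ?b u) \<in> push (Suc k)"
      if g: "g = ?a \<or> g = inv ?a" and u: "u \<in> push k" for g u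
    proof -
      have gc: "g \<in> carrier G" using g a by auto
      have gen: "conj_by (?b \<otimes> g) x \<in> push (Suc k)" if xin: "x \<in> insert (?a \<otimes> ?a) (conj_by ?a ` push k')" for x
      proof -
        have xc: "x \<in> carrier G" using xin subk by auto
        show ?thesis
        proof (cases "x = ?a \<otimes> ?a")
          case True
          have "conj_by g (conj_by ?b (?a \<otimes> ?a)) \<in> push (Suc k)"
            using g
          proof
            assume "g = ?a" then show ?thesis using c3 bb by simp
          next
            assume "g = inv ?a"
            then show ?thesis
              using c4 X bb subgroup.m_closed[OF sgU] subgroup.m_inv_closed[OF sgU] by simp
          qed
          then show ?thesis using True gc b a by (simp add: conj_by_comp del: push.simps)
        next
          case False
          then obtain v where v: "v \<in> push k'" "x = conj_by ?a v" using xin by auto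
          have "x \<in> push k" unfolding v(2) k(2) by (rule conj_push[OF v(1)])
          have "conj_by g (conj_by ?b x) = conj_by ?b x"
            using fixed[OF v(1)] v(2) g a b xc conj_by_fixed_inv[of ?a "conj_by ?b x"] by auto
          then show ?thesis
            using conj_push[OF \<open>x \<in> push k\<close>] xc gc b by (simp add: conj_by_comp del: push.simps)
        qed
      qed
      have "conj_by (?b \<otimes> g) u \<in> push (Suc k)"
        using conj_by_generate[OF m_closed[OF b gc] subk sgU gen] u unfolding pk by blast
      then show ?thesis
        using push_carrier[OF u] kn gc b by (simp add: conj_by_comp del: push.simps)
    qed
    have ja: "s j = ?a" using k by simp
    show ?thesis
      unfolding push.simps
    proof (rule normalizing_generate[OF sj sub])
      fix x assume x: "x \<in> insert (?b \<otimes> ?b) (conj_by ?b ` push k)"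
      show "conj_by (s j) x \<in> generate G (insert (?b \<otimes> ?b) (conj_by ?b ` push k))"
        using x bbU main[of ?a] unfolding ja by auto
      show "conj_by (inv (s j)) x \<in> generate G (insert (?b \<otimes> ?b) (conj_by ?b ` push k))"
        using x bbU main[of "inv ?a"] unfolding ja by auto
    qed
  qed
qed simp

lemma braids_normalizing_push: "m < n \<Longrightarrow> braids (m - 1) \<subseteq> normalizing (push m)"
  unfolding braids_def using normalizing_push[of _ m] subgroup.subset[OF subgroup_push, of m]
  by (intro generate_subgroup_incl subgroup_normalizing) auto

definition pure_last :: "nat \<Rightarrow> 'a set" where
  "pure_last m = braids (m - 1) <#> push m"

lemma subgroup_pure_last: "m < n \<Longrightarrow> subgroup (pure_last m) G"
  unfolding pure_last_def
  by (intro subgroup_set_mult subgroup_braids subgroup_push braids_normalizing_push) auto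

lemma pure_last_memI: "\<lbrakk>h \<in> braids (m - 1); u \<in> push m\<rbrakk> \<Longrightarrow> h \<otimes> u \<in> pure_last m"
  by (auto simp: pure_last_def set_mult_def)

lemma braids_subset_pure_last: "m < n \<Longrightarrow> braids (m - 1) \<subseteq> pure_last m"
  using pure_last_memI[of _ m \<one>] subgroup.one_closed[OF subgroup_push, of m] braids_carrier[of _ "m - 1"]
  by fastforce

lemma push_subset_pure_last: "m < n \<Longrightarrow> push m \<subseteq> pure_last m"
  using pure_last_memI[of \<one> m] subgroup.one_closed[OF subgroup_braids, of "m - 1"] push_carrier[of _ m]
  by fastforce

text \<open>Among the braids on \<open>m + 1\<close> strands, those returning the last strand to its place form
  \<open>pure_last m\<close>; all the others lie in one double coset.\<close>
lemma combing:
  assumes "g \<in> braids m" "m < n"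
  shows "g \<in> pure_last m \<or>
    (1 \<le> m \<and> (\<exists>k \<in> pure_last m. \<exists>h \<in> braids (m - 1). g = k \<otimes> s m \<otimes> h))"
  using assms
proof (induction m arbitrary: g)
  case 0
  then show ?case
    by (auto simp: pure_last_def set_mult_def braids_0)
next
  case (Suc m)
  let ?K = "pure_last (Suc m)" and ?b = "s (Suc m)"
  let ?P = "\<lambda>g. g \<in> ?K \<or> (\<exists>k \<in> ?K. \<exists>h \<in> braids m. g = k \<otimes> ?b \<otimes> h)"
  have sub: "s ` {1..Suc m} \<subseteq> carrier G" and b: "?b \<in> carrier G" using Suc.prems by auto
  note sgK = subgroup_pure_last[OF Suc.prems(2)]
  have sgB: "subgroup (braids m) G" using Suc.prems by (simp add: subgroup_braids)
  note Km = subgroup.m_closed[OF sgK] and Kc = subgroup.mem_carrier[OF sgK]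
  note Bm = subgroup.m_closed[OF sgB] and Bc = subgroup.mem_carrier[OF sgB]
  have BK: "braids m \<subseteq> ?K" using braids_subset_pure_last[OF Suc.prems(2)] by simp
  have UK: "push (Suc m) \<subseteq> ?K" by (rule push_subset_pure_last[OF Suc.prems(2)])
  have bbK: "?b \<otimes> ?b \<in> ?K" using UK square_in_push[of m] by auto
  have PB: "?P (x \<otimes> t)" if "?P x" "t \<in> braids m" for x t
    using that(1)
  proof
    assume "x \<in> ?K" then show ?thesis using Km BK that by auto
  next
    assume "\<exists>k \<in> ?K. \<exists>h \<in> braids m. x = k \<otimes> ?b \<otimes> h"
    then obtain k h where kh: "k \<in> ?K" "h \<in> braids m" "x = k \<otimes> ?b \<otimes> h" by auto
    then have "x \<otimes> t = k \<otimes> ?b \<otimes> (h \<otimes> t)"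
      using Kc Bc b that by (simp add: m_assoc)
    then show ?thesis using kh Bm that by auto
  qed
  \<comment> \<open>The essential case: a new \<open>b\<close> or \<open>b^-1\<close> meets the
    factor \<open>h\<close> standing behind an earlier \<open>b\<close>. The induction hypothesis
    splits \<open>h\<close>; factors from \<open>braids (m - 1)\<close> slide past \<open>b\<close>,
    and pushing elements are conjugated into \<open>push (m + 1)\<close>.\<close>
  have Pb: "?P (k \<otimes> (?b \<otimes> h \<otimes> e))" if k: "k \<in> ?K" and h: "h \<in> braids m" and e: "e = ?b \<or> e = inv ?b" for k h e
  proof -
    have kc: "k \<in> carrier G" and hc: "h \<in> carrier G" and ec: "e \<in> carrier G"
      using k h e Kc Bc b by auto
    have comm: "?b \<otimes> t = t \<otimes> ?b" "e \<otimes> t = t \<otimes> e" if "t \<in> braids (m - 1)" "1 \<le> m" for t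
    proof -
      have tc: "t \<in> carrier G" using that Suc.prems braids_carrier by simp
      show bt: "?b \<otimes> t = t \<otimes> ?b"
        using braids_commute[of t "m - 1" "Suc m"] that Suc.prems by simp
      show "e \<otimes> t = t \<otimes> e"
        using e bt tc b by (metis inv_closed inv_solve_left inv_solve_right m_assoc m_closed)
    qed
    \<comment> \<open>For \<open>m = 0\<close> truncated subtraction turns
      \<open>braids (m - 1)\<close> into \<open>braids 0\<close>, which is trivial.\<close>
    have t0: "t = \<one>" if "t \<in> braids (m - 1)" "\<not> 1 \<le> m" for t
      using that braids_0 by (cases m) auto
    have comm: "?b \<otimes> t = t \<otimes> ?b" "e \<otimes> t = t \<otimes> e" if "t \<in> braids (m - 1)" for t
      using comm[OF that] t0[OF that] b ec by (cases "1 \<le> m"; simp)+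
    have pushU: "conj_by (inv ?b) u \<in> ?K" if "u \<in> push m" for u
      using conj_inv_push[OF that Suc.prems(2)] UK by auto
    have small: "t \<in> ?K" if "t \<in> braids (m - 1)" for t
      using that BK braids_mono[of "m - 1" m] by auto
    from Suc.IH[of h] h Suc.prems
    have "h \<in> pure_last m \<or> (1 \<le> m \<and> (\<exists>k \<in> pure_last m. \<exists>h' \<in> braids (m - 1). h = k \<otimes> s m \<otimes> h'))" by simp
    then show ?thesis
    proof
      assume "h \<in> pure_last m"
      then obtain t u where tu: "t \<in> braids (m - 1)" "u \<in> push m" "h = t \<otimes> u"
        by (auto simp: pure_last_def set_mult_def)
      have c: "t \<in> carrier G" "u \<in> carrier G"
        using tu Suc.prems braids_carrier push_carrier by auto
      have be: "?b \<otimes> e \<in> ?K" using e bbK b subgroup.one_closed[OF sgK] by auto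
      have "?b \<otimes> h \<otimes> e = (?b \<otimes> t) \<otimes> u \<otimes> e" using tu c b ec by (simp add: m_assoc)
      also have "\<dots> = t \<otimes> conj_by (inv ?b) u \<otimes> (?b \<otimes> e)"
        unfolding comm(1)[OF tu(1)] using c b ec by (simp add: conj_by_def m_assoc)
      finally show ?thesis
        using Km[OF k Km[OF Km[OF small[OF tu(1)] pushU[OF tu(2)]] be]] by simp
    next
      assume "1 \<le> m \<and> (\<exists>k \<in> pure_last m. \<exists>h' \<in> braids (m - 1). h = k \<otimes> s m \<otimes> h')"
      then obtain t u r where m: "1 \<le> m" and tu: "t \<in> braids (m - 1)" "u \<in> push m" "r \<in> braids (m - 1)"
        "h = t \<otimes> u \<otimes> s m \<otimes> r"
        by (auto simp: pure_last_def set_mult_def)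
      let ?a = "s m"
      have c: "t \<in> carrier G" "u \<in> carrier G" "r \<in> carrier G" "?a \<in> carrier G"
        using tu m Suc.prems braids_carrier push_carrier by auto
      have aB: "?a \<in> braids m" by (rule s_in_braids) (use m in auto)
      \<comment> \<open>Unifies \<open>b a b = a b a\<close> and \<open>b a b^-1 = a^-1 b a\<close>:
        the letter \<open>e\<close> passes to the left and becomes the corresponding power of
        \<open>a\<close>.\<close>
      define f where "f = (if e = ?b then ?a else inv ?a)"
      have f: "f \<in> braids m" "f \<in> carrier G"
        using aB subgroup.m_inv_closed[OF sgB] c by (auto simp: f_def)
      have bae: "?b \<otimes> ?a \<otimes> e = f \<otimes> ?b \<otimes> ?a"
        using e braid[of m] braid_conj(1)[of m] m Suc.prems by (auto simp: f_def)
      have "?b \<otimes> h \<otimes> e = (?b \<otimes> t) \<otimes> u \<otimes> ?a \<otimes> (r \<otimes> e)"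
        using tu(4) c b ec by (simp add: m_assoc)
      also have "\<dots> = t \<otimes> conj_by (inv ?b) u \<otimes> (?b \<otimes> ?a \<otimes> e) \<otimes> r"
        unfolding comm(1)[OF tu(1)] comm(2)[OF tu(3), symmetric] using c b ec
        by (simp add: conj_by_def m_assoc)
      also have "\<dots> = t \<otimes> conj_by (inv ?b) u \<otimes> f \<otimes> ?b \<otimes> (?a \<otimes> r)"
        unfolding bae using c b f by (simp add: m_assoc)
      finally have "k \<otimes> (?b \<otimes> h \<otimes> e) = (k \<otimes> (t \<otimes> conj_by (inv ?b) u \<otimes> f)) \<otimes> ?b \<otimes> (?a \<otimes> r)"
        using c b f kc by (simp add: m_assoc)
      moreover have "k \<otimes> (t \<otimes> conj_by (inv ?b) u \<otimes> f) \<in> ?K"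
        using Km k small[OF tu(1)] pushU[OF tu(2)] f BK by auto
      moreover have "?a \<otimes> r \<in> braids m"
        using Bm[OF aB] tu(3) braids_mono[of "m - 1" m] by auto
      ultimately show ?thesis by blast
    qed
  qed
  have bstep: "?P (x \<otimes> e)" if "?P x" and e: "e = ?b \<or> e = inv ?b" for x e
    using that(1)
  proof
    assume x: "x \<in> ?K"
    have xc: "x \<in> carrier G" using x Kc by auto
    \<comment> \<open>The double coset is written with a positive \<open>b\<close>; a factor
      \<open>b^-1\<close> is replaced by \<open>b^-2 b\<close>, and the square is absorbed into
      \<open>?K\<close>.\<close>
    have "x \<otimes> ?b = x \<otimes> ?b \<otimes> \<one>" "x \<otimes> inv ?b = (x \<otimes> inv (?b \<otimes> ?b)) \<otimes> ?b \<otimes> \<one>"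
      using xc b by (simp_all add: m_assoc inv_mult_group)
    moreover have "x \<otimes> inv (?b \<otimes> ?b) \<in> ?K"
      using x bbK Km subgroup.m_inv_closed[OF sgK] by auto
    ultimately show ?thesis
      using e x subgroup.one_closed[OF sgB] by blast
  next
    assume "\<exists>k \<in> ?K. \<exists>h \<in> braids m. x = k \<otimes> ?b \<otimes> h"
    then obtain k h where kh: "k \<in> ?K" "h \<in> braids m" "x = k \<otimes> ?b \<otimes> h" by auto
    then have "x \<otimes> e = k \<otimes> (?b \<otimes> h \<otimes> e)"
      using Kc Bc b e by (auto simp: m_assoc)
    then show ?thesis using Pb[OF kh(1,2) e] by simp
  qed
  have gm: "g \<in> generate G (s ` {1..Suc m})" using Suc.prems by (simp add: braids_def)
  have "?P g"
    using sub gm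
  proof (induction g rule: generate_right_induct)
    case one
    then show ?case using subgroup.one_closed[OF sgK] by simp
  next
    case (mult x h)
    then obtain i where i: "1 \<le> i" "i \<le> Suc m" "h = s i" by auto
    show ?case
    proof (cases "i = Suc m")
      case True then show ?thesis using bstep[OF mult.IH, of h] i by simp
    next
      case False then show ?thesis using PB[OF mult.IH, of h] i s_in_braids[of i m] by simp
    qed
  next
    case (mult_inv x h)
    then obtain i where i: "1 \<le> i" "i \<le> Suc m" "h = s i" by auto
    show ?case
    proof (cases "i = Suc m")
      case True then show ?thesis using bstep[OF mult_inv.IH, of "inv h"] i by simp
    next
      case False then show ?thesis
        using PB[OF mult_inv.IH, of "inv h"] i s_in_braids[of i m] subgroup.m_inv_closed[OF sgB] by simp
    qed
  qed
  then show ?case by simp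
qed

end

section \<open>Faithfulness of the braid action\<close>

text \<open>Alternating products of nontrivial powers of \<open>A\<close> and nontrivial elements of \<open>V\<close>; the flag
  tells whether the last factor is a power of \<open>A\<close>.\<close>
inductive alternating :: "('a, 'b) monoid_scheme \<Rightarrow> 'a set \<Rightarrow> 'a \<Rightarrow> bool \<Rightarrow> 'a \<Rightarrow> bool"
  for G (structure) and V and A where
  one: "alternating G V A b \<one>"
| power: "alternating G V A False v \<Longrightarrow> e \<noteq> 0 \<Longrightarrow> alternating G V A True (v \<otimes> A [^] (e :: int))"
| element: "alternating G V A True v \<Longrightarrow> g \<in> V \<Longrightarrow> g \<noteq> \<one> \<Longrightarrow> alternating G V A False (v \<otimes> g)"

context group
begin

lemma alternating_closed:
  assumes "alternating G V A b x" "V \<subseteq> carrier G" "A \<in> carrier G"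
  shows "x \<in> carrier G"
  using assms by (induction rule: alternating.induct) auto

text \<open>A new power merges with a final power of \<open>A\<close>. When the exponents cancel,
  the shorter product that remains is again alternating.\<close>

lemma alternating_mult_power:
  assumes x: "alternating G V A b x" and V: "V \<subseteq> carrier G" and A: "A \<in> carrier G"
  shows "\<exists>b'. alternating G V A b' (x \<otimes> A [^] (e :: int))"
proof (cases "e = 0")
  case True
  then show ?thesis
    using x alternating_closed[OF x V A] by auto
next
  case False
  show ?thesis
    using x
  proof cases
    case one
    then show ?thesis
      using alternating.power[OF alternating.one False, of G V A] A by auto
  next
    case (power v e')
    have "x \<otimes> A [^] e = v \<otimes> A [^] (e' + e)"
      using power alternating_closed[OF power(3) V A] A by (simp add: int_pow_mult m_assoc)
    then show ?thesis
      using power alternating.power[OF power(3), of "e' + e"] alternating_closed[OF power(3) V A]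
      by (cases "e' + e = 0") auto
  next
    case (element v g)
    then show ?thesis
      using alternating.power[OF _ False, of G V A x] x by auto
  qed
qed

lemma alternating_mult_element:
  assumes x: "alternating G V A b x" and V: "subgroup V G" and A: "A \<in> carrier G" and h: "h \<in> V"
  shows "\<exists>b'. alternating G V A b' (x \<otimes> h)"
proof (cases "h = \<one>")
  case True
  then show ?thesis
    using x alternating_closed[OF x subgroup.subset[OF V] A] by auto
next
  case False
  note c = subgroup.mem_carrier[OF V]
  show ?thesis
    using x
  proof cases
    case one
    then show ?thesis
      using alternating.element[OF alternating.one h False, of A] c[OF h] by auto
  next
    case (power v e')
    then show ?thesis
      using alternating.element[OF _ h False, of A x] x by auto
  next
    case (element v g)
    note vc = alternating_closed[OF element(3) subgroup.subset[OF V] A]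
    have "x \<otimes> h = v \<otimes> (g \<otimes> h)"
      using element vc c[OF h] c[OF element(4)] by (simp add: m_assoc)
    then show ?thesis
      using element alternating.element[OF element(3), of "g \<otimes> h"] vc subgroup.m_closed[OF V element(4) h]
      by (cases "g \<otimes> h = \<one>") auto
  qed
qed

lemma generate_alternating:
  assumes V: "subgroup V G" and A: "A \<in> carrier G" and y: "y \<in> generate G (insert A V)"
  shows "\<exists>b. alternating G V A b y"
proof -
  have sub: "insert A V \<subseteq> carrier G" using A subgroup.subset[OF V] by auto
  show ?thesis
    using sub y
  proof (induction y rule: generate_right_induct)
    case one
    show ?case by (intro exI alternating.one)
  next
    case (mult x h)
    then obtain b where b: "alternating G V A b x" by auto
    have "A = A [^] (1 :: int)" using A by simp
    then show ?case
      using mult alternating_mult_power[OF b subgroup.subset[OF V] A, of 1]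
        alternating_mult_element[OF b V A, of h] by auto
  next
    case (mult_inv x h)
    then obtain b where b: "alternating G V A b x" by auto
    have "inv A = A [^] (-1 :: int)" using A by (simp add: int_pow_neg)
    then show ?case
      using mult_inv alternating_mult_power[OF b subgroup.subset[OF V] A, of "-1"]
        alternating_mult_element[OF b V A, of "inv h"] subgroup.m_inv_closed[OF V] by auto
  qed
qed

text \<open>The action is on the right, so the last factor acts last and alone decides in which set
  the image lies. The point \<open>p\<close> is added to both sets because the first factor acts on
  \<open>p\<close> itself.\<close>

lemma ping_pong:
  assumes V: "subgroup V G" and A: "A \<in> carrier G" and y: "y \<in> generate G (insert A V)"
    and mult: "\<And>x y. x \<in> carrier G \<Longrightarrow> y \<in> carrier G \<Longrightarrow> f (x \<otimes> y) p = f y (f x p)"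
    and one: "f \<one> p = p"
    and X: "\<And>e :: int. \<And>w. e \<noteq> 0 \<Longrightarrow> w \<in> insert p X \<Longrightarrow> f (A [^] e) w \<in> Y"
    and Y: "\<And>g w. g \<in> V \<Longrightarrow> g \<noteq> \<one> \<Longrightarrow> w \<in> insert p Y \<Longrightarrow> f g w \<in> X"
  shows "y = \<one> \<or> f y p \<in> X \<union> Y"
proof -
  note cl = alternating_closed[OF _ subgroup.subset[OF V] A]
  obtain b where "alternating G V A b y" using generate_alternating[OF V A y] by auto
  then have "y = \<one> \<or> f y p \<in> (if b then Y else X)"
  proof (induction rule: alternating.induct)
    case (power v e)
    have "f v p \<in> insert p X" using power one by auto
    then show ?case
      using X[OF power(2)] mult[OF cl[OF power(1)]] A by simp
  next
    case (element v g)
    have "f v p \<in> insert p Y" using element one by auto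
    then show ?case
      using Y[OF element(2,3)] mult[OF cl[OF element(1)]] subgroup.mem_carrier[OF V element(2)] by simp
  qed simp
  then show ?thesis by (auto split: if_splits)
qed

end

section \<open>Endomorphisms given on letters, and the deletion of a letter\<close>

lemma c2_end_concat_map:
  assumes "\<And>k. k \<in> {1..n} \<Longrightarrow> set (f k) \<subseteq> {1..n} \<and> c2_red (f k @ f k) = []"
  shows "c2_end n (\<lambda>w. c2_red (concat (map f w)))"
  unfolding c2_end_def
proof (rule homI)
  fix v w assume "v \<in> carrier (C2_grp n)" "w \<in> carrier (C2_grp n)"
  then have "set (v @ w) \<subseteq> {1..n}" by (auto simp: C2_carrier_def)
  then have "c2_red (concat (map f (c2_red (v @ w)))) = c2_red (concat (map f (v @ w)))"
    using assms by (intro c2_red_concat_map) blast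
  then show "c2_red (concat (map f (v \<otimes>\<^bsub>C2_grp n\<^esub> w))) =
      c2_red (concat (map f v)) \<otimes>\<^bsub>C2_grp n\<^esub> c2_red (concat (map f w))"
    by (simp add: c2_mult_def)
next
  fix w assume "w \<in> carrier (C2_grp n)"
  then have "set (concat (map f w)) \<subseteq> {1..n}"
    using assms by (fastforce simp: C2_carrier_def)
  then show "c2_red (concat (map f w)) \<in> carrier (C2_grp n)"
    by (simp add: c2_red_in_carrier)
qed

lemma c2_end_comp: "c2_end n \<theta> \<Longrightarrow> c2_end n \<eta> \<Longrightarrow> c2_end n (\<lambda>w. \<theta> (\<eta> w))"
  unfolding c2_end_def using hom_compose[of \<eta> "C2_grp n" "C2_grp n" \<theta> "C2_grp n"] by (simp add: comp_def)

lemma c2_end_set: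
  assumes \<theta>: "c2_end n \<theta>" and w: "w \<in> C2_carrier n" and S: "\<And>k. k \<in> set w \<Longrightarrow> set (\<theta> [k]) \<subseteq> S"
  shows "set (\<theta> w) \<subseteq> S"
  using w S
proof (induction w rule: c2_induct)
  case Nil
  then show ?case using c2_endD(3)[OF \<theta>] by simp
next
  case (Cons k w)
  have "[k] \<in> C2_carrier n" using Cons.hyps(1) by (simp add: C2_carrier_iff)
  then have "\<theta> (k # w) = c2_red (\<theta> [k] @ \<theta> w)"
    using c2_endD(2)[OF \<theta> _ Cons.hyps(2), of "[k]"] Cons.hyps(4) by (metis c2_mult_def)
  moreover have "set (\<theta> [k] @ \<theta> w) \<subseteq> S"
    using Cons.IH Cons.prems by simp
  ultimately show ?case
    using set_c2_red subset_trans by metis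
qed

definition kill :: "nat \<Rightarrow> nat list \<Rightarrow> nat list" where
  "kill j w = c2_red (concat (map (\<lambda>k. if k = j then [] else [k]) w))"

text \<open>This is the action of \<open>s j\<close> followed by \<open>kill (Suc j)\<close>: letter
  \<open>j\<close> disappears and letter \<open>j + 1\<close> takes its place. It carries the
  induction for \<open>kill_push\<close> from one index to the next.\<close>

definition kill_shift :: "nat \<Rightarrow> nat list \<Rightarrow> nat list" where
  "kill_shift j w = c2_red (concat (map (\<lambda>k. if k = j then [] else if k = Suc j then [j] else [k]) w))"

lemma c2_end_kill: "c2_end n (kill j)"
  unfolding kill_def by (rule c2_end_concat_map) auto

lemma c2_end_kill_shift: "1 \<le> j \<Longrightarrow> c2_end n (kill_shift j)"
  unfolding kill_shift_def by (rule c2_end_concat_map) auto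

lemma kill_id:
  assumes "w \<in> C2_carrier n" "j \<notin> set w"
  shows "kill j w = w"
proof -
  have "concat (map (\<lambda>k. if k = j then [] else [k]) w) = w"
    using assms(2) by (induction w) auto
  then show ?thesis
    using assms(1) by (simp add: kill_def C2_carrier_def)
qed

lemma kill_shift_kill: "1 \<le> j \<Longrightarrow> w \<in> C2_carrier n \<Longrightarrow> kill_shift j (kill j w) = kill_shift j w"
  by (rule c2_end_eqI[OF c2_end_comp[OF c2_end_kill_shift c2_end_kill] c2_end_kill_shift])
     (auto simp: kill_def kill_shift_def)

text \<open>To be applied to \<open>ArtD n\<close> acting through the first component of its
  homomorphism to the semidirect product. There the last Artin generator acts like the one before
  it, so faithfulness can be expected only on the elements of \<open>braids\<close>.\<close>

locale braid_rep = braid_gens +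
  fixes act :: "'a \<Rightarrow> nat list \<Rightarrow> nat list"
  assumes act_end: "x \<in> carrier G \<Longrightarrow> c2_end n (act x)"
    and act_mult: "\<lbrakk>x \<in> carrier G; y \<in> carrier G; w \<in> C2_carrier n\<rbrakk> \<Longrightarrow> act (x \<otimes> y) w = act y (act x w)"
    and act_one: "w \<in> C2_carrier n \<Longrightarrow> act \<one> w = w"
    and act_s: "\<lbrakk>1 \<le> i; i < n; w \<in> C2_carrier n\<rbrakk> \<Longrightarrow> act (s i) w = c2_red (concat (map (sigma_img i) w))"
begin

lemma letter_in_C2: "1 \<le> k \<Longrightarrow> k \<le> n \<Longrightarrow> [k] \<in> C2_carrier n"
  by (simp add: C2_carrier_iff)

lemma act_closed: "\<lbrakk>x \<in> carrier G; w \<in> C2_carrier n\<rbrakk> \<Longrightarrow> act x w \<in> C2_carrier n"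
  using c2_endD(1)[OF act_end] .

lemma act_inv:
  assumes "x \<in> carrier G" "w \<in> C2_carrier n"
  shows "act (inv x) (act x w) = w" "act x (act (inv x) w) = w"
  using assms act_mult[of x "inv x" w] act_mult[of "inv x" x w] by (simp_all add: act_one)

lemma inj_act: "x \<in> carrier G \<Longrightarrow> inj_on (act x) (C2_carrier n)"
  using act_inv(1) by (metis inj_onI)

lemma act_s_letters:
  assumes "1 \<le> i" "i < n"
  shows "act (s i) [i] = [Suc i]" "act (s i) [Suc i] = [Suc i, i, Suc i]"
    "\<lbrakk>1 \<le> k; k \<le> n; k \<noteq> i; k \<noteq> Suc i\<rbrakk> \<Longrightarrow> act (s i) [k] = [k]"
    "act (s i) [Suc i, i, Suc i] = [Suc i, i, Suc i, i, Suc i]" "act (s i) [i, Suc i, i] = [i]"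
  using assms by (simp_all add: act_s C2_carrier_iff sigma_img_def c2_red.simps(2))

lemma act_inv_s_letters:
  assumes "1 \<le> i" "i < n"
  shows "act (inv (s i)) [Suc i] = [i]" "act (inv (s i)) [i] = [i, Suc i, i]"
    "\<lbrakk>1 \<le> k; k \<le> n; k \<noteq> i; k \<noteq> Suc i\<rbrakk> \<Longrightarrow> act (inv (s i)) [k] = [k]"
proof -
  note L = act_s_letters[OF assms] and I = act_inv(1)[OF s_closed[OF assms]]
  show "act (inv (s i)) [Suc i] = [i]"
    using I[of "[i]"] L assms by (simp add: C2_carrier_iff)
  show "act (inv (s i)) [i] = [i, Suc i, i]"
    using I[of "[i, Suc i, i]"] L assms by (simp add: C2_carrier_iff)
  show "act (inv (s i)) [k] = [k]" if "1 \<le> k" "k \<le> n" "k \<noteq> i" "k \<noteq> Suc i"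
    using I[of "[k]"] L that by (simp add: C2_carrier_iff)
qed

text \<open>Provides the two hypotheses of \<open>free_factor_end\<close>: words over
  \<open>S\<close> stay over \<open>S\<close>, and the letters outside \<open>S\<close> do not
  move.\<close>

lemma act_support:
  assumes x: "x \<in> generate G (s ` I)" and I: "I \<subseteq> {1..<n}" and S: "\<And>i. i \<in> I \<Longrightarrow> i \<in> S \<and> Suc i \<in> S"
  shows "(\<forall>w \<in> C2_carrier n. set w \<subseteq> S \<longrightarrow> set (act x w) \<subseteq> S) \<and>
    (\<forall>k. 1 \<le> k \<longrightarrow> k \<le> n \<longrightarrow> k \<notin> S \<longrightarrow> act x [k] = [k])"
proof -
  let ?P = "\<lambda>x. (\<forall>w \<in> C2_carrier n. set w \<subseteq> S \<longrightarrow> set (act x w) \<subseteq> S) \<and>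
    (\<forall>k. 1 \<le> k \<longrightarrow> k \<le> n \<longrightarrow> k \<notin> S \<longrightarrow> act x [k] = [k])"
  have sub: "s ` I \<subseteq> carrier G" using I by auto
  have P_mult: "?P (x \<otimes> y)" if "x \<in> carrier G" "y \<in> carrier G" "?P x" "?P y" for x y
    using that by (auto simp: act_mult letter_in_C2 act_closed)
  have gen: "?P (s i)" "?P (inv (s i))" if i: "i \<in> I" for i
  proof -
    have i': "1 \<le> i" "i < n" "i \<in> S" "Suc i \<in> S" using i I S by auto
    have letters: "set (act (s i) [k]) \<subseteq> S \<and> set (act (inv (s i)) [k]) \<subseteq> S"
      if k: "k \<in> S" "1 \<le> k" "k \<le> n" for k
    proof -
      consider "k = i" | "k = Suc i" | "k \<noteq> i" "k \<noteq> Suc i" by blast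
      then show ?thesis
        by cases (use k i' in \<open>simp_all add: act_s_letters[OF i'(1,2)] act_inv_s_letters[OF i'(1,2)]\<close>)
    qed
    have "set (act y w) \<subseteq> S" if y: "y = s i \<or> y = inv (s i)" and w: "w \<in> C2_carrier n" "set w \<subseteq> S" for y w
    proof (rule c2_end_set[OF act_end w(1)])
      show "y \<in> carrier G" using y i' by auto
      fix k assume "k \<in> set w"
      then have "k \<in> S" "1 \<le> k" "k \<le> n" using w by (auto simp: C2_carrier_def)
      then show "set (act y [k]) \<subseteq> S" using letters y by auto
    qed
    moreover have "act (s i) [k] = [k]" "act (inv (s i)) [k] = [k]" if "1 \<le> k" "k \<le> n" "k \<notin> S" for k
      using that i' act_s_letters(3)[OF i'(1,2), of k] act_inv_s_letters(3)[OF i'(1,2), of k] by auto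
    ultimately show "?P (s i)" "?P (inv (s i))" by blast+
  qed
  show ?thesis
    using sub x
  proof (induction x rule: generate_right_induct)
    case one
    then show ?case by (simp add: act_one letter_in_C2)
  next
    case (mult x h)
    then obtain i where i: "i \<in> I" "h = s i" by auto
    show ?case unfolding i(2) by (rule P_mult[OF mult.hyps(1) _ mult.IH gen(1)[OF i(1)]]) (use sub i in auto)
  next
    case (mult_inv x h)
    then obtain i where i: "i \<in> I" "h = s i" by auto
    show ?case unfolding i(2) by (rule P_mult[OF mult_inv.hyps(1) _ mult_inv.IH gen(2)[OF i(1)]]) (use sub i in auto)
  qed
qed

lemma braids_support:
  assumes "x \<in> braids m" "m < n"
  shows "w \<in> C2_carrier n \<Longrightarrow> set w \<subseteq> {1..Suc m} \<Longrightarrow> set (act x w) \<subseteq> {1..Suc m}"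
    "Suc m < k \<Longrightarrow> k \<le> n \<Longrightarrow> act x [k] = [k]"
proof -
  have I: "{1..m} \<subseteq> {1..<n}" using assms(2) by auto
  have S: "i \<in> {1..Suc m} \<and> Suc i \<in> {1..Suc m}" if "i \<in> {1..m}" for i using that by auto
  note supp = act_support[OF assms(1)[unfolded braids_def] I S]
  show "w \<in> C2_carrier n \<Longrightarrow> set w \<subseteq> {1..Suc m} \<Longrightarrow> set (act x w) \<subseteq> {1..Suc m}"
    using supp by blast
  show "Suc m < k \<Longrightarrow> k \<le> n \<Longrightarrow> act x [k] = [k]"
    using supp by auto
qed

text \<open>The elements that a deletion does not detect form a subgroup. For
  \<open>b^-1 v b\<close> the action of \<open>b\<close> followed by the deletion is
  \<open>kill_shift\<close>, which factors through the previous deletion; by induction this does not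
  see \<open>v\<close>.\<close>

lemma kill_push:
  assumes "u \<in> push m" "m < n" "w \<in> C2_carrier n"
  shows "kill (Suc m) (act u w) = kill (Suc m) w"
  using assms
proof (induction m arbitrary: u w)
  case 0
  then show ?case by (simp add: act_one)
next
  case (Suc m)
  let ?b = "s (Suc m)"
  have b: "?b \<in> carrier G" "1 \<le> Suc m" "Suc m < n" using Suc.prems by auto
  note L = act_s_letters[OF b(2,3)]
  have shift: "kill (Suc (Suc m)) (act ?b w) = kill_shift (Suc m) w" if "w \<in> C2_carrier n" for w
  proof (rule c2_end_eqI[OF c2_end_comp[OF c2_end_kill act_end[OF b(1)]] c2_end_kill_shift[OF b(2)] _ that])
    fix k assume k: "k \<in> {1..n}"
    consider "k = Suc m" | "k = Suc (Suc m)" | "k \<noteq> Suc m" "k \<noteq> Suc (Suc m)" by blast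
    then show "kill (Suc (Suc m)) (act ?b [k]) = kill_shift (Suc m) [k]"
      using k L by cases (auto simp: kill_def kill_shift_def)
  qed
  let ?T = "{u \<in> carrier G. \<forall>w \<in> C2_carrier n. kill (Suc (Suc m)) (act u w) = kill (Suc (Suc m)) w}"
  have "subgroup ?T G"
  proof (rule subgroupI)
    show "?T \<noteq> {}" using act_one by (auto intro!: exI[of _ \<one>])
  next
    fix a assume "a \<in> ?T"
    then show "inv a \<in> ?T"
      using act_closed[of "inv a"] act_inv(2)[of a] by (auto, metis)
  next
    fix a b assume "a \<in> ?T" "b \<in> ?T"
    then show "a \<otimes> b \<in> ?T" by (auto simp: act_mult act_closed)
  qed auto
  moreover have "kill (Suc (Suc m)) (act (?b \<otimes> ?b) w) = kill (Suc (Suc m)) w" if "w \<in> C2_carrier n" for w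
  proof (rule c2_end_eqI[OF c2_end_comp[OF c2_end_kill act_end[OF m_closed[OF b(1) b(1)]]] c2_end_kill _ that])
    fix k assume k: "k \<in> {1..n}"
    consider "k = Suc m" | "k = Suc (Suc m)" | "k \<noteq> Suc m" "k \<noteq> Suc (Suc m)" by blast
    then show "kill (Suc (Suc m)) (act (?b \<otimes> ?b) [k]) = kill (Suc (Suc m)) [k]"
      using k L b by cases (auto simp: act_mult letter_in_C2 kill_def)
  qed
  then have "?b \<otimes> ?b \<in> ?T" using b by simp
  moreover have "conj_by ?b v \<in> ?T" if v: "v \<in> push m" for v
  proof (intro CollectI conjI ballI)
    have vc: "v \<in> carrier G" using push_carrier[OF v] b by simp
    then show "conj_by ?b v \<in> carrier G" using b by simp
    fix w assume w: "w \<in> C2_carrier n"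
    let ?y = "act (inv ?b) w"
    have y: "?y \<in> C2_carrier n" using act_closed w b by simp
    have "kill (Suc (Suc m)) (act (conj_by ?b v) w) = kill_shift (Suc m) (act v ?y)"
      using w b vc y by (simp add: conj_by_def act_mult act_closed shift)
    also have "\<dots> = kill_shift (Suc m) (kill (Suc m) (act v ?y))"
      using kill_shift_kill[OF b(2) act_closed[OF vc y]] by simp
    also have "\<dots> = kill_shift (Suc m) ?y"
      using Suc.IH[OF v _ y] b kill_shift_kill[OF b(2) y] by simp
    also have "\<dots> = kill (Suc (Suc m)) w"
      using shift[OF y] act_inv(2)[OF b(1) w] by simp
    finally show "kill (Suc (Suc m)) (act (conj_by ?b v) w) = kill (Suc (Suc m)) w" .
  qed
  ultimately have "push (Suc m) \<subseteq> ?T"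
    unfolding push.simps by (intro generate_subgroup_incl) auto
  then show ?case using Suc.prems by blast
qed

text \<open>In \<open>b^-1 v b\<close> the first factor brings the top letter one place down,
  \<open>v\<close> replaces it by a conjugate by induction, and \<open>b\<close> brings that
  conjugate back up.\<close>

lemma push_conj:
  assumes "u \<in> push m" "m < n"
  shows "c2_conj n (Suc m) (act u [Suc m])"
  using assms
proof (induction m arbitrary: u)
  case 0
  then show ?case
    by (auto simp: act_one letter_in_C2 c2_conj_def intro!: exI[of _ "[]"])
next
  case (Suc m)
  let ?b = "s (Suc m)" and ?j = "Suc (Suc m)"
  have b: "?b \<in> carrier G" "1 \<le> Suc m" "Suc m < n" using Suc.prems by auto
  note L = act_s_letters[OF b(2,3)] and L' = act_inv_s_letters[OF b(2,3)]
  have self: "c2_conj n k [k]" for k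
    by (auto simp: c2_conj_def intro!: exI[of _ "[]"])
  have sq: "c2_conj n ?j (act (?b \<otimes> ?b) [?j])"
    using b L by (auto simp: act_mult letter_in_C2 c2_conj_def c2_red.simps(2) intro!: exI[of _ "[Suc m, ?j]"])
  have "c2_red [Suc m, ?j, Suc m] = [Suc m, ?j, Suc m]" by (simp add: c2_red_fixed_iff)
  then have sq': "c2_conj n ?j (act (inv (?b \<otimes> ?b)) [?j])"
    using b L' by (auto simp: inv_mult_group act_mult letter_in_C2 c2_conj_def intro!: exI[of _ "[Suc m]"])
  have cj: "c2_conj n ?j (act (conj_by ?b v) [?j])" if v: "v \<in> push m" for v
  proof -
    have vc: "v \<in> carrier G" using push_carrier[OF v] b by simp
    have "act (conj_by ?b v) [?j] = act ?b (act v [Suc m])"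
      using vc b L' by (simp add: conj_by_def act_mult letter_in_C2 act_closed)
    then show ?thesis
      using Suc.IH[OF v] b L self c2_conj_hom[OF act_end[OF b(1)], of "Suc m" ?j "act v [Suc m]"] by simp
  qed
  have step: "c2_conj n ?j (act (x \<otimes> h) [?j])"
    if "x \<in> carrier G" "h \<in> carrier G" "c2_conj n ?j (act x [?j])" "c2_conj n ?j (act h [?j])" for x h
    using that b c2_conj_hom[OF act_end[of h], of ?j ?j "act x [?j]"] by (simp add: act_mult letter_in_C2)
  note sub = push_gens_subset[OF b(3)]
  have u: "u \<in> generate G (insert (?b \<otimes> ?b) (conj_by ?b ` push m))" using Suc.prems by simp
  show ?case
    using sub u
  proof (induction u rule: generate_right_induct)
    case one
    then show ?case using self b by (simp add: act_one letter_in_C2)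
  next
    case (mult x h)
    then show ?case using step[of x h] sub sq cj by auto
  next
    case (mult_inv x h)
    have "c2_conj n ?j (act (inv h) [?j])"
    proof (cases "h = ?b \<otimes> ?b")
      \<comment> \<open>Since \<open>push m\<close> is closed under inverses, the inverse of a
        generator \<open>b^-1 v b\<close> is again of this form.\<close>
      case False
      then obtain v where v: "v \<in> push m" "h = conj_by ?b v" using mult_inv by auto
      have "inv v \<in> push m" "v \<in> carrier G"
        using v subgroup.m_inv_closed[OF subgroup_push] push_carrier b by auto
      then show ?thesis using cj v b by (simp flip: conj_by_inv)
    qed (use sq' in simp)
    then show ?case using step[of x "inv h"] mult_inv sub by auto
  qed
qed

text \<open>\<open>B\<close> fixes the product \<open>c d\<close> and conjugates \<open>x\<close> by
  it, so its powers conjugate by powers of \<open>c d\<close>. As the image of \<open>x\<close>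
  begins and ends with \<open>c\<close>, each further step puts \<open>c, d\<close> in front and
  \<open>d, c\<close> behind without cancellation, and the subword \<open>t\<close>
  survives.\<close>

lemma dihedral_power:
  assumes B: "B \<in> carrier G" and z: "act B [c, d] = [c, d]"
    and x: "act B [x] = c2_mult [c, d] (c2_mult [x] [d, c])"
    and start: "hd (act B [x]) = c" "last (act B [x]) = c" "act B [x] = q0 @ t @ r0" "act B [x] \<noteq> []"
    and cd: "c \<noteq> d" "{c, d, x} \<subseteq> {1..n}"
  shows "\<exists>q r. act (B [^] Suc k) [x] = q @ t @ r \<and>
     hd (act (B [^] Suc k) [x]) = c \<and> last (act (B [^] Suc k) [x]) = c \<and> act (B [^] Suc k) [x] \<noteq> []"
proof (induction k)
  case 0
  then show ?case using start B by auto
next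
  case (Suc k)
  have mem: "[c, d] \<in> C2_carrier n" "[d, c] \<in> C2_carrier n" "[x] \<in> C2_carrier n"
    using cd by (auto simp: C2_carrier_iff)
  have fxd: "act (B [^] j) [c, d] = [c, d]" for j :: nat
  proof (induction j)
    case (Suc j)
    then show ?case using B z mem by (simp add: act_mult)
  qed (simp add: act_one mem)
  have fxd': "act (B [^] j) [d, c] = [d, c]" for j :: nat
    using fxd[of j] c2_endD(4)[OF act_end, of "B [^] j" "[c, d]"] B mem by simp
  define C where "C = B [^] Suc k"
  let ?w = "act C [x]"
  have C: "C \<in> carrier G" "act C [c, d] = [c, d]" "act C [d, c] = [d, c]"
    unfolding C_def using B fxd fxd' by (simp del: nat_pow_Suc, blast+)
  have w: "?w \<in> C2_carrier n" using C mem act_closed by simp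
  have "act (B [^] Suc (Suc k)) [x] = act C (act B [x])"
    unfolding nat_pow_Suc2[OF B, of "Suc k"] C_def[symmetric] using B C mem by (simp add: act_mult)
  also have "\<dots> = c2_mult [c, d] (c2_mult ?w [d, c])"
    unfolding x using C mem c2_endD(2)[OF act_end[OF C(1)]] by (simp add: c2_mult_closed)
  also have "\<dots> = [c, d] @ ?w @ [d, c]"
  proof -
    have "distinct_adj (?w @ [d, c])" "distinct_adj ([c, d] @ ?w @ [d, c])"
      using w Suc.IH[folded C_def] cd
      by (auto simp: C2_carrier_iff distinct_adj_append_iff distinct_adj_Cons hd_append)
    then show ?thesis
      by (simp add: c2_mult_reduced del: append.simps)
  qed
  finally have eq: "act (B [^] Suc (Suc k)) [x] = [c, d] @ ?w @ [d, c]" .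
  obtain q r where "?w = q @ t @ r" using Suc.IH[folded C_def] by auto
  then show ?case
    unfolding eq by (intro exI[of _ "[c, d] @ q"] exI[of _ "r @ [d, c]"]) simp
qed

text \<open>The full twist of two strands conjugates by the product of their two letters. Passing to
  its inverse exchanges the roles of the letters, so both signs of the exponent reduce to
  \<open>dihedral_power\<close>.\<close>

lemma twist_power:
  assumes M: "1 \<le> M" "M < n" and e: "e \<noteq> (0 :: int)"
  shows "\<exists>q r. act ((s M \<otimes> s M) [^] e) [M] = q @ [Suc M, M, Suc M] @ r"
proof -
  let ?A = "s M \<otimes> s M"
  note L = act_s_letters[OF M] and L' = act_inv_s_letters[OF M]
  have A: "?A \<in> carrier G" "inv ?A \<in> carrier G" and sc: "s M \<in> carrier G" using M by auto
  have mem: "[M] \<in> C2_carrier n" "[Suc M] \<in> C2_carrier n" "[Suc M, M] \<in> C2_carrier n" "[M, Suc M] \<in> C2_carrier n"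
    "[M, Suc M, M] \<in> C2_carrier n"
    using M by (auto simp: C2_carrier_iff)
  have sz: "act (s M) [Suc M, M] = [Suc M, M]"
    using M by (simp add: act_s mem sigma_img_def c2_red.simps(2))
  have Ax: "act ?A [M] = [Suc M, M, Suc M]" and Az: "act ?A [Suc M, M] = [Suc M, M]"
    using L sz mem sc by (simp_all add: act_mult)
  have iz: "act (inv ?A) [M, Suc M] = [M, Suc M]"
    using act_inv(1)[OF A(1), of "[Suc M, M]"] Az mem c2_endD(4)[OF act_end[OF A(2)], of "[Suc M, M]"] by simp
  have ix: "act (inv ?A) [M] = [M, Suc M, M, Suc M, M]"
  proof -
    have m5: "[M, Suc M, M, Suc M, M] \<in> C2_carrier n" using M by (auto simp: C2_carrier_iff)
    have "act (s M) [M, Suc M, M, Suc M, M] = [M, Suc M, M]"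
      using M m5 by (simp add: act_s sigma_img_def c2_red.simps(2))
    then have "act ?A [M, Suc M, M, Suc M, M] = [M]"
      using L m5 sc by (simp add: act_mult)
    then show ?thesis using act_inv(1)[OF A(1) m5] by simp
  qed
  show ?thesis
  proof (cases "e > 0")
    case True
    then obtain k where k: "e = int (Suc k)" by (metis gr0_implies_Suc zero_less_imp_eq_int)
    have "act ?A [M] = c2_mult [Suc M, M] (c2_mult [M] [M, Suc M])"
      unfolding Ax by (simp add: c2_mult_def c2_red.simps(2))
    from dihedral_power[OF A(1) Az this, of "[]" "[Suc M, M, Suc M]" "[]" k]
    show ?thesis
      unfolding k int_pow_int using Ax M by auto
  next
    case False
    then obtain k where k: "e = - int (Suc k)" using e
      by (metis gr0_implies_Suc linorder_neqE_linordered_idom neg_0_less_iff_less minus_minus zero_less_imp_eq_int)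
    have "act (inv ?A) [M] = c2_mult [M, Suc M] (c2_mult [M] [Suc M, M])"
      unfolding ix by (simp add: c2_mult_def c2_red.simps(2))
    from dihedral_power[OF A(2) iz this, of "[M]" "[Suc M, M, Suc M]" "[M]" k]
    have "\<exists>q r. act (inv ?A [^] Suc k) [M] = q @ [Suc M, M, Suc M] @ r"
      using ix M by auto
    moreover have "?A [^] e = inv ?A [^] Suc k"
      unfolding k using int_pow_neg_int[OF A(1)] nat_pow_inv[OF A(1)] by metis
    ultimately show ?thesis by simp
  qed
qed

text \<open>The hypothesis tests one letter because that is what the induction has to return: every
  nontrivial element of \<open>push m\<close> moves letter \<open>m + 1\<close>. Conjugating by
  \<open>s (m + 1)\<close> makes this letter the base point, and it is the one on which both factors
  of the ping-pong act.\<close>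

lemma push_faithful:
  assumes "u \<in> push m" "m < n" "act u [Suc m] = [Suc m]"
  shows "u = \<one>"
  using assms
proof (induction m arbitrary: u)
  case (Suc m)
  let ?M = "Suc m" and ?b = "s (Suc m)"
  let ?A = "?b \<otimes> ?b" and ?C = "\<lambda>w. w \<in> C2_carrier n \<and> set w \<subseteq> {1..Suc ?M}"
  \<comment> \<open>Around the displayed \<open>?M\<close>, the neighbours in a word of
    \<open>X\<close> are fixed by powers of \<open>?A\<close>, those in a word of \<open>Y\<close>
    by \<open>push m\<close>. They act as walls between which the image of \<open>?M\<close> is
    inserted.\<close>
  define X where "X = {w. ?C w \<and> (\<exists>q a c r. w = q @ [a, ?M, c] @ r \<and> a < ?M \<and> c < ?M)}"
  define Y where "Y = {w. ?C w \<and> (\<exists>q r. w = q @ [Suc ?M, ?M, Suc ?M] @ r)}"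
  have M: "1 \<le> ?M" "?M < n" and b: "?b \<in> carrier G" and A: "?A \<in> carrier G" using Suc.prems by auto
  have V: "subgroup (push m) G" using Suc.prems by (simp add: subgroup_push)
  have memM: "[?M] \<in> C2_carrier n" using M by (simp add: C2_carrier_iff)
  have CM: "?C [?M]" using memM by simp
  have clos: "?C (act x w)" if "x \<in> braids ?M" "?C w" for x w
    using that braids_support(1)[of x ?M w] braids_carrier[of x ?M] act_closed M by auto
  have X: "act (?A [^] e) w \<in> Y" if e: "e \<noteq> 0" and w: "w \<in> insert [?M] X" for e :: int and w
  proof -
    let ?\<theta> = "act (?A [^] e)"
    have xc: "?A [^] e \<in> carrier G" using A by simp
    have gen: "?A [^] e \<in> generate G (s ` {?M})"
      using b by (intro subgroup_int_pow_closed generate_is_subgroup generate.eng generate.incl) auto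
    moreover have "generate G (s ` {?M}) \<subseteq> braids ?M"
      unfolding braids_def by (rule mono_generate) auto
    ultimately have br: "?A [^] e \<in> braids ?M" by auto
    have supp: "(\<forall>w \<in> C2_carrier n. set w \<subseteq> {?M, Suc ?M} \<longrightarrow> set (?\<theta> w) \<subseteq> {?M, Suc ?M}) \<and>
      (\<forall>k. 1 \<le> k \<longrightarrow> k \<le> n \<longrightarrow> k \<notin> {?M, Suc ?M} \<longrightarrow> ?\<theta> [k] = [k])"
      by (rule act_support[OF gen]) (use M in auto)
    have ff: "?\<theta> (p @ a # r) = ?\<theta> p @ a # ?\<theta> r"
      if "p @ a # r \<in> C2_carrier n" "a \<notin> {?M, Suc ?M}" for p a r
      by (rule free_factor_end[OF act_end[OF xc] inj_act[OF xc], where S = "{?M, Suc ?M}"])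
        (use supp that in auto)
    obtain q r where tw: "?\<theta> [?M] = q @ [Suc ?M, ?M, Suc ?M] @ r"
      using twist_power[OF M e] by auto
    have C: "?C w" using w CM by (auto simp: X_def)
    have "\<exists>q r. ?\<theta> w = q @ [Suc ?M, ?M, Suc ?M] @ r"
    proof (cases "w = [?M]")
      case False
      then obtain p a c t where dec: "w = p @ [a, ?M, c] @ t" "a < ?M" "c < ?M"
        using w by (auto simp: X_def)
      have "[?M] @ c # t \<in> C2_carrier n"
        using C dec by (auto simp: C2_carrier_iff distinct_adj_append_iff distinct_adj_Cons)
      then have "?\<theta> w = ?\<theta> p @ a # ?\<theta> [?M] @ c # ?\<theta> t"
        using ff[of p a "[?M] @ c # t"] ff[of "[?M]" c t] C dec by simp
      then show ?thesis
        unfolding tw by (intro exI[of _ "?\<theta> p @ a # q"] exI[of _ "r @ c # ?\<theta> t"]) simp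
    qed (use tw in auto)
    then show ?thesis using clos[OF br C] by (auto simp: Y_def)
  qed
  have Y: "act g w \<in> X" if g: "g \<in> push m" "g \<noteq> \<one>" and w: "w \<in> insert [?M] Y" for g w
  proof -
    let ?\<theta> = "act g"
    have gb: "g \<in> braids m" using g push_subset_braids[of m] Suc.prems by auto
    then have br: "g \<in> braids ?M" using braids_mono[of m ?M] by auto
    have xc: "g \<in> carrier G" using push_carrier[OF g(1)] Suc.prems by simp
    have mn: "m < n" using M by simp
    note supp = braids_support[OF gb mn]
    have ff: "?\<theta> (p @ a # r) = ?\<theta> p @ a # ?\<theta> r"
      if "p @ a # r \<in> C2_carrier n" "a \<notin> {1..?M}" for p a r
      by (rule free_factor_end[OF act_end[OF xc] inj_act[OF xc], where S = "{1..?M}"])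
        (use supp that in auto)
    \<comment> \<open>By the contrapositive of the induction hypothesis \<open>g\<close> moves the
      letter, so the normal form of the image has a centre \<open>a M a\<close>; the support of
      \<open>g\<close> then leaves only \<open>a < M\<close>.\<close>
    have "?\<theta> [?M] \<noteq> [?M]" using Suc.IH g mn by auto
    then obtain v a where v: "?\<theta> [?M] = rev v @ [a, ?M, a] @ v" "a \<noteq> ?M"
      using c2_conj_normal_form[OF push_conj[OF g(1) mn]] by auto
    have "set (?\<theta> [?M]) \<subseteq> {1..?M}" using supp(1)[OF memM] by simp
    then have a: "a < ?M" using v by auto
    have C: "?C w" using w CM by (auto simp: Y_def)
    have "\<exists>q a c r. ?\<theta> w = q @ [a, ?M, c] @ r \<and> a < ?M \<and> c < ?M"
    proof (cases "w = [?M]")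
      case True
      then show ?thesis using v a by blast
    next
      case False
      then obtain p t where dec: "w = p @ [Suc ?M, ?M, Suc ?M] @ t"
        using w by (auto simp: Y_def)
      have "[?M] @ Suc ?M # t \<in> C2_carrier n"
        using C dec by (auto simp: C2_carrier_iff distinct_adj_append_iff distinct_adj_Cons)
      then have "?\<theta> w = ?\<theta> p @ Suc ?M # ?\<theta> [?M] @ Suc ?M # ?\<theta> t"
        using ff[of p "Suc ?M" "[?M] @ Suc ?M # t"] ff[of "[?M]" "Suc ?M" t] C dec by simp
      then have "?\<theta> w = (?\<theta> p @ Suc ?M # rev v) @ [a, ?M, a] @ (v @ Suc ?M # ?\<theta> t)"
        unfolding v by simp
      then show ?thesis using a by blast
    qed
    then show ?thesis using clos[OF br C] by (auto simp: X_def)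
  qed
  let ?y = "conj_by (inv ?b) u"
  have uc: "u \<in> carrier G" using push_carrier[OF Suc.prems(1)] M by simp
  have "?y \<in> generate G (insert ?A (push m))"
  proof (rule conj_by_generate[OF inv_closed[OF b] push_gens_subset[OF M(2)]])
    have sub: "insert ?A (push m) \<subseteq> carrier G" using A subgroup.subset[OF V] by auto
    show "subgroup (generate G (insert ?A (push m))) G" by (rule generate_is_subgroup[OF sub])
    show "u \<in> generate G (insert ?A (conj_by ?b ` push m))" using Suc.prems by simp
    fix x assume "x \<in> insert ?A (conj_by ?b ` push m)"
    then consider "x = ?A" | v where "v \<in> push m" "x = conj_by ?b v" by auto
    then show "conj_by (inv ?b) x \<in> generate G (insert ?A (push m))"
    proof cases
      case 1
      then have "conj_by (inv ?b) x = ?A" using b by (simp add: conj_by_def m_assoc)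
      then show ?thesis by (simp add: generate.incl)
    next
      case 2
      then show ?thesis using b push_carrier[of v m] M by (simp add: generate.incl)
    qed
  qed
  then have "?y = \<one> \<or> act ?y [?M] \<in> X \<union> Y"
    by (rule ping_pong[where f = act and X = X and Y = Y, OF V A])
      (use X Y memM in \<open>auto simp: act_mult act_one\<close>)
  moreover have "act ?y [?M] = [?M]"
  proof -
    have "act ?y [?M] = act (inv ?b) (act u (act ?b [?M]))"
      using b uc memM by (simp add: conj_by_def act_mult act_closed)
    then show ?thesis
      using act_s_letters(1)[OF M] act_inv_s_letters(1)[OF M] Suc.prems by simp
  qed
  moreover have "[?M] \<notin> X \<union> Y"
    by (auto simp: X_def Y_def Cons_eq_append_conv)
  ultimately have "?y = \<one>" by auto
  then show ?case
    using conj_by_cancel(1)[OF b uc] b by simp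
qed simp

text \<open>Only the letters up to \<open>m + 1\<close> are tested, since after deleting the last
  one no more than the letters up to \<open>m\<close> remain to test the braid on one strand
  less.\<close>

lemma braids_faithful:
  assumes "g \<in> braids m" "m < n" "\<And>k. \<lbrakk>1 \<le> k; k \<le> Suc m\<rbrakk> \<Longrightarrow> act g [k] = [k]"
  shows "g = \<one>"
  using assms
proof (induction m arbitrary: g)
  case 0
  then show ?case by (simp add: braids_0)
next
  case (Suc m)
  let ?M = "Suc m"
  have M: "1 \<le> ?M" "?M < n" "m < n" and b: "s ?M \<in> carrier G" using Suc.prems by auto
  have gc: "g \<in> carrier G" using Suc.prems braids_carrier by blast
  have mem: "[k] \<in> C2_carrier n" if "1 \<le> k" "k \<le> Suc ?M" for k
    using that M by (simp add: C2_carrier_iff)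
  \<comment> \<open>The deletion hides \<open>u\<close>, and the image of the letter under
    \<open>h\<close> does not contain the deleted letter.\<close>
  have kill_letter: "kill (Suc ?M) (act (h \<otimes> u) [k]) = act h [k]"
    if "h \<in> braids m" "u \<in> push ?M" "1 \<le> k" "k \<le> ?M" for h u k
  proof -
    have c: "h \<in> carrier G" "u \<in> carrier G" "[k] \<in> C2_carrier n"
      using braids_carrier[OF that(1) M(3)] push_carrier[OF that(2) M(2)] mem that(3,4) by auto
    have "set (act h [k]) \<subseteq> {1..?M}"
      using braids_support(1)[OF that(1) M(3) c(3)] that by simp
    then have "kill (Suc ?M) (act h [k]) = act h [k]"
      using c by (intro kill_id[of _ n] act_closed) auto
    then show ?thesis
      using kill_push[OF that(2) M(2) act_closed[OF c(1,3)]] c by (simp add: act_mult)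
  qed
  note sgK = subgroup_pure_last[OF M(2)]
  from combing[OF Suc.prems(1) M(2)] show ?case
  proof
    assume "g \<in> pure_last ?M"
    then obtain h u where hu: "h \<in> braids m" "u \<in> push ?M" "g = h \<otimes> u"
      by (auto simp: pure_last_def set_mult_def)
    have "act h [k] = [k]" if "1 \<le> k" "k \<le> ?M" for k
      using kill_letter[OF hu(1,2) that] Suc.prems(3)[of k] that hu(3) kill_id[of "[k]" n "Suc ?M"] mem[of k]
      by simp
    then have "h = \<one>" using Suc.IH[OF hu(1) M(3)] by simp
    then have "g = u" using hu(3) push_carrier[OF hu(2) M(2)] by auto
    then show ?thesis
      using push_faithful[OF hu(2) M(2)] Suc.prems(3)[of "Suc ?M"] by simp
  next
    \<comment> \<open>This case is contradictory. As \<open>g\<close> acts trivially,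
      \<open>inv k\<close> sends letter \<open>M\<close> where \<open>s M\<close> followed by
      \<open>h\<close> sends it, namely to \<open>M + 1\<close>. Deleting \<open>M + 1\<close> then
      gives the empty word, but \<open>inv k = t u\<close> and the deletion leaves the nonempty
      image of \<open>M\<close> under \<open>t\<close>.\<close>
    assume "1 \<le> ?M \<and> (\<exists>k \<in> pure_last ?M. \<exists>h \<in> braids (?M - 1). g = k \<otimes> s ?M \<otimes> h)"
    then obtain k h where kh: "k \<in> pure_last ?M" "h \<in> braids m" "g = k \<otimes> s ?M \<otimes> h" by auto
    have c: "k \<in> carrier G" "h \<in> carrier G"
      using subgroup.mem_carrier[OF sgK kh(1)] braids_carrier[OF kh(2) M(3)] by auto
    obtain t u where tu: "t \<in> braids m" "u \<in> push ?M" "inv k = t \<otimes> u"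
      using subgroup.m_inv_closed[OF sgK kh(1)] by (auto simp: pure_last_def set_mult_def)
    have ic: "inv k \<in> carrier G" using c by simp
    have "inv k \<in> braids ?M"
      unfolding tu(3) using tu(1,2) push_subset_braids[OF M(2)] braids_mono[of m ?M]
      by (intro subgroup.m_closed[OF subgroup_braids[OF M(2)]]) (auto simp del: push.simps)
    then have ik: "set (act (inv k) [?M]) \<subseteq> {1..Suc ?M}" "act (inv k) [?M] \<in> C2_carrier n"
      using braids_support(1)[of "inv k" ?M "[?M]"] M mem act_closed c by auto
    have gid: "act g w = w" if "w \<in> C2_carrier n" "set w \<subseteq> {1..Suc ?M}" for w
      using that
    proof (induction w rule: c2_induct)
      case Nil
      then show ?case using c2_endD(3)[OF act_end[OF gc]] by simp
    next
      case (Cons k w)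
      have "[k] \<in> C2_carrier n" "act g [k] = [k]" "act g w = w"
        using Cons.IH Cons.prems Suc.prems(3)[of k] mem[of k] by auto
      then show ?case
        using c2_endD(2)[OF act_end[OF gc] _ Cons.hyps(2), of "[k]"] Cons.hyps(4) by metis
    qed
    have "act (inv k \<otimes> g) [?M] = act (inv k) [?M]"
      using gid[OF ik(2,1)] ic gc mem[of ?M] by (simp add: act_mult)
    moreover have "inv k \<otimes> g = s ?M \<otimes> h"
      using kh(3) c b by (simp add: m_assoc)
    moreover have "act (s ?M \<otimes> h) [?M] = [Suc ?M]"
      using act_s_letters(1)[OF M(1,2)] braids_support(2)[OF kh(2) M(3), of "Suc ?M"] M mem[of ?M] b c
      by (simp add: act_mult)
    ultimately have "act (t \<otimes> u) [?M] = [Suc ?M]" using tu by simp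
    then have "act t [?M] = []"
      using kill_letter[OF tu(1,2), of ?M] by (simp add: kill_def)
    then have "[?M] = []"
      using inj_onD[OF inj_act, of t "[?M]" "[]"] c2_endD(3)[OF act_end, of t] braids_carrier[OF tu(1) M(3)] mem[of ?M] by simp
    then show ?thesis by simp
  qed
qed

end

section \<open>The normal free subgroup of the Artin group of type D\<close>

context group
begin

lemma conj_by_swap:
  assumes "g \<in> carrier G" "h \<in> carrier G" "y \<in> carrier G" "g \<otimes> h = h \<otimes> g"
  shows "conj_by g (conj_by h y) = conj_by h (conj_by g y)"
  using assms by (simp flip: conj_by_comp)

lemma commute_inv:
  assumes "g \<in> carrier G" "h \<in> carrier G" "g \<otimes> h = h \<otimes> g"
  shows "g \<otimes> inv h = inv h \<otimes> g"
  using assms by (metis inv_closed inv_solve_left inv_solve_right m_assoc m_closed)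

end

text \<open>\<open>d\<close> is attached to the chain in the same way as \<open>s (n - 1)\<close>:
  it braids with \<open>s (n - 2)\<close> and commutes with all others, \<open>s (n - 1)\<close>
  included. For \<open>n = 2\<close> the index \<open>n - 2\<close> is 0, and what remains is that
  the two generators commute.\<close>

locale artin_D = braid_gens +
  fixes d :: 'a
  assumes n2: "2 \<le> n" and d_closed [simp]: "d \<in> carrier G"
    and d_far: "\<lbrakk>1 \<le> i; i < n; i \<noteq> n - 2\<rbrakk> \<Longrightarrow> s i \<otimes> d = d \<otimes> s i"
    and d_braid: "3 \<le> n \<Longrightarrow> s (n - 2) \<otimes> d \<otimes> s (n - 2) = d \<otimes> s (n - 2) \<otimes> d"
begin

text \<open>The recursion descends, its \<open>k\<close>-th value belonging to the index
  \<open>n - 1 - k\<close>. The start will be mapped to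
  \<open>\<tau>\<^sub>n \<tau>\<^sub>n\<^sub>-\<^sub>1\<close>, and conjugation by the inverse of
  \<open>s j\<close> turns \<open>\<tau>\<^sub>j\<^sub>+\<^sub>1\<close> into
  \<open>\<tau>\<^sub>j\<close>.\<close>

primrec xi_from_top :: "nat \<Rightarrow> 'a" where
  "xi_from_top 0 = inv (s (n - 1)) \<otimes> d"
| "xi_from_top (Suc k) = conj_by (inv (s (n - 1 - Suc k))) (xi_from_top k)"

text \<open>\<open>xi j\<close> will be mapped to \<open>\<tau>\<^sub>n \<tau>\<^sub>j\<close>.\<close>
definition xi :: "nat \<Rightarrow> 'a" where
  "xi j = (if j = n then \<one> else xi_from_top (n - 1 - j))"

lemma xi_top: "xi (n - 1) = inv (s (n - 1)) \<otimes> d"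
proof -
  have "n - 1 \<noteq> n" using n2 by simp
  then show ?thesis by (simp add: xi_def)
qed

lemma xi_n: "xi n = \<one>"
  by (simp add: xi_def)

lemma xi_step:
  assumes "1 \<le> j" "j < n - 1"
  shows "xi j = conj_by (inv (s j)) (xi (Suc j))"
proof -
  have "n - 1 - j = Suc (n - 1 - Suc j)" "n - 1 - Suc (n - 1 - Suc j) = j" "j \<noteq> n" "Suc j \<noteq> n"
    using assms by auto
  then show ?thesis
    by (simp add: xi_def)
qed

lemma xi_closed [simp]:
  assumes "1 \<le> j" "j \<le> n"
  shows "xi j \<in> carrier G"
proof (cases "j = n")
  case False
  then have "j \<le> n - 1" using assms by simp
  then show ?thesis
    using assms(1)
  proof (induction j rule: inc_induct)
    case base
    then show ?case unfolding xi_top using n2 by simp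
  next
    case (step k)
    then show ?case by (simp add: xi_step)
  qed
qed (simp add: xi_n)

section \<open>Conjugation formulas that copy the braid action on the words \<tau>_n
  \<tau>_j\<close>

lemma conj_xi_top:
  assumes "1 \<le> i" "i < n" "i \<noteq> n - 2"
  shows "conj_by (s i) (xi (n - 1)) = xi (n - 1)"
proof -
  have c: "s i \<in> carrier G" "s (n - 1) \<in> carrier G" using assms n2 by auto
  have "s i \<otimes> s (n - 1) = s (n - 1) \<otimes> s i"
    using far[of i "n - 1"] assms by (cases "i = n - 1") auto
  then have "s i \<otimes> inv (s (n - 1)) = inv (s (n - 1)) \<otimes> s i"
    by (rule commute_inv[OF c])
  then have "s i \<otimes> (inv (s (n - 1)) \<otimes> d) = inv (s (n - 1)) \<otimes> d \<otimes> s i"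
    using d_far[OF assms] c by (metis d_closed inv_closed m_assoc)
  then show ?thesis
    unfolding xi_top using c by (intro conj_by_commute) auto
qed

lemma conj_xi_below:
  assumes "1 \<le> i" "Suc i < j" "j \<le> n - 1"
  shows "conj_by (s i) (xi j) = xi j"
  using assms(3,1,2)
proof (induction j rule: inc_induct)
  case base
  then show ?case using assms n2 by (intro conj_xi_top) auto
next
  case (step k)
  have c: "s i \<in> carrier G" "s k \<in> carrier G" "xi (Suc k) \<in> carrier G" using step by auto
  have "s i \<otimes> s k = s k \<otimes> s i" using far[of i k] step by simp
  then have "conj_by (s i) (conj_by (inv (s k)) (xi (Suc k))) = conj_by (inv (s k)) (conj_by (s i) (xi (Suc k)))"
    using c by (intro conj_by_swap commute_inv) auto
  then show ?case using step by (simp add: xi_step)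
qed

lemma conj_xi_self: "\<lbrakk>1 \<le> j; j < n - 1\<rbrakk> \<Longrightarrow> conj_by (s j) (xi j) = xi (Suc j)"
  by (simp add: xi_step)

text \<open>Put \<open>a = s j\<close>, \<open>b = s (j + 1)\<close>. For \<open>i = j + 1\<close>
  the braid relation rewrites \<open>b^-1 a^-1 b\<close> as \<open>a b^-1 a^-1\<close>, and
  \<open>a\<close> fixes \<open>xi (j + 2)\<close>. For larger \<open>i\<close> the elements
  \<open>s i\<close> and \<open>s j\<close> commute.\<close>

lemma conj_xi_above:
  assumes "1 \<le> j" "j < i" "i \<le> n - 2"
  shows "conj_by (s i) (xi j) = xi j"
proof -
  have "j \<le> i - 1" using assms by simp
  then show ?thesis
    using assms(1)
  proof (induction j rule: inc_induct)
    case base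
    let ?a = "s (i - 1)" and ?b = "s i" and ?y = "xi (Suc i)"
    have i: "1 \<le> i - 1" "Suc (i - 1) = i" "i < n - 1" "Suc i \<le> n - 1" "Suc (i - 1) < n" using base assms by auto
    have c: "?a \<in> carrier G" "?b \<in> carrier G" "?y \<in> carrier G" using i by auto
    have x: "xi (i - 1) = conj_by (inv ?a) (conj_by (inv ?b) ?y)"
      using xi_step[of "i - 1"] xi_step[of i] i assms by simp
    have y: "conj_by ?a ?y = ?y"
      by (rule conj_xi_below) (use i in auto)
    have "inv (?a \<otimes> ?b \<otimes> inv ?a) = inv (inv ?b \<otimes> ?a \<otimes> ?b)"
      using braid_conj(2)[OF i(1,5)] i by simp
    then have e: "inv ?b \<otimes> inv ?a \<otimes> ?b = ?a \<otimes> inv ?b \<otimes> inv ?a"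
      using c by (simp add: inv_mult_group m_assoc)
    have "conj_by ?b (xi (i - 1)) = conj_by (inv ?b \<otimes> inv ?a \<otimes> ?b) ?y"
      unfolding x using c by (simp add: conj_by_comp)
    also have "\<dots> = xi (i - 1)"
      unfolding e x using c y by (simp add: conj_by_comp)
    finally show ?case .
  next
    case (step k)
    have c: "s i \<in> carrier G" "s k \<in> carrier G" "xi (Suc k) \<in> carrier G" using step assms by auto
    have "s i \<otimes> s k = s k \<otimes> s i" using far[of k i] step assms by simp
    then have "conj_by (s i) (conj_by (inv (s k)) (xi (Suc k))) = conj_by (inv (s k)) (conj_by (s i) (xi (Suc k)))"
      using c by (intro conj_by_swap commute_inv) auto
    then show ?case using step assms by (simp add: xi_step)
  qed
qed

text \<open>The right-hand side comes from \<open>\<tau>\<^sub>n \<tau>\<^sub>i\<^sub>+\<^sub>1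
  \<tau>\<^sub>i \<tau>\<^sub>i\<^sub>+\<^sub>1\<close>, the image of
  \<open>\<tau>\<^sub>n \<tau>\<^sub>i\<^sub>+\<^sub>1\<close>, after inserting
  \<open>\<tau>\<^sub>n \<tau>\<^sub>n\<close> before the last letter. The case
  \<open>i = n - 2\<close> is computed from the relations of \<open>d\<close>; the others are
  carried down from it.\<close>

lemma conj_xi_pred:
  assumes "1 \<le> i" "i \<le> n - 2"
  shows "conj_by (s i) (xi (Suc i)) = xi (Suc i) \<otimes> inv (xi i) \<otimes> xi (Suc i)"
  using assms(2,1)
proof (induction i rule: inc_induct)
  case base
  let ?a = "s (n - 2)" and ?b = "s (n - 1)"
  have n3: "3 \<le> n" "1 \<le> n - 2" "Suc (n - 2) = n - 1" "Suc (n - 2) < n" using base by auto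
  have c: "?a \<in> carrier G" "?b \<in> carrier G" "d \<in> carrier G" using n3 by auto
  have x: "xi (n - 2) = ?a \<otimes> (inv ?b \<otimes> d) \<otimes> inv ?a"
    using xi_step[of "n - 2"] n3 xi_top c by (simp add: conj_by_def m_assoc)
  have ada: "?a \<otimes> (d \<otimes> ?a) = d \<otimes> (?a \<otimes> d)"
    using d_braid[OF n3(1)] c by (simp add: m_assoc)
  have "inv ?a \<otimes> d \<otimes> ?a \<otimes> d = inv ?a \<otimes> (d \<otimes> (?a \<otimes> d))" using c by (simp add: m_assoc)
  also have "\<dots> = d \<otimes> ?a" using c ada[symmetric] by simp
  finally have f1: "d \<otimes> ?a \<otimes> inv d = inv ?a \<otimes> d \<otimes> ?a"
    using c by (simp add: inv_solve_right')
  have "inv (?b \<otimes> ?a \<otimes> inv ?b) = inv (inv ?a \<otimes> ?b \<otimes> ?a)"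
    using braid_conj(1)[OF n3(2,4)] n3 by simp
  then have f2: "?b \<otimes> inv ?a \<otimes> inv ?b = inv ?a \<otimes> inv ?b \<otimes> ?a"
    using c by (simp add: inv_mult_group m_assoc)
  have f3: "inv ?b \<otimes> inv ?a \<otimes> inv ?b = inv ?a \<otimes> inv ?b \<otimes> inv ?a"
  proof -
    have "inv (?b \<otimes> ?a \<otimes> ?b) = inv (?a \<otimes> ?b \<otimes> ?a)"
      using braid[OF n3(2,4)] n3 by simp
    then show ?thesis using c by (simp add: inv_mult_group m_assoc)
  qed
  have db: "d \<otimes> inv ?b = inv ?b \<otimes> d"
    using d_far[of "n - 1"] n3 c by (intro commute_inv) auto
  have "xi (n - 1) \<otimes> inv (xi (n - 2)) \<otimes> xi (n - 1)
      = inv ?b \<otimes> (d \<otimes> ?a \<otimes> inv d) \<otimes> (?b \<otimes> inv ?a \<otimes> inv ?b) \<otimes> d"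
    unfolding x xi_top using c by (simp add: inv_mult_group m_assoc)
  also have "\<dots> = inv ?b \<otimes> inv ?a \<otimes> (d \<otimes> inv ?b) \<otimes> (?a \<otimes> d)"
    unfolding f1 f2 using c by (simp add: m_assoc)
  also have "\<dots> = (inv ?b \<otimes> inv ?a \<otimes> inv ?b) \<otimes> (d \<otimes> (?a \<otimes> d))"
    unfolding db using c by (simp add: m_assoc)
  also have "\<dots> = inv ?a \<otimes> (inv ?b \<otimes> d) \<otimes> ?a"
    unfolding f3 ada[symmetric] using c by (simp add: m_assoc)
  finally show ?case
    using n3 xi_top by (simp add: conj_by_def)
next
  case (step i)
  let ?a = "s i" and ?b = "s (Suc i)"
  have i: "1 \<le> i" "Suc i < n" "Suc (Suc i) \<le> n - 1" "i < n - 1" "Suc i < n - 1" using step by auto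
  have c: "?a \<in> carrier G" "?b \<in> carrier G" using i by auto
  have cx: "xi i \<in> carrier G" "xi (Suc i) \<in> carrier G" "xi (Suc (Suc i)) \<in> carrier G" using i by auto
  \<comment> \<open>Conjugation by the inverse of \<open>g\<close> shifts the whole formula down by
    one: it sends \<open>s (i + 1)\<close> to \<open>s i\<close>, \<open>xi (i + 2)\<close> to
    \<open>xi (i + 1)\<close>, and \<open>xi (i + 1)\<close> to \<open>xi i\<close>.\<close>
  define g where "g = ?b \<otimes> ?a"
  have g: "g \<in> carrier G" using c by (simp add: g_def)
  have ig: "conj_by (inv g) y = conj_by (inv ?b) (conj_by (inv ?a) y)" if "y \<in> carrier G" for y
    using that c by (simp add: g_def inv_mult_group conj_by_comp)
  have "conj_by (inv ?a) (xi (Suc (Suc i))) = xi (Suc (Suc i))"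
    using conj_xi_below[of i "Suc (Suc i)"] i c cx by (intro conj_by_fixed_inv) auto
  then have g2: "conj_by (inv g) (xi (Suc (Suc i))) = xi (Suc i)"
    using ig[OF cx(3)] xi_step[of "Suc i"] i by simp
  have "conj_by (inv ?b) (xi i) = xi i"
    using conj_xi_above[of i "Suc i"] i c cx by (intro conj_by_fixed_inv) auto
  then have g1: "conj_by (inv g) (xi (Suc i)) = xi i"
    using ig[OF cx(2)] xi_step[of i] i by simp
  have "g \<otimes> ?b = ?a \<otimes> g"
    unfolding g_def using braid[OF i(1,2)] c by (simp add: m_assoc)
  then have "?b \<otimes> inv g = inv g \<otimes> ?a"
    using c g by (metis inv_closed inv_solve_left inv_solve_right m_assoc m_closed)
  then have sw: "conj_by (inv g) (conj_by ?b y) = conj_by ?a (conj_by (inv g) y)" if "y \<in> carrier G" for y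
    using that c g by (simp flip: conj_by_comp)
  have "conj_by ?a (xi (Suc i)) = conj_by (inv g) (conj_by ?b (xi (Suc (Suc i))))"
    using sw[OF cx(3)] g2 by simp
  also have "\<dots> = conj_by (inv g) (xi (Suc (Suc i)) \<otimes> inv (xi (Suc i)) \<otimes> xi (Suc (Suc i)))"
    using step i by simp
  also have "\<dots> = xi (Suc i) \<otimes> inv (xi i) \<otimes> xi (Suc i)"
    using cx g g1 g2 by (simp add: conj_by_mult conj_by_inv)
  finally show ?case .
qed

text \<open>For these \<open>j\<close> the last generator changes only the first letter of
  \<open>\<tau>\<^sub>n \<tau>\<^sub>j\<close>, to
  \<open>\<tau>\<^sub>n \<tau>\<^sub>n\<^sub>-\<^sub>1 \<tau>\<^sub>n\<close>; hence the extra
  factor on the left.\<close>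

lemma conj_xi_last:
  assumes "1 \<le> j" "j \<le> n - 2"
  shows "conj_by (s (n - 1)) (xi j) = xi (n - 1) \<otimes> xi j"
  using assms(2,1)
proof (induction j rule: inc_induct)
  case base
  let ?a = "s (n - 2)" and ?b = "s (n - 1)"
  have n3: "3 \<le> n" "1 \<le> n - 2" "Suc (n - 2) = n - 1" "Suc (n - 2) < n" using base by auto
  have c: "?a \<in> carrier G" "?b \<in> carrier G" "d \<in> carrier G" using n3 by auto
  have x: "xi (n - 2) = ?a \<otimes> (inv ?b \<otimes> d) \<otimes> inv ?a"
    using xi_step[of "n - 2"] n3 xi_top c by (simp add: conj_by_def m_assoc)
  have ada: "?a \<otimes> d \<otimes> ?a = d \<otimes> ?a \<otimes> d"
    using d_braid[OF n3(1)] .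
  have db: "inv ?b \<otimes> d = d \<otimes> inv ?b"
    using commute_inv[OF c(3,2)] d_far[of "n - 1"] n3 by simp
  have "inv (?a \<otimes> ?b \<otimes> inv ?a) = inv (inv ?b \<otimes> ?a \<otimes> ?b)"
    using braid_conj(2)[OF n3(2,4)] n3 by simp
  then have f: "inv ?b \<otimes> inv ?a \<otimes> ?b = ?a \<otimes> inv ?b \<otimes> inv ?a"
    using c by (simp add: inv_mult_group m_assoc)
  have "conj_by ?b (xi (n - 2)) = inv ?b \<otimes> (?a \<otimes> (d \<otimes> inv ?b) \<otimes> inv ?a) \<otimes> ?b"
    unfolding x conj_by_def db ..
  also have "\<dots> = inv ?b \<otimes> (?a \<otimes> d \<otimes> (inv ?b \<otimes> inv ?a \<otimes> ?b))"
    using c by (simp add: m_assoc)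
  also have "\<dots> = inv ?b \<otimes> ((?a \<otimes> d \<otimes> ?a) \<otimes> inv ?b \<otimes> inv ?a)"
    unfolding f using c by (simp add: m_assoc)
  also have "\<dots> = inv ?b \<otimes> d \<otimes> (?a \<otimes> (d \<otimes> inv ?b) \<otimes> inv ?a)"
    unfolding ada using c by (simp add: m_assoc)
  finally show ?case
    unfolding x xi_top db .
next
  case (step k)
  have c: "s (n - 1) \<in> carrier G" "s k \<in> carrier G" "xi (Suc k) \<in> carrier G" "xi (n - 1) \<in> carrier G"
    using step by auto
  have "s (n - 1) \<otimes> s k = s k \<otimes> s (n - 1)" using far[of k "n - 1"] step by simp
  then have "conj_by (s (n - 1)) (conj_by (inv (s k)) (xi (Suc k))) = conj_by (inv (s k)) (conj_by (s (n - 1)) (xi (Suc k)))"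
    using c by (intro conj_by_swap commute_inv) auto
  moreover have "conj_by (inv (s k)) (xi (n - 1)) = xi (n - 1)"
    using conj_xi_top[of k] step c by (intro conj_by_fixed_inv) auto
  ultimately show ?case using step c by (simp add: xi_step conj_by_mult)
qed

definition xis :: "'a set" where
  "xis = generate G (xi ` {1..n - 1})"

lemma xi_gens_subset: "xi ` {1..n - 1} \<subseteq> carrier G"
  by auto

lemma subgroup_xis: "subgroup xis G"
  unfolding xis_def by (rule generate_is_subgroup[OF xi_gens_subset])

lemma xi_in_xis: "1 \<le> j \<Longrightarrow> j \<le> n - 1 \<Longrightarrow> xi j \<in> xis"
  unfolding xis_def by (rule generate.incl) auto

lemma s_normalizing_xis:
  assumes i: "1 \<le> i" "i < n"
  shows "s i \<in> normalizing xis"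
proof -
  note m = subgroup.m_closed[OF subgroup_xis] and v = subgroup.m_inv_closed[OF subgroup_xis]
  have si: "s i \<in> carrier G" using i by simp
  have both: "conj_by (s i) (xi j) \<in> xis \<and> conj_by (inv (s i)) (xi j) \<in> xis" if j: "1 \<le> j" "j \<le> n - 1" for j
  proof -
    have xj: "xi j \<in> carrier G" using j by simp
    have fixed: ?thesis if "conj_by (s i) (xi j) = xi j"
      using that conj_by_fixed_inv[OF si xj that] xi_in_xis[OF j] by simp
    consider "i = n - 1" "j = n - 1" | "i = n - 1" "j \<le> n - 2" | "i \<le> n - 2" "Suc i < j" | "i \<le> n - 2" "j < i"
      | "i \<le> n - 2" "j = i" | "i \<le> n - 2" "j = Suc i"
      using i j n2 by linarith
    then show ?thesis
    proof cases
      case 1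
      then have "i \<noteq> n - 2" using n2 by linarith
      then show ?thesis using conj_xi_top[OF i] 1 by (intro fixed) simp
    next
      case 2
      have t: "xi (n - 1) \<in> carrier G" "xi (n - 1) \<in> xis" using n2 xi_in_xis by auto
      have c1: "conj_by (s i) (xi j) = xi (n - 1) \<otimes> xi j" using conj_xi_last[of j] 2 j by simp
      have c0: "conj_by (inv (s i)) (xi (n - 1)) = xi (n - 1)"
        using conj_xi_top[of i] 2 i si t n2 by (intro conj_by_fixed_inv) auto
      have "conj_by (inv (s i)) (conj_by (s i) (xi j)) = xi (n - 1) \<otimes> conj_by (inv (s i)) (xi j)"
        unfolding c1 using si t xj c0 by (simp add: conj_by_mult)
      then have "conj_by (inv (s i)) (xi j) = inv (xi (n - 1)) \<otimes> xi j"
        using si t xj by (simp add: inv_solve_left)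
      then show ?thesis using c1 m v t xi_in_xis[OF j] by simp
    next
      case 3
      then show ?thesis using conj_xi_below[of i j] i j by (intro fixed) simp
    next
      case 4
      then show ?thesis using conj_xi_above[of j i] i j by (intro fixed) simp
    next
      case 5
      have ii: "i < n - 1" "Suc i \<le> n - 1" using 5 i n2 by auto
      have t: "xi (Suc i) \<in> carrier G" "xi (Suc i) \<in> xis" using ii xi_in_xis by auto
      have c2: "conj_by (inv (s i)) (xi (Suc i)) = xi i" using xi_step[of i] i ii by simp
      \<comment> \<open>Conjugating the formula of \<open>conj_xi_pred\<close> back by
        \<open>inv (s i)\<close> gives an equation with the conjugate of \<open>xi i\<close> as its
        only unknown, which is then solved.\<close>
      have "xi (Suc i) = conj_by (inv (s i)) (conj_by (s i) (xi (Suc i)))" using si t by simp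
      also have "\<dots> = xi i \<otimes> inv (conj_by (inv (s i)) (xi i)) \<otimes> xi i"
        using conj_xi_pred[of i] i 5 si t xj c2 by (simp add: conj_by_mult conj_by_inv)
      finally have eq: "xi (Suc i) = xi i \<otimes> inv (conj_by (inv (s i)) (xi i)) \<otimes> xi i" .
      have xi_i: "xi i \<in> carrier G" "conj_by (inv (s i)) (xi i) \<in> carrier G" using xj 5 si by auto
      have "inv (xi i) \<otimes> xi (Suc i) \<otimes> inv (xi i) = inv (conj_by (inv (s i)) (xi i))"
        unfolding eq using xi_i by (simp add: m_assoc)
      then have "conj_by (inv (s i)) (xi i) = inv (inv (xi i) \<otimes> xi (Suc i) \<otimes> inv (xi i))"
        using xi_i by simp
      moreover have "inv (inv (xi i) \<otimes> xi (Suc i) \<otimes> inv (xi i)) \<in> xis"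
        using m v t xi_in_xis[OF j] 5 by simp
      ultimately show ?thesis
        using conj_xi_self[of i] i ii t 5 by simp
    next
      case 6
      have ii: "i < n - 1" using 6 i n2 by auto
      have "xi i \<in> xis" "xi (Suc i) \<in> xis" using ii i xi_in_xis by auto
      then show ?thesis
        using conj_xi_pred[of i] xi_step[of i] 6 i ii m v by simp
    qed
  qed
  show ?thesis
    unfolding xis_def
    by (rule normalizing_generate[OF si xi_gens_subset]) (use both in \<open>auto simp: xis_def\<close>)
qed

lemma carrier_decomposition:
  assumes gen: "carrier G = generate G (insert d (s ` {1..n - 1}))"
  shows "carrier G = braids (n - 1) <#> xis"
proof
  have n1: "n - 1 < n" using n2 by simp
  note sgB = subgroup_braids[OF n1]
  have "braids (n - 1) \<subseteq> normalizing xis"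
    unfolding braids_def
    by (intro generate_subgroup_incl subgroup_normalizing subgroup.subset[OF subgroup_xis])
      (use s_normalizing_xis n2 in auto)
  then have sg: "subgroup (braids (n - 1) <#> xis) G"
    by (intro subgroup_set_mult sgB subgroup_xis)
  have I: "h \<otimes> t \<in> braids (n - 1) <#> xis" if "h \<in> braids (n - 1)" "t \<in> xis" for h t
    using that by (auto simp: set_mult_def)
  have "s i \<in> braids (n - 1) <#> xis" if "1 \<le> i" "i \<le> n - 1" for i
    using I[OF s_in_braids[OF that] subgroup.one_closed[OF subgroup_xis]] that n2 by simp
  moreover have "d \<in> braids (n - 1) <#> xis"
  proof -
    have "d = s (n - 1) \<otimes> xi (n - 1)" unfolding xi_top using n2 by simp
    also have "\<dots> \<in> braids (n - 1) <#> xis"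
      using n2 by (intro I s_in_braids xi_in_xis) auto
    finally show ?thesis .
  qed
  ultimately have "insert d (s ` {1..n - 1}) \<subseteq> braids (n - 1) <#> xis" by auto
  then show "carrier G \<subseteq> braids (n - 1) <#> xis"
    unfolding gen by (rule generate_subgroup_incl[OF _ sg])
  show "braids (n - 1) <#> xis \<subseteq> carrier G"
    using subgroup.subset[OF sg] .
qed

text \<open>The inverse of \<open>xi j \<mapsto> \<tau>\<^sub>n \<tau>\<^sub>j\<close>: since
  \<open>\<tau>\<^sub>k \<tau>\<^sub>l = (\<tau>\<^sub>n \<tau>\<^sub>k)\<^sup>-\<^sup>1 (\<tau>\<^sub>n \<tau>\<^sub>l)\<close>, a word of even length is sent to the product of the \<open>xi k\<close>
  with alternating exponents, which is insensitive to the cancellation of equal neighbours.\<close>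
primrec alt_prod :: "bool \<Rightarrow> nat list \<Rightarrow> 'a" where
  "alt_prod b [] = \<one>"
| "alt_prod b (k # w) = (if b then xi k else inv (xi k)) \<otimes> alt_prod (\<not> b) w"

lemma alt_prod_closed [simp]: "set w \<subseteq> {1..n} \<Longrightarrow> alt_prod b w \<in> carrier G"
  by (induction w arbitrary: b) auto

lemma alt_prod_append:
  "set (v @ w) \<subseteq> {1..n} \<Longrightarrow> alt_prod b (v @ w) = alt_prod b v \<otimes> alt_prod (if even (length v) then b else \<not> b) w"
proof (induction v arbitrary: b)
  case (Cons k v)
  then have "xi k \<in> carrier G" "alt_prod (\<not> b) v \<in> carrier G" "\<And>b. alt_prod b w \<in> carrier G"
    by auto
  then show ?case using Cons by (auto simp: m_assoc)
qed auto

lemma alt_prod_red: "set w \<subseteq> {1..n} \<Longrightarrow> alt_prod b (c2_red w) = alt_prod b w"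
proof (induction w arbitrary: b)
  case (Cons k w)
  then have IH: "alt_prod (\<not> b) w = alt_prod (\<not> b) (c2_red w)" by simp
  have s: "set (c2_red w) \<subseteq> {1..n}" using set_c2_red[of w] Cons by auto
  show ?case
  proof (cases "c2_red w")
    case (Cons l r)
    have "xi k \<in> carrier G" "alt_prod b r \<in> carrier G" using s Cons.prems Cons by auto
    then show ?thesis using IH Cons by (auto simp: c2_red.simps(2))
  qed (use IH in \<open>simp add: c2_red.simps(2)\<close>)
qed simp

end

section \<open>The semidirect products\<close>

lemma sigma_act_apply: "w \<in> C2_carrier n \<Longrightarrow> sigma_act n i w = c2_red (concat (map (sigma_img i) w))"
  by (simp add: sigma_act_def)

lemma sigma_act_Nil [simp]: "sigma_act n i [] = []"
  by (simp add: sigma_act_apply)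

lemma c2_end_restrict_cong:
  assumes "c2_end n \<theta>" "\<And>w. w \<in> C2_carrier n \<Longrightarrow> \<eta> w = \<theta> w"
  shows "c2_end n \<eta>"
  using assms c2_endD[OF assms(1)] unfolding c2_end_def
  by (intro homI) (auto simp: c2_mult_closed)

lemma c2_end_sigma_act:
  assumes "1 \<le> i" "i < n"
  shows "c2_end n (sigma_act n i)"
proof (rule c2_end_restrict_cong[OF c2_end_concat_map[of n "sigma_img i"] sigma_act_apply])
  fix k assume "k \<in> {1..n}"
  then show "set (sigma_img i k) \<subseteq> {1..n} \<and> c2_red (sigma_img i k @ sigma_img i k) = []"
    using assms by (auto simp: sigma_img_def c2_red.simps(2))
qed

lemma sigma_act_auto:
  assumes i: "1 \<le> i" "i < n"
  shows "sigma_act n i \<in> auto (C2_grp n)"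
proof -
  let ?S = "C2_carrier n"
  \<comment> \<open>The values of the inverse automorphism on letters; both composites are compared
    with the identity letter by letter.\<close>
  let ?f = "\<lambda>k. if k = i then [i, Suc i, i] else if k = Suc i then [i] else [k]"
  let ?t = "\<lambda>w. c2_red (concat (map ?f w))"
  note \<sigma> = c2_end_sigma_act[OF i]
  have t: "c2_end n ?t"
    using i by (intro c2_end_concat_map) (auto simp: c2_red.simps(2))
  have idend: "c2_end n (\<lambda>w. w)"
    by (auto simp: c2_end_def intro!: homI)
  have letter: "[k] \<in> ?S" if "k \<in> {1..n}" for k using that by (simp add: C2_carrier_iff)
  have "[Suc i, i, Suc i] \<in> ?S" "[i, Suc i, i] \<in> ?S" using i by (auto simp: C2_carrier_iff)
  then have "?t (sigma_act n i w) = w" "sigma_act n i (?t w) = w" if "w \<in> ?S" for w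
    using that letter i
    by (intro c2_end_eqI[OF c2_end_comp[OF t \<sigma>] idend _ that]
        c2_end_eqI[OF c2_end_comp[OF \<sigma> t] idend _ that];
        auto simp: sigma_act_apply sigma_img_def c2_red.simps(2))+
  then have "bij_betw (sigma_act n i) ?S ?S"
    using c2_endD(1)[OF \<sigma>] c2_endD(1)[OF t] by (intro bij_betwI[where g = ?t]) auto
  then show ?thesis
    using \<sigma> by (simp add: auto_def c2_end_def Bij_def) (simp add: sigma_act_def)
qed

context
  fixes n :: nat
begin

abbreviation "Bij_C2 \<equiv> BijGroup (C2_carrier n)"

interpretation B: group Bij_C2
  by (rule group_BijGroup)

interpretation C: group "C2_grp n"
  by (rule group_C2_grp)

lemma sigma_subset_Bij: "{sigma_act n i | i. 1 \<le> i \<and> i < n} \<subseteq> carrier Bij_C2"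
  using sigma_act_auto by (fastforce simp: auto_def BijGroup_def)

lemma subgroup_Bn: "subgroup (Bn n) Bij_C2"
  unfolding Bn_def by (rule B.generate_is_subgroup[OF sigma_subset_Bij])

lemma Bn_subset_auto: "Bn n \<subseteq> auto (C2_grp n)"
  unfolding Bn_def using C.subgroup_auto sigma_act_auto
  by (intro B.generate_subgroup_incl) auto

lemma Bn_facts:
  assumes "\<phi> \<in> Bn n"
  shows "\<phi> \<in> Bij (C2_carrier n)" "c2_end n \<phi>" "\<phi> \<in> extensional (C2_carrier n)"
    "\<phi> \<in> C2_carrier n \<rightarrow> C2_carrier n"
proof -
  have "\<phi> \<in> auto (C2_grp n)" using assms Bn_subset_auto by (rule rev_subsetD)
  then show B: "\<phi> \<in> Bij (C2_carrier n)" and "c2_end n \<phi>" by (auto simp: auto_def c2_end_def)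
  show "\<phi> \<in> extensional (C2_carrier n)" by (rule Bij_imp_extensional[OF B])
  show "\<phi> \<in> C2_carrier n \<rightarrow> C2_carrier n" by (rule Bij_imp_funcset[OF B])
qed

lemma Bn_compose: "\<phi> \<in> Bn n \<Longrightarrow> \<psi> \<in> Bn n \<Longrightarrow> compose (C2_carrier n) \<phi> \<psi> \<in> Bn n"
  using subgroup.m_closed[OF subgroup_Bn, of \<phi> \<psi>] Bn_facts by (simp add: BijGroup_def)

lemma Bn_id: "(\<lambda>x \<in> C2_carrier n. x) \<in> Bn n"
  using subgroup.one_closed[OF subgroup_Bn] by (simp add: BijGroup_def)

lemma Bn_inverse:
  assumes "\<phi> \<in> Bn n"
  shows "inv\<^bsub>Bij_C2\<^esub> \<phi> \<in> Bn n" "compose (C2_carrier n) \<phi> (inv\<^bsub>Bij_C2\<^esub> \<phi>) = (\<lambda>x \<in> C2_carrier n. x)"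
    "compose (C2_carrier n) (inv\<^bsub>Bij_C2\<^esub> \<phi>) \<phi> = (\<lambda>x \<in> C2_carrier n. x)"
    "w \<in> C2_carrier n \<Longrightarrow> \<phi> ((inv\<^bsub>Bij_C2\<^esub> \<phi>) w) = w"
proof -
  show inv: "inv\<^bsub>Bij_C2\<^esub> \<phi> \<in> Bn n" using subgroup.m_inv_closed[OF subgroup_Bn assms] .
  have "\<phi> \<in> carrier Bij_C2" "inv\<^bsub>Bij_C2\<^esub> \<phi> \<in> carrier Bij_C2"
    using assms inv Bn_facts(1) by (auto simp: BijGroup_def)
  then show eq: "compose (C2_carrier n) \<phi> (inv\<^bsub>Bij_C2\<^esub> \<phi>) = (\<lambda>x \<in> C2_carrier n. x)"
    and "compose (C2_carrier n) (inv\<^bsub>Bij_C2\<^esub> \<phi>) \<phi> = (\<lambda>x \<in> C2_carrier n. x)"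
    using B.r_inv[of \<phi>] B.l_inv[of \<phi>] by (simp_all add: BijGroup_def)
  show "w \<in> C2_carrier n \<Longrightarrow> \<phi> ((inv\<^bsub>Bij_C2\<^esub> \<phi>) w) = w"
    using fun_cong[OF eq, of w] by (simp add: compose_def)
qed

lemma Bn_eqI:
  assumes "\<phi> \<in> Bn n" "\<psi> \<in> Bn n" "\<And>k. k \<in> {1..n} \<Longrightarrow> \<phi> [k] = \<psi> [k]"
  shows "\<phi> = \<psi>"
  by (rule extensionalityI[OF Bn_facts(3)[OF assms(1)] Bn_facts(3)[OF assms(2)]])
    (rule c2_end_eqI[OF Bn_facts(2)[OF assms(1)] Bn_facts(2)[OF assms(2)] assms(3)])

lemma sigma_in_Bn: "1 \<le> i \<Longrightarrow> i < n \<Longrightarrow> sigma_act n i \<in> Bn n"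
  unfolding Bn_def by (rule generate.incl) auto

lemma semidirect_simps:
  "carrier (semidirect_BC n) = Bn n \<times> C2_carrier n"
  "(\<phi>, g) \<otimes>\<^bsub>semidirect_BC n\<^esub> (\<psi>, h) = (compose (C2_carrier n) \<psi> \<phi>, c2_mult (\<psi> g) h)"
  "\<one>\<^bsub>semidirect_BC n\<^esub> = (\<lambda>x \<in> C2_carrier n. x, [])"
  by (simp_all add: semidirect_BC_def)

lemma group_semidirect_BC: "group (semidirect_BC n)"
proof (rule groupI)
  fix x y assume "x \<in> carrier (semidirect_BC n)" "y \<in> carrier (semidirect_BC n)"
  then show "x \<otimes>\<^bsub>semidirect_BC n\<^esub> y \<in> carrier (semidirect_BC n)"
    using c2_endD(1)[OF Bn_facts(2)]
    by (cases x; cases y) (auto simp: semidirect_simps Bn_compose c2_mult_closed)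
next
  show "\<one>\<^bsub>semidirect_BC n\<^esub> \<in> carrier (semidirect_BC n)"
    by (simp add: semidirect_simps Bn_id)
next
  fix x y z
  assume xyz: "x \<in> carrier (semidirect_BC n)" "y \<in> carrier (semidirect_BC n)" "z \<in> carrier (semidirect_BC n)"
  obtain \<phi> g \<psi> h \<chi> k where e: "x = (\<phi>, g)" "y = (\<psi>, h)" "z = (\<chi>, k)" by (cases x; cases y; cases z) auto
  then have m: "\<phi> \<in> Bn n" "\<psi> \<in> Bn n" "\<chi> \<in> Bn n" "g \<in> C2_carrier n" "h \<in> C2_carrier n" "k \<in> C2_carrier n"
    using xyz by (auto simp: semidirect_simps)
  have "compose (C2_carrier n) \<chi> (compose (C2_carrier n) \<psi> \<phi>) = compose (C2_carrier n) (compose (C2_carrier n) \<chi> \<psi>) \<phi>"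
    using Bn_facts(4)[OF m(1)] by (rule compose_assoc)
  moreover have "\<chi> (c2_mult (\<psi> g) h) = c2_mult (\<chi> (\<psi> g)) (\<chi> h)"
    using c2_endD[OF Bn_facts(2)] m by simp
  ultimately show "x \<otimes>\<^bsub>semidirect_BC n\<^esub> y \<otimes>\<^bsub>semidirect_BC n\<^esub> z = x \<otimes>\<^bsub>semidirect_BC n\<^esub> (y \<otimes>\<^bsub>semidirect_BC n\<^esub> z)"
    using m e by (simp add: semidirect_simps c2_mult_assoc compose_eq)
next
  fix x assume "x \<in> carrier (semidirect_BC n)"
  then obtain \<phi> g where x: "x = (\<phi>, g)" "\<phi> \<in> Bn n" "g \<in> C2_carrier n" by (auto simp: semidirect_simps)
  have "c2_red g = g" using x by (simp add: C2_carrier_def)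
  then show "\<one>\<^bsub>semidirect_BC n\<^esub> \<otimes>\<^bsub>semidirect_BC n\<^esub> x = x"
    using compose_Id[OF Bn_facts(4) Bn_facts(3)] c2_endD(3)[OF Bn_facts(2)[OF x(2)]] x
    by (simp add: semidirect_simps c2_mult_def)
  \<comment> \<open>The left inverse of \<open>\<phi> g\<close> is \<open>g^-1 \<phi>^-1\<close>,
    rewritten with the automorphism in front: this replaces \<open>g^-1\<close> by its image under
    \<open>\<phi>^-1\<close>.\<close>
  let ?\<psi> = "inv\<^bsub>Bij_C2\<^esub> \<phi>"
  have "(?\<psi>, ?\<psi> (rev g)) \<otimes>\<^bsub>semidirect_BC n\<^esub> x = \<one>\<^bsub>semidirect_BC n\<^esub>"
    using x Bn_inverse[OF x(2)] by (simp add: semidirect_simps c2_mult_def)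
  moreover have "(?\<psi>, ?\<psi> (rev g)) \<in> carrier (semidirect_BC n)"
    using x Bn_inverse(1)[OF x(2)] c2_endD(1)[OF Bn_facts(2)[OF Bn_inverse(1)[OF x(2)]]] by (simp add: semidirect_simps)
  ultimately show "\<exists>y\<in>carrier (semidirect_BC n). y \<otimes>\<^bsub>semidirect_BC n\<^esub> x = \<one>\<^bsub>semidirect_BC n\<^esub>"
    by blast
qed

section \<open>Words of even length\<close>

lemma even_length_c2_red: "even (length (c2_red w)) = even (length w)"
proof (induction w)
  case (Cons x w)
  then show ?case
    by (cases "c2_red w") (auto simp: c2_red.simps(2))
qed simp

lemma Phi_iff: "w \<in> Phi n \<longleftrightarrow> w \<in> C2_carrier n \<and> even (length w)"
  by (auto simp: Phi_def even_length_c2_red C2_carrier_def intro!: exI[of _ w])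

text \<open>Each letter is sent by a generator to a word of odd length, and cancellation removes
  letters in pairs.\<close>

lemma Bn_even_length:
  assumes "\<phi> \<in> Bn n" "w \<in> C2_carrier n"
  shows "even (length (\<phi> w)) = even (length w)"
proof -
  have odd: "odd (length (sigma_img i k))" for i k by (simp add: sigma_img_def)
  have sig: "even (length (sigma_act n i w)) = even (length w)" if w: "w \<in> C2_carrier n" for i w
  proof -
    have "even (length (concat (map (sigma_img i) w))) = even (length w)"
      by (induction w) (auto simp: odd)
    then show ?thesis using w by (simp add: sigma_act_apply even_length_c2_red)
  qed
  let ?P = "\<lambda>\<phi>. \<forall>w \<in> C2_carrier n. even (length (\<phi> w)) = even (length w)"
  have "?P \<phi>"
    using assms(1) unfolding Bn_def
  proof (induction \<phi> rule: generate.induct)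
    case one
    then show ?case by (simp add: BijGroup_def)
  next
    case (incl h)
    then show ?case using sig by auto
  next
    case (inv h)
    then have h: "h \<in> Bn n" and P: "?P h" using sig sigma_in_Bn by auto
    show ?case
    proof
      fix w assume w: "w \<in> C2_carrier n"
      then have "(inv\<^bsub>Bij_C2\<^esub> h) w \<in> C2_carrier n"
        using c2_endD(1)[OF Bn_facts(2)[OF Bn_inverse(1)[OF h]]] by simp
      then show "even (length ((inv\<^bsub>Bij_C2\<^esub> h) w)) = even (length w)"
        using P Bn_inverse(4)[OF h w] by metis
    qed
  next
    case (eng h1 h2)
    then have "h1 \<in> Bn n" "h2 \<in> Bn n" by (auto simp: Bn_def)
    then show ?case
      using eng Bn_facts(1)[of h1] Bn_facts(1)[of h2] c2_endD(1)[OF Bn_facts(2), of h2]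
      by (auto simp: BijGroup_def compose_def)
  qed
  then show ?thesis using assms by blast
qed

lemma Bn_Phi: "\<phi> \<in> Bn n \<Longrightarrow> w \<in> Phi n \<Longrightarrow> \<phi> w \<in> Phi n"
  using c2_endD(1)[OF Bn_facts(2)] Bn_even_length by (auto simp: Phi_iff)

lemma subgroup_BPhi: "subgroup (Bn n \<times> Phi n) (semidirect_BC n)"
proof -
  interpret S: group "semidirect_BC n" by (rule group_semidirect_BC)
  have mult: "c2_mult v w \<in> Phi n" if "v \<in> Phi n" "w \<in> Phi n" for v w
    using that c2_mult_closed by (auto simp: Phi_iff even_length_c2_red c2_mult_def)
  show ?thesis
  proof (rule S.subgroupI)
    show "Bn n \<times> Phi n \<subseteq> carrier (semidirect_BC n)" by (auto simp: semidirect_simps Phi_iff)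
    have "[] \<in> Phi n" by (simp add: Phi_iff)
    then show "Bn n \<times> Phi n \<noteq> {}" using Bn_id by blast
  next
    fix a assume "a \<in> Bn n \<times> Phi n"
    then obtain \<phi> g where a: "a = (\<phi>, g)" "\<phi> \<in> Bn n" "g \<in> Phi n" by auto
    let ?\<psi> = "inv\<^bsub>Bij_C2\<^esub> \<phi>"
    note i = Bn_inverse(1)[OF a(2)]
    have r: "rev g \<in> Phi n" "g \<in> C2_carrier n" using a by (auto simp: Phi_iff)
    have "inv\<^bsub>semidirect_BC n\<^esub> a = (?\<psi>, ?\<psi> (rev g))"
    proof (rule S.inv_equality)
      show "(?\<psi>, ?\<psi> (rev g)) \<otimes>\<^bsub>semidirect_BC n\<^esub> a = \<one>\<^bsub>semidirect_BC n\<^esub>"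
        using a r Bn_inverse[OF a(2)] by (simp add: semidirect_simps c2_mult_def)
    qed (use a r i Bn_Phi[OF i r(1)] in \<open>auto simp: semidirect_simps Phi_iff\<close>)
    then show "inv\<^bsub>semidirect_BC n\<^esub> a \<in> Bn n \<times> Phi n" using i Bn_Phi[OF i r(1)] by simp
  next
    fix a b assume "a \<in> Bn n \<times> Phi n" "b \<in> Bn n \<times> Phi n"
    then show "a \<otimes>\<^bsub>semidirect_BC n\<^esub> b \<in> Bn n \<times> Phi n"
      using mult Bn_Phi Bn_compose by (cases a; cases b) (auto simp: semidirect_simps)
  qed
qed

lemma group_semidirect_BPhi: "group (semidirect_BPhi n)"
  unfolding semidirect_BPhi_def
  using subgroup.subgroup_is_group[OF subgroup_BPhi group_semidirect_BC] .

lemma semidirect_BPhi_simps: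
  "carrier (semidirect_BPhi n) = Bn n \<times> Phi n"
  "(\<phi>, g) \<otimes>\<^bsub>semidirect_BPhi n\<^esub> (\<psi>, h) = (compose (C2_carrier n) \<psi> \<phi>, c2_mult (\<psi> g) h)"
  "\<one>\<^bsub>semidirect_BPhi n\<^esub> = (\<lambda>x \<in> C2_carrier n. x, [])"
  by (simp_all add: semidirect_BPhi_def semidirect_BC_def)

end

section \<open>The defining relations\<close>

context group
begin

lemma word_eval_braid_relator:
  assumes "e i \<in> carrier G" "e j \<in> carrier G"
  shows "word_eval G e [(i, False), (j, False), (i, False), (j, True), (i, True), (j, True)] = \<one>
    \<longleftrightarrow> e i \<otimes> e j \<otimes> e i = e j \<otimes> e i \<otimes> e j"
proof -
  have "word_eval G e [(i, False), (j, False), (i, False), (j, True), (i, True), (j, True)]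
      = (e i \<otimes> e j \<otimes> e i) \<otimes> inv (e j \<otimes> e i \<otimes> e j)"
    using assms by (simp add: m_assoc inv_mult_group)
  then show ?thesis using assms by (simp add: inv_solve_right')
qed

lemma word_eval_commutator_relator:
  assumes "e i \<in> carrier G" "e j \<in> carrier G"
  shows "word_eval G e [(i, False), (j, False), (i, True), (j, True)] = \<one> \<longleftrightarrow> e i \<otimes> e j = e j \<otimes> e i"
proof -
  have "word_eval G e [(i, False), (j, False), (i, True), (j, True)] = (e i \<otimes> e j) \<otimes> inv (e j \<otimes> e i)"
    using assms by (simp add: m_assoc inv_mult_group)
  then show ?thesis using assms by (simp add: inv_solve_right')
qed

end

lemma artD_rels_letters: "r \<in> artD_rels n \<Longrightarrow> fst ` set r \<subseteq> {1..n}"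
  by (auto simp: artD_rels_def)

definition artD_img :: "nat \<Rightarrow> nat \<Rightarrow> (nat list \<Rightarrow> nat list) \<times> nat list" where
  "artD_img n i = (if i = n then (sigma_act n (n - 1), [n, n - 1]) else (sigma_act n i, []))"

lemma sigma_compose_letter:
  assumes "1 \<le> i" "i < n" "1 \<le> j" "j < n" "k \<in> {1..n}"
  shows "compose (C2_carrier n) (sigma_act n i) (sigma_act n j) [k]
     = c2_red (concat (map (sigma_img i) (sigma_img j k)))"
proof -
  have "[k] \<in> C2_carrier n" "sigma_img j k \<in> C2_carrier n"
    using assms by (auto simp: C2_carrier_iff sigma_img_def)
  then show ?thesis
    by (simp add: compose_def sigma_act_apply) (simp add: C2_carrier_def sigma_act_apply)
qed

lemma sigma_far:
  assumes "1 \<le> i" "Suc i < j" "j < n"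
  shows "compose (C2_carrier n) (sigma_act n j) (sigma_act n i) = compose (C2_carrier n) (sigma_act n i) (sigma_act n j)"
proof (rule Bn_eqI)
  fix k assume "k \<in> {1..n}"
  then show "compose (C2_carrier n) (sigma_act n j) (sigma_act n i) [k] = compose (C2_carrier n) (sigma_act n i) (sigma_act n j) [k]"
    using assms by (simp add: sigma_compose_letter) (auto simp: sigma_img_def)
qed (use assms in \<open>auto intro!: Bn_compose sigma_in_Bn\<close>)

lemma sigma_braid:
  assumes "1 \<le> i" "Suc i < n"
  defines "j \<equiv> Suc i"
  shows "compose (C2_carrier n) (sigma_act n i) (compose (C2_carrier n) (sigma_act n j) (sigma_act n i))
    = compose (C2_carrier n) (sigma_act n j) (compose (C2_carrier n) (sigma_act n i) (sigma_act n j))"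
proof (rule Bn_eqI)
  fix k assume k: "k \<in> {1..n}"
  have ij: "1 \<le> i" "i < n" "1 \<le> j" "j < n" "j = Suc i" using assms by auto
  have mem: "c2_red (concat (map (sigma_img a) (sigma_img b k))) \<in> C2_carrier n" if "a \<in> {i, j}" "b \<in> {i, j}" for a b
    using that k ij by (intro c2_red_in_carrier) (auto simp: sigma_img_def)
  have kk: "[k] \<in> C2_carrier n" using k by (simp add: C2_carrier_iff)
  consider "k = i" | "k = Suc i" | "k = Suc (Suc i)" | "k \<noteq> i" "k \<noteq> Suc i" "k \<noteq> Suc (Suc i)" by blast
  then have "c2_red (concat (map (sigma_img i) (c2_red (concat (map (sigma_img j) (sigma_img i k))))))
    = c2_red (concat (map (sigma_img j) (c2_red (concat (map (sigma_img i) (sigma_img j k))))))"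
    unfolding ij(5) by cases (simp_all add: sigma_img_def c2_red.simps(2))
  moreover have "compose (C2_carrier n) (sigma_act n a) (compose (C2_carrier n) (sigma_act n b) (sigma_act n a)) [k]
    = c2_red (concat (map (sigma_img a) (c2_red (concat (map (sigma_img b) (sigma_img a k))))))"
    if "a \<in> {i, j}" "b \<in> {i, j}" for a b
  proof -
    have ab: "1 \<le> a" "a < n" "1 \<le> b" "b < n" using that ij by auto
    show ?thesis
      using sigma_act_apply[OF mem[OF that(2,1)], of a] sigma_compose_letter[OF ab(3,4,1,2) k]
      by (simp add: compose_eq[OF kk])
  qed
  ultimately show "compose (C2_carrier n) (sigma_act n i) (compose (C2_carrier n) (sigma_act n j) (sigma_act n i)) [k]
    = compose (C2_carrier n) (sigma_act n j) (compose (C2_carrier n) (sigma_act n i) (sigma_act n j)) [k]"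
    by simp
qed (use assms in \<open>auto intro!: Bn_compose sigma_in_Bn\<close>)

lemma artD_img_closed: "2 \<le> n \<Longrightarrow> i \<in> {1..n} \<Longrightarrow> artD_img n i \<in> carrier (semidirect_BPhi n)"
  by (auto simp: artD_img_def semidirect_BPhi_simps Phi_iff C2_carrier_iff intro!: sigma_in_Bn)

lemma artD_img_braid:
  assumes "2 \<le> n" "braid_pair_D n i j" "i \<in> {1..n}" "j \<in> {1..n}"
  shows "artD_img n i \<otimes>\<^bsub>semidirect_BPhi n\<^esub> artD_img n j \<otimes>\<^bsub>semidirect_BPhi n\<^esub> artD_img n i
     = artD_img n j \<otimes>\<^bsub>semidirect_BPhi n\<^esub> artD_img n i \<otimes>\<^bsub>semidirect_BPhi n\<^esub> artD_img n j"
proof -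
  have pair: "artD_img n i \<otimes>\<^bsub>semidirect_BPhi n\<^esub> artD_img n (Suc i) \<otimes>\<^bsub>semidirect_BPhi n\<^esub> artD_img n i
     = artD_img n (Suc i) \<otimes>\<^bsub>semidirect_BPhi n\<^esub> artD_img n i \<otimes>\<^bsub>semidirect_BPhi n\<^esub> artD_img n (Suc i)"
    if "1 \<le> i" "Suc i < n" for i
    using that sigma_braid[OF that] by (simp add: artD_img_def semidirect_BPhi_simps c2_mult_def)
  have last: "artD_img n p \<otimes>\<^bsub>semidirect_BPhi n\<^esub> artD_img n n \<otimes>\<^bsub>semidirect_BPhi n\<^esub> artD_img n p
     = artD_img n n \<otimes>\<^bsub>semidirect_BPhi n\<^esub> artD_img n p \<otimes>\<^bsub>semidirect_BPhi n\<^esub> artD_img n n"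
    if p: "n = Suc (Suc p)" "1 \<le> p" for p
  proof -
    have "Suc p < n" using p by simp
    note br = sigma_braid[OF p(2) this]
    have mem: "[n, Suc p] \<in> C2_carrier n" "[n, Suc p, p, Suc p] \<in> C2_carrier n"
      using p by (auto simp: C2_carrier_iff)
    \<comment> \<open>Here \<open>p = n - 2\<close> and \<open>Suc p = n - 1\<close>. The two sides
      of the relation have as second components the word in \<open>s1\<close> and the product in
      \<open>s2\<close>; both equal \<open>[n, Suc p, p, Suc p]\<close>.\<close>
    have s1: "sigma_act n p [n, Suc p] = [n, Suc p, p, Suc p]"
      using mem p by (simp add: sigma_act_apply sigma_img_def c2_red.simps(2))
    have s2: "c2_mult (sigma_act n (Suc p) [n, Suc p, p, Suc p]) [n, Suc p] = [n, Suc p, p, Suc p]"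
      using mem p by (simp add: sigma_act_apply sigma_img_def c2_red.simps(2) c2_mult_def)
    have "c2_red [n, Suc p] = [n, Suc p]" "c2_red [n, Suc p, p, Suc p] = [n, Suc p, p, Suc p]"
      using mem by (simp_all add: C2_carrier_def)
    then show ?thesis
      using p br s1 s2 by (simp add: artD_img_def semidirect_BPhi_simps c2_mult_def[of _ "[]"] c2_mult_def[of "[]"])
  qed
  obtain p where p: "n = Suc (Suc p)" using assms(1) that[of "n - 2"] by simp
  have "(1 \<le> i \<and> j = Suc i \<and> Suc i < n) \<or> (1 \<le> j \<and> i = Suc j \<and> Suc j < n)
      \<or> (1 \<le> p \<and> i = p \<and> j = n) \<or> (1 \<le> p \<and> i = n \<and> j = p)"
    using assms(2) p by (auto simp: braid_pair_D_def)
  then show ?thesis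
    using pair[of i] pair[of j] last[OF p] by (elim disjE conjE) simp_all
qed

lemma artD_img_commute:
  assumes n: "2 \<le> n" and ij: "\<not> braid_pair_D n i j" "i \<in> {1..n}" "j \<in> {1..n}" "i \<noteq> j"
  shows "artD_img n i \<otimes>\<^bsub>semidirect_BPhi n\<^esub> artD_img n j = artD_img n j \<otimes>\<^bsub>semidirect_BPhi n\<^esub> artD_img n i"
proof -
  obtain p where p: "n = Suc (Suc p)" using n that[of "n - 2"] by simp
  have far: "artD_img n i \<otimes>\<^bsub>semidirect_BPhi n\<^esub> artD_img n j = artD_img n j \<otimes>\<^bsub>semidirect_BPhi n\<^esub> artD_img n i"
    if "1 \<le> i" "Suc i < j" "j < n" for i j
    using that sigma_far[OF that] by (simp add: artD_img_def semidirect_BPhi_simps c2_mult_def)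
  have mem: "[n, Suc p] \<in> C2_carrier n" using p by (auto simp: C2_carrier_iff)
  then have red: "c2_red [n, Suc p] = [n, Suc p]" by (simp add: C2_carrier_def)
  have last: "artD_img n i \<otimes>\<^bsub>semidirect_BPhi n\<^esub> artD_img n n = artD_img n n \<otimes>\<^bsub>semidirect_BPhi n\<^esub> artD_img n i"
    if i: "1 \<le> i" "i < n" "i \<noteq> p" for i
  proof -
    have comm: "compose (C2_carrier n) (sigma_act n (Suc p)) (sigma_act n i) = compose (C2_carrier n) (sigma_act n i) (sigma_act n (Suc p))"
      using sigma_far[of i "Suc p" n] i p by (cases "i = Suc p") auto
    \<comment> \<open>For \<open>i = n - 1\<close> neither letter is fixed, but their product is,
      since the last two letters of its image cancel.\<close>
    have "sigma_act n i [n, Suc p] = [n, Suc p]"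
      using mem i p by (auto simp: sigma_act_apply sigma_img_def c2_red.simps(2))
    then show ?thesis
      using comm i p red by (simp add: artD_img_def semidirect_BPhi_simps c2_mult_def)
  qed
  have "(i < n \<and> j < n \<and> Suc i < j) \<or> (i < n \<and> j < n \<and> Suc j < i) \<or> (i = n \<and> j < n \<and> j \<noteq> p)
      \<or> (j = n \<and> i < n \<and> i \<noteq> p)"
  proof -
    have b: "1 \<le> i" "i \<le> n" "1 \<le> j" "j \<le> n" using ij by auto
    have near: "j \<noteq> Suc i \<or> \<not> Suc i < n" "i \<noteq> Suc j \<or> \<not> Suc j < n"
      using ij(1) b p by (simp_all add: braid_pair_D_def less_Suc_eq_le)
    have ends: "j = n \<Longrightarrow> i \<noteq> p" "i = n \<Longrightarrow> j \<noteq> p"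
      using ij(1) b p by (auto simp: braid_pair_D_def)
    show ?thesis
    proof (cases "i = n \<or> j = n")
      case True
      then show ?thesis using ends b ij(4) by (elim disjE) simp_all
    next
      case False
      then have "i < n" "j < n" using b by simp_all
      then show ?thesis using near ij(4) by linarith
    qed
  qed
  then show ?thesis
    using far[of i j] far[of j i] last[of i] last[of j] ij by (elim disjE conjE) simp_all
qed

section \<open>The presented group as an instance of the abstract setting\<close>

lemma group_ArtD: "group (ArtD n)"
  unfolding ArtD_def by (rule group_presented_grp[OF artD_rels_letters])

lemma artD_gen_closed: "i \<in> {1..n} \<Longrightarrow> artD_gen n i \<in> carrier (ArtD n)"
  unfolding ArtD_def artD_gen_def by (rule pres_gen_closed[OF artD_rels_letters])

lemma ArtD_generated: "carrier (ArtD n) = generate (ArtD n) (artD_gen n ` {1..n})"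
  unfolding ArtD_def artD_gen_def by (rule presented_grp_generated[OF artD_rels_letters])

lemma ArtD_relator: "r \<in> artD_rels n \<Longrightarrow> word_eval (ArtD n) (artD_gen n) r = \<one>\<^bsub>ArtD n\<^esub>"
  unfolding ArtD_def artD_gen_def by (rule presented_grp_relator[OF artD_rels_letters])

lemma ArtD_braid:
  assumes "braid_pair_D n i j" "i \<in> {1..n}" "j \<in> {1..n}" "i \<noteq> j"
  shows "artD_gen n i \<otimes>\<^bsub>ArtD n\<^esub> artD_gen n j \<otimes>\<^bsub>ArtD n\<^esub> artD_gen n i
    = artD_gen n j \<otimes>\<^bsub>ArtD n\<^esub> artD_gen n i \<otimes>\<^bsub>ArtD n\<^esub> artD_gen n j"
proof -
  have "[(i, False), (j, False), (i, False), (j, True), (i, True), (j, True)] \<in> artD_rels n"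
    using assms unfolding artD_rels_def by blast
  from ArtD_relator[OF this] show ?thesis
    using group.word_eval_braid_relator[OF group_ArtD[of n], of "artD_gen n" i j] assms by (simp add: artD_gen_closed)
qed

lemma ArtD_commute:
  assumes "\<not> braid_pair_D n i j" "i \<in> {1..n}" "j \<in> {1..n}" "i \<noteq> j"
  shows "artD_gen n i \<otimes>\<^bsub>ArtD n\<^esub> artD_gen n j = artD_gen n j \<otimes>\<^bsub>ArtD n\<^esub> artD_gen n i"
proof -
  have "[(i, False), (j, False), (i, True), (j, True)] \<in> artD_rels n"
    using assms unfolding artD_rels_def by blast
  from ArtD_relator[OF this] show ?thesis
    using group.word_eval_commutator_relator[OF group_ArtD[of n], of "artD_gen n" i j] assms by (simp add: artD_gen_closed)
qed

lemma artin_D_ArtD: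
  assumes "2 \<le> n"
  shows "artin_D (ArtD n) n (artD_gen n) (artD_gen n n)"
proof -
  interpret group "ArtD n" by (rule group_ArtD)
  show ?thesis
  proof unfold_locales
    fix i assume "1 \<le> i" "i < n"
    then show "artD_gen n i \<in> carrier (ArtD n)" by (simp add: artD_gen_closed)
  next
    fix i assume "1 \<le> i" "Suc i < n"
    then show "artD_gen n i \<otimes>\<^bsub>ArtD n\<^esub> artD_gen n (Suc i) \<otimes>\<^bsub>ArtD n\<^esub> artD_gen n i
        = artD_gen n (Suc i) \<otimes>\<^bsub>ArtD n\<^esub> artD_gen n i \<otimes>\<^bsub>ArtD n\<^esub> artD_gen n (Suc i)"
      by (intro ArtD_braid) (simp_all add: braid_pair_D_def)
  next
    fix i j assume "1 \<le> i" "Suc i < j" "j < n"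
    then show "artD_gen n i \<otimes>\<^bsub>ArtD n\<^esub> artD_gen n j = artD_gen n j \<otimes>\<^bsub>ArtD n\<^esub> artD_gen n i"
      by (intro ArtD_commute) (simp_all add: braid_pair_D_def)
  next
    show "2 \<le> n" by fact
    show "artD_gen n n \<in> carrier (ArtD n)" using assms by (simp add: artD_gen_closed)
  next
    fix i assume "1 \<le> i" "i < n" "i \<noteq> n - 2"
    moreover from this have "\<not> braid_pair_D n i n"
      by (auto simp: braid_pair_D_def)
    ultimately show "artD_gen n i \<otimes>\<^bsub>ArtD n\<^esub> artD_gen n n = artD_gen n n \<otimes>\<^bsub>ArtD n\<^esub> artD_gen n i"
      by (intro ArtD_commute) simp_all
  next
    assume "3 \<le> n"
    then show "artD_gen n (n - 2) \<otimes>\<^bsub>ArtD n\<^esub> artD_gen n n \<otimes>\<^bsub>ArtD n\<^esub> artD_gen n (n - 2)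
        = artD_gen n n \<otimes>\<^bsub>ArtD n\<^esub> artD_gen n (n - 2) \<otimes>\<^bsub>ArtD n\<^esub> artD_gen n n"
      by (intro ArtD_braid) (simp_all add: braid_pair_D_def)
  qed
qed

lemma ArtD_hom:
  assumes n: "2 \<le> n"
  obtains h where "h \<in> hom (ArtD n) (semidirect_BPhi n)" "\<And>i. i \<in> {1..n} \<Longrightarrow> h (artD_gen n i) = artD_img n i"
proof -
  note K = group_semidirect_BPhi[of n] and cl = artD_img_closed[OF n]
  have rel: "word_eval (semidirect_BPhi n) (artD_img n) r = \<one>\<^bsub>semidirect_BPhi n\<^esub>" if r: "r \<in> artD_rels n" for r
    using r unfolding artD_rels_def
  proof (elim UnE CollectE exE conjE)
    fix i j assume "r = [(i, False), (j, False), (i, False), (j, True), (i, True), (j, True)]"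
      "i \<in> {1..n}" "j \<in> {1..n}" "braid_pair_D n i j"
    then show ?thesis
      using group.word_eval_braid_relator[OF K, of "artD_img n" i j] artD_img_braid[OF n, of i j] cl[of i] cl[of j] by simp
  next
    fix i j assume "r = [(i, False), (j, False), (i, True), (j, True)]"
      "i \<in> {1..n}" "j \<in> {1..n}" "i \<noteq> j" "\<not> braid_pair_D n i j"
    then show ?thesis
      using group.word_eval_commutator_relator[OF K, of "artD_img n" i j] artD_img_commute[OF n, of i j] cl[of i] cl[of j] by simp
  qed
  have "artD_img n \<in> {1..n} \<rightarrow> carrier (semidirect_BPhi n)" using cl by blast
  from presented_grp_hom[OF artD_rels_letters K this rel] that show thesis
    unfolding ArtD_def artD_gen_def by blast
qed

section \<open>The homomorphism to the semidirect product and its bijectivity\<close>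

locale artD_map =
  fixes n :: nat and h :: "(nat \<times> bool) list set \<Rightarrow> (nat list \<Rightarrow> nat list) \<times> nat list"
  assumes two: "2 \<le> n" and h_hom: "h \<in> hom (ArtD n) (semidirect_BPhi n)"
    and h_gen: "\<And>i. i \<in> {1..n} \<Longrightarrow> h (artD_gen n i) = artD_img n i"
begin

definition idn :: "nat list \<Rightarrow> nat list" where
  "idn = (\<lambda>x \<in> C2_carrier n. x)"

lemma idn_Bn: "idn \<in> Bn n"
  unfolding idn_def by (rule Bn_id)

lemma idn_apply: "w \<in> C2_carrier n \<Longrightarrow> idn w = w"
  by (simp add: idn_def)

lemma BPhi_one: "\<one>\<^bsub>semidirect_BPhi n\<^esub> = (idn, [])"
  by (simp add: idn_def semidirect_BPhi_simps)

lemma compose_idn: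
  assumes "\<phi> \<in> Bn n"
  shows "compose (C2_carrier n) idn \<phi> = \<phi>" "compose (C2_carrier n) \<phi> idn = \<phi>"
  unfolding idn_def using Id_compose[OF Bn_facts(4) Bn_facts(3)] compose_Id[OF Bn_facts(4) Bn_facts(3)] assms
  by blast+

sublocale K: group "semidirect_BPhi n"
  by (rule group_semidirect_BPhi)

sublocale D: artin_D "ArtD n" n "artD_gen n" "artD_gen n n"
  by (rule artin_D_ArtD[OF two])

sublocale h: group_hom "ArtD n" "semidirect_BPhi n" h
  using h_hom by unfold_locales

declare h.hom_mult [simp del]

lemma h_mem: "x \<in> carrier (ArtD n) \<Longrightarrow> fst (h x) \<in> Bn n \<and> snd (h x) \<in> Phi n"
  using h.hom_closed[of x] by (auto simp: semidirect_BPhi_simps mem_Times_iff)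

lemma h_mult:
  assumes "x \<in> carrier (ArtD n)" "y \<in> carrier (ArtD n)"
  shows "h (x \<otimes>\<^bsub>ArtD n\<^esub> y) = (compose (C2_carrier n) (fst (h y)) (fst (h x)), c2_mult (fst (h y) (snd (h x))) (snd (h y)))"
  using h.hom_mult[OF assms] semidirect_BPhi_simps(2)[of n "fst (h x)" "snd (h x)" "fst (h y)" "snd (h y)"] by simp

sublocale R: braid_rep "ArtD n" n "artD_gen n" "\<lambda>x. fst (h x)"
proof unfold_locales
  fix x assume "x \<in> carrier (ArtD n)"
  then show "c2_end n (fst (h x))" using h_mem Bn_facts(2) by blast
next
  fix x y w assume "x \<in> carrier (ArtD n)" "y \<in> carrier (ArtD n)" "w \<in> C2_carrier n"
  then show "fst (h (x \<otimes>\<^bsub>ArtD n\<^esub> y)) w = fst (h y) (fst (h x) w)"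
    by (simp add: h_mult compose_eq)
next
  fix w assume "w \<in> C2_carrier n"
  then show "fst (h \<one>\<^bsub>ArtD n\<^esub>) w = w"
    using h.hom_one by (simp add: semidirect_BPhi_simps)
next
  fix i w assume "1 \<le> i" "i < n" "w \<in> C2_carrier n"
  then show "fst (h (artD_gen n i)) w = c2_red (concat (map (sigma_img i) w))"
    by (simp add: h_gen artD_img_def sigma_act_apply)
qed

lemma mult_id:
  assumes "\<phi> \<in> Bn n" "v \<in> C2_carrier n"
  shows "(\<phi>, v) \<otimes>\<^bsub>semidirect_BPhi n\<^esub> (idn, w) = (\<phi>, c2_mult v w)"
  using assms by (simp add: semidirect_BPhi_simps compose_idn idn_apply)

text \<open>Instead of computing conjugates in the semidirect product, the proof applies
  \<open>h\<close> to \<open>s (n - 1) (xi (n - 1)) = d\<close> and to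
  \<open>xi j s j = s j (xi (j + 1))\<close> and cancels. The reduction in the statement includes
  \<open>j = n\<close>, where the word is empty.\<close>

lemma h_xi:
  assumes "1 \<le> j" "j \<le> n"
  shows "h (D.xi j) = (idn, c2_red [n, j])"
proof (cases "j = n")
  case True
  then show ?thesis
    using h.hom_one by (simp add: D.xi_n BPhi_one)
next
  case False
  then have "j \<le> n - 1" using assms by simp
  then show ?thesis
    using assms(1)
  proof (induction j rule: inc_induct)
    case base
    let ?b = "artD_gen n (n - 1)"
    have n1: "1 \<le> n - 1" "n - 1 < n" "n - 1 \<noteq> n" using two by auto
    have c: "?b \<in> carrier (ArtD n)" "D.xi (n - 1) \<in> carrier (ArtD n)" using n1 by auto
    have red: "c2_red [n, n - 1] = [n, n - 1]" using n1 by (simp add: c2_red_fixed_iff)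
    have m: "(idn, [n, n - 1]) \<in> carrier (semidirect_BPhi n)"
      using n1 by (simp add: semidirect_BPhi_simps idn_Bn Phi_iff C2_carrier_iff)
    have "?b \<otimes>\<^bsub>ArtD n\<^esub> D.xi (n - 1) = artD_gen n n"
      unfolding D.xi_top using c two by (simp add: artD_gen_closed)
    then have "h ?b \<otimes>\<^bsub>semidirect_BPhi n\<^esub> h (D.xi (n - 1)) = h (artD_gen n n)"
      using h.hom_mult[OF c] by simp
    also have "\<dots> = h ?b \<otimes>\<^bsub>semidirect_BPhi n\<^esub> (idn, [n, n - 1])"
      using n1 two red sigma_in_Bn[of "n - 1" n] mult_id[of "sigma_act n (n - 1)" "[]" "[n, n - 1]"]
      by (simp add: h_gen artD_img_def c2_mult_def)
    finally have "h (D.xi (n - 1)) = (idn, [n, n - 1])"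
      using K.Units_l_cancel[of "h ?b" "h (D.xi (n - 1))" "(idn, [n, n - 1])"] K.Units_eq h.hom_closed[OF c(1)] h.hom_closed[OF c(2)] m by simp
    then show ?case unfolding red .
  next
    case (step j)
    let ?s = "artD_gen n j"
    have j: "1 \<le> j" "j < n - 1" "j < n" "Suc j < n" using step by auto
    have c: "?s \<in> carrier (ArtD n)" "D.xi (Suc j) \<in> carrier (ArtD n)" "D.xi j \<in> carrier (ArtD n)" using j by auto
    have red: "c2_red [n, j] = [n, j]" "c2_red [n, Suc j] = [n, Suc j]" using j by (simp_all add: c2_red_fixed_iff)
    have mem: "[n, j] \<in> C2_carrier n" "[n, Suc j] \<in> C2_carrier n" using j by (auto simp: C2_carrier_iff)
    have m: "(idn, [n, j]) \<in> carrier (semidirect_BPhi n)"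
      using mem by (simp add: semidirect_BPhi_simps idn_Bn Phi_iff)
    have sB: "sigma_act n j \<in> Bn n" by (rule sigma_in_Bn[OF j(1,3)])
    have hs: "h ?s = (sigma_act n j, [])" using j by (simp add: h_gen artD_img_def)
    have "D.xi j \<otimes>\<^bsub>ArtD n\<^esub> ?s = ?s \<otimes>\<^bsub>ArtD n\<^esub> D.xi (Suc j)"
      using c D.conj_xi_self[OF j(1,2)] D.conj_by_move(1)[OF c(1,3)] by simp
    then have "h (D.xi j) \<otimes>\<^bsub>semidirect_BPhi n\<^esub> h ?s = h ?s \<otimes>\<^bsub>semidirect_BPhi n\<^esub> h (D.xi (Suc j))"
      using h.hom_mult[OF c(1,2)] h.hom_mult[OF c(3,1)] by simp
    also have "\<dots> = (sigma_act n j, [n, Suc j])"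
      unfolding hs using step mult_id[OF sB, of "[]"] red by (simp add: c2_mult_def)
    also have "\<dots> = (idn, [n, j]) \<otimes>\<^bsub>semidirect_BPhi n\<^esub> h ?s"
    proof -
      have "sigma_act n j [n, j] = [n, Suc j]"
        using mem red j by (simp add: sigma_act_apply sigma_img_def)
      then show ?thesis
        unfolding hs using compose_idn(2)[OF sB] red
        by (simp add: semidirect_BPhi_simps c2_mult_def)
    qed
    finally have "h (D.xi j) = (idn, [n, j])"
      using K.right_cancel[of "h ?s" "h (D.xi j)" "(idn, [n, j])"] h.hom_closed[OF c(1)] h.hom_closed[OF c(3)] m by simp
    then show ?case unfolding red .
  qed
qed

lemma h_inv_xi:
  assumes "1 \<le> j" "j \<le> n"
  shows "h (inv\<^bsub>ArtD n\<^esub> (D.xi j)) = (idn, c2_red [j, n])"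
proof -
  have mem: "c2_red [j, n] \<in> C2_carrier n" "c2_red [n, j] \<in> C2_carrier n"
    using assms by (auto intro!: c2_red_in_carrier)
  then have "(idn, c2_red [j, n]) \<in> carrier (semidirect_BPhi n)" "(idn, c2_red [n, j]) \<in> carrier (semidirect_BPhi n)"
    by (simp_all add: semidirect_BPhi_simps idn_Bn Phi_iff even_length_c2_red)
  moreover have "c2_red [j, n, n, j] = []" by (simp add: c2_red.simps(2))
  then have "(idn, c2_red [j, n]) \<otimes>\<^bsub>semidirect_BPhi n\<^esub> (idn, c2_red [n, j]) = \<one>\<^bsub>semidirect_BPhi n\<^esub>"
    using mem idn_Bn by (subst mult_id) (simp_all add: c2_mult_def BPhi_one)
  ultimately have "inv\<^bsub>semidirect_BPhi n\<^esub> (idn, c2_red [n, j]) = (idn, c2_red [j, n])"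
    by (intro K.inv_equality)
  then show ?thesis
    using h.hom_inv[of "D.xi j"] h_xi[OF assms] assms by simp
qed

text \<open>Taken two letters at a time: the product of \<open>inv (xi k)\<close> and
  \<open>xi l\<close> goes to the word \<open>k n n l\<close>, whose middle cancels. This puts the
  even words into the image.\<close>

lemma h_alt_prod:
  assumes "set w \<subseteq> {1..n}" "even (length w)"
  shows "h (D.alt_prod False w) = (idn, c2_red w)"
  using assms
proof (induction w rule: induct_list012)
  case 1
  then show ?case using h.hom_one by (simp add: BPhi_one)
next
  case (3 k l w)
  have kl: "1 \<le> k" "k \<le> n" "1 \<le> l" "l \<le> n" and w: "set w \<subseteq> {1..n}" "even (length w)" using 3 by auto
  have mem: "c2_red [k, n] \<in> C2_carrier n" "c2_red [n, l] \<in> C2_carrier n" "c2_red [k, l] \<in> C2_carrier n" "c2_red w \<in> C2_carrier n"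
    using kl w by (auto intro!: c2_red_in_carrier)
  have c: "D.xi k \<in> carrier (ArtD n)" "D.xi l \<in> carrier (ArtD n)" "D.alt_prod False w \<in> carrier (ArtD n)"
    using kl w by auto
  have "h (D.alt_prod False (k # l # w)) = (idn, c2_red [k, n]) \<otimes>\<^bsub>semidirect_BPhi n\<^esub>
      ((idn, c2_red [n, l]) \<otimes>\<^bsub>semidirect_BPhi n\<^esub> (idn, c2_red w))"
    using c h_inv_xi[OF kl(1,2)] h_xi[OF kl(3,4)] 3 w by (simp add: h.hom_mult)
  also have "\<dots> = (idn, c2_mult (c2_red [k, n]) (c2_mult (c2_red [n, l]) (c2_red w)))"
    using mem idn_Bn by (simp add: mult_id c2_mult_closed)
  also have "c2_mult (c2_red [k, n]) (c2_mult (c2_red [n, l]) (c2_red w)) = c2_red (k # l # w)"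
    using c2_red_cancel(2)[of "[k]" n "l # w"] by (simp add: c2_mult_def)
  finally show ?case .
qed simp

text \<open>\<open>alt_prod False\<close> recovers \<open>x\<close> from its image, so
  \<open>h\<close> is injective on \<open>xis\<close>. Multiplying by \<open>xi j\<close> appends
  the letters \<open>n, j\<close> to a word of even length, and these contribute
  \<open>inv (xi n)\<close> and \<open>xi j\<close>, the former being trivial; the inverse of
  \<open>xi j\<close> appends \<open>j, n\<close>.\<close>

lemma h_xis:
  assumes "x \<in> D.xis"
  shows "fst (h x) = idn \<and> D.alt_prod False (snd (h x)) = x"
  using D.xi_gens_subset assms unfolding D.xis_def
proof (induction x rule: D.generate_right_induct)
  case one
  then show ?case using h.hom_one by (simp add: BPhi_one)
next
  case (mult x y)
  then obtain j where j: "1 \<le> j" "j \<le> n - 1" "y = D.xi j" by auto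
  have jn: "1 \<le> j" "j \<le> n" "j \<noteq> n" using j two by auto
  have hy: "h y = (idn, [n, j])"
    using h_xi[OF jn(1,2)] j jn by (simp add: c2_red_fixed_iff)
  have sx: "snd (h x) \<in> C2_carrier n" "even (length (snd (h x)))" "set (snd (h x)) \<subseteq> {1..n}"
    using h_mem[OF mult.hyps(1)] by (auto simp: Phi_iff C2_carrier_def)
  have yc: "y \<in> carrier (ArtD n)" using j by simp
  have "h (x \<otimes>\<^bsub>ArtD n\<^esub> y) = (idn, c2_mult (snd (h x)) [n, j])"
    using h_mult[OF mult.hyps(1) yc] hy mult.IH sx by (simp add: compose_idn idn_Bn idn_apply)
  moreover have "D.alt_prod False (c2_mult (snd (h x)) [n, j]) = x \<otimes>\<^bsub>ArtD n\<^esub> y"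
    unfolding c2_mult_def using sx jn j mult.IH
    by (simp add: D.alt_prod_red D.alt_prod_append D.xi_n)
  ultimately show ?case by simp
next
  case (mult_inv x y)
  then obtain j where j: "1 \<le> j" "j \<le> n - 1" "y = D.xi j" by auto
  have jn: "1 \<le> j" "j \<le> n" "j \<noteq> n" using j two by auto
  have hy: "h (inv\<^bsub>ArtD n\<^esub> y) = (idn, [j, n])"
    using h_inv_xi[OF jn(1,2)] j jn by (simp add: c2_red_fixed_iff)
  have sx: "snd (h x) \<in> C2_carrier n" "even (length (snd (h x)))" "set (snd (h x)) \<subseteq> {1..n}"
    using h_mem[OF mult_inv.hyps(1)] by (auto simp: Phi_iff C2_carrier_def)
  have yc: "inv\<^bsub>ArtD n\<^esub> y \<in> carrier (ArtD n)" using j by simp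
  have "h (x \<otimes>\<^bsub>ArtD n\<^esub> inv\<^bsub>ArtD n\<^esub> y) = (idn, c2_mult (snd (h x)) [j, n])"
    using h_mult[OF mult_inv.hyps(1) yc] hy mult_inv.IH sx by (simp add: compose_idn idn_Bn idn_apply)
  moreover have "D.alt_prod False (c2_mult (snd (h x)) [j, n]) = x \<otimes>\<^bsub>ArtD n\<^esub> inv\<^bsub>ArtD n\<^esub> y"
    unfolding c2_mult_def using sx jn j mult_inv.IH
    by (simp add: D.alt_prod_red D.alt_prod_append D.xi_n)
  ultimately show ?case by simp
qed

lemma inv_pure:
  assumes "\<phi> \<in> Bn n"
  shows "inv\<^bsub>semidirect_BPhi n\<^esub> (\<phi>, []) = (inv\<^bsub>BijGroup (C2_carrier n)\<^esub> \<phi>, [])"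
proof (rule K.inv_equality)
  show "(inv\<^bsub>BijGroup (C2_carrier n)\<^esub> \<phi>, []) \<otimes>\<^bsub>semidirect_BPhi n\<^esub> (\<phi>, []) = \<one>\<^bsub>semidirect_BPhi n\<^esub>"
    using Bn_inverse(2)[OF assms] c2_endD(3)[OF Bn_facts(2)[OF assms]]
    by (simp add: semidirect_BPhi_simps c2_mult_def)
qed (use assms Bn_inverse(1)[OF assms] in \<open>auto simp: semidirect_BPhi_simps Phi_iff\<close>)

lemma h_braids:
  assumes "x \<in> D.braids (n - 1)"
  shows "snd (h x) = []"
proof -
  have sub: "artD_gen n ` {1..n - 1} \<subseteq> carrier (ArtD n)" by (auto simp: artD_gen_closed)
  have snd_mult: "snd (h (x \<otimes>\<^bsub>ArtD n\<^esub> y)) = []"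
    if "x \<in> carrier (ArtD n)" "y \<in> carrier (ArtD n)" "snd (h x) = []" "snd (h y) = []" for x y
    using that h_mult[OF that(1,2)] c2_endD(3)[OF R.act_end[OF that(2)]] by (simp add: c2_mult_def)
  have gen: "snd (h (artD_gen n i)) = [] \<and> snd (h (inv\<^bsub>ArtD n\<^esub> (artD_gen n i))) = []"
    if i: "1 \<le> i" "i \<le> n - 1" for i
  proof -
    have "h (artD_gen n i) = (sigma_act n i, [])"
      using i two by (simp add: h_gen artD_img_def)
    then show ?thesis
      using inv_pure[OF sigma_in_Bn, of i] i two h.hom_inv[of "artD_gen n i"] by (simp add: artD_gen_closed)
  qed
  show ?thesis
    using sub assms unfolding D.braids_def
  proof (induction x rule: D.generate_right_induct)
    case one
    then show ?case using h.hom_one by (simp add: BPhi_one)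
  next
    case (mult x y)
    then show ?case using gen sub by (intro snd_mult) auto
  next
    case (mult_inv x y)
    then show ?case using gen sub by (intro snd_mult) auto
  qed
qed

lemma ArtD_decomposition: "carrier (ArtD n) = D.braids (n - 1) <#>\<^bsub>ArtD n\<^esub> D.xis"
proof (rule D.carrier_decomposition)
  have "{1..n} = insert n {1..n - 1}" using two by auto
  then show "carrier (ArtD n) = generate (ArtD n) (insert (artD_gen n n) (artD_gen n ` {1..n - 1}))"
    using ArtD_generated[of n] by simp
qed

text \<open>Writing \<open>x = b v\<close> with \<open>b\<close> a braid word and \<open>v\<close>
  in \<open>xis\<close>, the first component of \<open>h x\<close> depends only on \<open>b\<close>
  and the second only on \<open>v\<close>. The factors can therefore be shown to be trivial one by
  one.\<close>

lemma h_kernel: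
  assumes "x \<in> carrier (ArtD n)" "h x = \<one>\<^bsub>semidirect_BPhi n\<^esub>"
  shows "x = \<one>\<^bsub>ArtD n\<^esub>"
proof -
  have n1: "n - 1 < n" using two by simp
  obtain b v where bv: "b \<in> D.braids (n - 1)" "v \<in> D.xis" "x = b \<otimes>\<^bsub>ArtD n\<^esub> v"
    using assms(1) unfolding ArtD_decomposition by (auto simp: set_mult_def)
  have c: "b \<in> carrier (ArtD n)" "v \<in> carrier (ArtD n)"
    using D.braids_carrier[OF bv(1) n1] subgroup.mem_carrier[OF D.subgroup_xis bv(2)] by auto
  note hv = h_xis[OF bv(2)]
  have "snd (h v) \<in> C2_carrier n" using h_mem[OF c(2)] by (simp add: Phi_iff)
  then have red: "c2_red (snd (h v)) = snd (h v)" by (simp add: C2_carrier_def)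
  have "h x = (fst (h b), snd (h v))"
    unfolding bv(3) using h_mult[OF c] hv h_braids[OF bv(1)] h_mem[OF c(1)] red
    by (simp add: c2_mult_def compose_idn idn_apply)
  then have "fst (h b) = idn" "snd (h v) = []"
    using assms(2) by (auto simp: BPhi_one)
  moreover from this have "v = \<one>\<^bsub>ArtD n\<^esub>" using hv by simp
  moreover have "b = \<one>\<^bsub>ArtD n\<^esub>"
    using R.braids_faithful[OF bv(1) n1] calculation(1) two by (simp add: C2_carrier_iff idn_apply)
  ultimately show ?thesis using bv(3) by simp
qed

lemma h_surj: "h ` carrier (ArtD n) = carrier (semidirect_BPhi n)"
proof
  show "h ` carrier (ArtD n) \<subseteq> carrier (semidirect_BPhi n)" using h.hom_closed by auto
  have sg: "subgroup (h ` carrier (ArtD n)) (semidirect_BPhi n)"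
    by (rule h.img_is_subgroup)
  have pure: "(\<phi>, []) \<in> h ` carrier (ArtD n)" if "\<phi> \<in> Bn n" for \<phi>
    using that unfolding Bn_def
  proof (induction \<phi> rule: generate.induct)
    case one
    have "\<one>\<^bsub>BijGroup (C2_carrier n)\<^esub> = idn"
      by (simp add: idn_def BijGroup_def)
    then show ?case
      using subgroup.one_closed[OF sg] BPhi_one by simp
  next
    case (incl \<phi>)
    then obtain i where i: "\<phi> = sigma_act n i" "1 \<le> i" "i < n" by auto
    then have "(\<phi>, []) = h (artD_gen n i)" by (simp add: h_gen artD_img_def)
    then show ?case using i by (auto simp: artD_gen_closed)
  next
    case (inv \<phi>)
    then obtain i where i: "\<phi> = sigma_act n i" "1 \<le> i" "i < n" by auto
    then have "(\<phi>, []) = h (artD_gen n i)" by (simp add: h_gen artD_img_def)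
    then have "(\<phi>, []) \<in> h ` carrier (ArtD n)" using i by (auto simp: artD_gen_closed)
    from subgroup.m_inv_closed[OF sg this] show ?case
      using inv_pure[OF sigma_in_Bn[OF i(2,3)]] i by simp
  next
    case (eng \<phi> \<psi>)
    then have B: "\<phi> \<in> Bn n" "\<psi> \<in> Bn n" by (simp_all add: Bn_def)
    \<comment> \<open>The factors are swapped because \<open>BijGroup\<close> composes from right to
      left and the semidirect product from left to right.\<close>
    have "(\<psi>, []) \<otimes>\<^bsub>semidirect_BPhi n\<^esub> (\<phi>, []) = (compose (C2_carrier n) \<phi> \<psi>, [])"
      using c2_endD(3)[OF Bn_facts(2)[OF B(1)]] by (simp add: semidirect_BPhi_simps c2_mult_def)
    then show ?case
      using subgroup.m_closed[OF sg eng.IH(2,1)] Bn_facts(1)[OF B(1)] Bn_facts(1)[OF B(2)] by (simp add: BijGroup_def)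
  qed
  show "carrier (semidirect_BPhi n) \<subseteq> h ` carrier (ArtD n)"
  proof
    fix y assume "y \<in> carrier (semidirect_BPhi n)"
    then obtain \<phi> w where y: "y = (\<phi>, w)" "\<phi> \<in> Bn n" "w \<in> Phi n" by (auto simp: semidirect_BPhi_simps)
    then have w: "set w \<subseteq> {1..n}" "even (length w)" "c2_red w = w" by (auto simp: Phi_iff C2_carrier_def)
    have iw: "(idn, w) \<in> h ` carrier (ArtD n)"
      using h_alt_prod[OF w(1,2)] w by (metis D.alt_prod_closed image_eqI)
    show "y \<in> h ` carrier (ArtD n)"
      using subgroup.m_closed[OF sg pure[OF y(2)] iw] mult_id[OF y(2), of "[]" w] y w by (simp add: c2_mult_def)
  qed
qed

lemma h_iso: "h \<in> iso (ArtD n) (semidirect_BPhi n)"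
proof (rule isoI[OF h_hom])
  have "inj_on h (carrier (ArtD n))"
    using h_kernel by (subst h.inj_on_one_iff) blast
  then show "bij_betw h (carrier (ArtD n)) (carrier (semidirect_BPhi n))"
    using h_surj by (simp add: bij_betw_def)
qed

end

theorem theorem9p3:
  fixes n :: nat
  assumes "n \<ge> 2"
  shows "\<exists>h. h \<in> iso (ArtD n) (semidirect_BPhi n)
           \<and> (\<forall>i \<in> {1..n-1}. h (artD_gen n i) = sd_sigma n i)
           \<and> h (artD_gen n n) =
               sd_sigma n (n - 1) \<otimes>\<^bsub>semidirect_BC n\<^esub> sd_tau n n
                 \<otimes>\<^bsub>semidirect_BC n\<^esub> sd_tau n (n - 1)"
proof -
  obtain h where "h \<in> hom (ArtD n) (semidirect_BPhi n)" "\<And>i. i \<in> {1..n} \<Longrightarrow> h (artD_gen n i) = artD_img n i"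
    using ArtD_hom[OF assms] by blast
  then interpret artD_map n h using assms by unfold_locales
  have n1: "1 \<le> n - 1" "n - 1 < n" "n - 1 \<noteq> n" using assms by auto
  note \<sigma> = sigma_in_Bn[OF n1(1,2)]
  have mem: "[n] \<in> C2_carrier n" "[n, n - 1] \<in> C2_carrier n" using n1 by (auto simp: C2_carrier_iff)
  \<comment> \<open>The product has to be evaluated in \<open>semidirect_BC\<close>: single letters
    have odd length and lie outside \<open>Phi n\<close>, though the result lies in the
    subgroup.\<close>
  have "sd_sigma n (n - 1) \<otimes>\<^bsub>semidirect_BC n\<^esub> sd_tau n n \<otimes>\<^bsub>semidirect_BC n\<^esub> sd_tau n (n - 1)
      = (sigma_act n (n - 1), [n, n - 1])"
    using mem Id_compose[OF Bn_facts(4)[OF \<sigma>] Bn_facts(3)[OF \<sigma>]]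
    by (simp add: sd_sigma_def sd_tau_def semidirect_simps c2_mult_def) (simp add: C2_carrier_def)
  then have "h (artD_gen n n) = sd_sigma n (n - 1) \<otimes>\<^bsub>semidirect_BC n\<^esub> sd_tau n n \<otimes>\<^bsub>semidirect_BC n\<^esub> sd_tau n (n - 1)"
    using assms by (simp add: h_gen artD_img_def)
  moreover have "\<forall>i \<in> {1..n-1}. h (artD_gen n i) = sd_sigma n i"
    using n1 by (auto simp: h_gen artD_img_def sd_sigma_def)
  ultimately show ?thesis using h_iso by blast
qed

end
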